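(* Suppose that $\Theta\in\mathscr{S}[A,C;B,D]$. Then for any $x\in\mathbb{R}^n$, $$\mathcal{U}_{ad}(x)=\big\{\Theta X_\Theta(\cdot\,;x,v(\cdot))+v(\cdot)\ \big|\ v(\cdot)\in L^2_{\mathbb{F}}(\mathbb{R}^m)\big\},$$ where $X_\Theta(\cdot\,;x,v(\cdot))$ is the solution of the SDE $$\left\{\begin{array}{l}dX_\Theta(t)=\big[(A+B\Theta)X_\Theta(t)+Bv(t)+b(t)\big]dt+\big[(C+D\Theta)X_\Theta(t)+Dv(t)+\sigma(t)\big]dW(t),\quad t\geq0,\\ X_\Theta(0)=x.\end{array}\right.$$
   Context: $(\Omega,\mathcal{F},\mathbb{F},\mathbb{P})$ is a complete filtered probability space carrying a standard one-dimensional Brownian motion $W=\{W(t);t\geq0\}$; $\mathbb{F}$ is the natural filtration of $W$ augmented by all $\mathbb{P}$-null sets. $L^2_{\mathbb{F}}(\mathbb{H})$ is the space of $\mathbb{F}$-progressively measurable $\varphi:[0,\infty)\times\Omega\to\mathbb{H}$ with $\mathbb{E}\int_0^\infty|\varphi(t)|^2dt<\infty$. $\mathcal{X}[0,\infty)$ is the set of $\mathbb{F}$-adapted continuous $\mathbb{R}^n$-valued processes $X$ with $\mathbb{E}(\sup_{0\le t\le T}|X(t)|^2)<\infty$ for every $T>0$ and $\mathbb{E}\int_0^\infty|X(t)|^2dt<\infty$. $A,C\in\mathbb{R}^{n\times n}$ and $B,D\in\mathbb{R}^{n\times m}$ are constant matrices and $b,\sigma\in L^2_{\mathbb{F}}(\mathbb{R}^n)$.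 For $x\in\mathbb{R}^n$ and $u\in L^2_{\mathbb{F}}(\mathbb{R}^m)$, $X(\cdot;x,u(\cdot))$ is the solution of $$dX(t)=[AX(t)+Bu(t)+b(t)]dt+[CX(t)+Du(t)+\sigma(t)]dW(t),\ t\geq0,\qquad X(0)=x,$$ and $\mathcal{U}_{ad}(x)=\{u(\cdot)\in L^2_{\mathbb{F}}(\mathbb{R}^m): \mathbb{E}\int_0^\infty|X(t;x,u(\cdot))|^2dt<\infty\}$. For $A',C'\in\mathbb{R}^{n\times n}$, $[A',C']$ is $L^2$-stable if for every $x\in\mathbb{R}^n$ the solution of $dX=A'X\,dt+C'X\,dW$, $X(0)=x$, is in $\mathcal{X}[0,\infty)$. $\mathscr{S}[A,C;B,D]$ is the set of all $\Theta\in\mathbb{R}^{m\times n}$ such that $[A+B\Theta,C+D\Theta]$ is $L^2$-stable. *)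

theory Defs
  imports "HOL-Probability.Probability"
begin

text \<open>
  Time is the half-line \<open>t \<ge> 0\<close> inside \<^typ>\<open>real\<close>, and processes are functions
  \<open>real \<Rightarrow> 'a \<Rightarrow> 'b\<close> whose values at negative times are never used.
\<close>

definition augmented_filtration :: "'a measure \<Rightarrow> (real \<Rightarrow> 'a \<Rightarrow> real) \<Rightarrow> real \<Rightarrow> 'a measure" where
  "augmented_filtration M W t =
     sigma (space M)
       ({W s -` S \<inter> space M | s S. 0 \<le> s \<and> s \<le> t \<and> S \<in> sets borel} \<union> null_sets M)"

text \<open>
  A standard one-dimensional Brownian motion on a complete probability space, relative to its own
  augmented filtration. The second parameter of \<^const>\<open>normal_density\<close> is the standard deviation.
\<close>

definition brownian_basis :: "'a measure \<Rightarrow> (real \<Rightarrow> 'a \<Rightarrow> real) \<Rightarrow> bool" where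
  "brownian_basis M W \<longleftrightarrow>
     prob_space M \<and> complete_measure M \<and>
     (\<forall>t\<ge>0. W t \<in> borel_measurable M) \<and>
     (AE \<omega> in M. W 0 \<omega> = 0 \<and> continuous_on {0..} (\<lambda>t. W t \<omega>)) \<and>
     (\<forall>s t. 0 \<le> s \<and> s < t \<longrightarrow>
        distributed M lborel (\<lambda>\<omega>. W t \<omega> - W s \<omega>) (normal_density 0 (sqrt (t - s))) \<and>
        prob_space.indep_set M
          (sets (augmented_filtration M W s))
          {(\<lambda>\<omega>. W t \<omega> - W s \<omega>) -` S \<inter> space M | S. S \<in> sets borel})"

definition adapted ::
  "'a measure \<Rightarrow> (real \<Rightarrow> 'a \<Rightarrow> real) \<Rightarrow> (real \<Rightarrow> 'a \<Rightarrow> 'b::euclidean_space) \<Rightarrow> bool" where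
  "adapted M W \<phi> \<longleftrightarrow> (\<forall>t\<ge>0. \<phi> t \<in> borel_measurable (augmented_filtration M W t))"

definition progressive ::
  "'a measure \<Rightarrow> (real \<Rightarrow> 'a \<Rightarrow> real) \<Rightarrow> (real \<Rightarrow> 'a \<Rightarrow> 'b::euclidean_space) \<Rightarrow> bool" where
  "progressive M W \<phi> \<longleftrightarrow>
     (\<forall>T\<ge>0. (\<lambda>(t, \<omega>). \<phi> t \<omega>) \<in>
        borel_measurable (restrict_space borel {0..T} \<Otimes>\<^sub>M augmented_filtration M W T))"

definition sq_integrable ::
  "'a measure \<Rightarrow> (real \<Rightarrow> 'a \<Rightarrow> 'b::euclidean_space) \<Rightarrow> bool" where
  "sq_integrable M \<phi> \<longleftrightarrow>
     (\<integral>\<^sup>+ \<omega>. (\<integral>\<^sup>+ t\<in>{0..}. ennreal ((norm (\<phi> t \<omega>))\<^sup>2) \<partial>lborel) \<partial>M) < \<infinity>"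

definition L2F ::
  "'a measure \<Rightarrow> (real \<Rightarrow> 'a \<Rightarrow> real) \<Rightarrow> (real \<Rightarrow> 'a \<Rightarrow> 'b::euclidean_space) set" where
  "L2F M W = {\<phi>. progressive M W \<phi> \<and> sq_integrable M \<phi>}"

definition adapted_continuous ::
  "'a measure \<Rightarrow> (real \<Rightarrow> 'a \<Rightarrow> real) \<Rightarrow> (real \<Rightarrow> 'a \<Rightarrow> 'b::euclidean_space) \<Rightarrow> bool" where
  "adapted_continuous M W X \<longleftrightarrow>
     adapted M W X \<and> (\<forall>\<omega>\<in>space M. continuous_on {0..} (\<lambda>t. X t \<omega>))"

definition X_space ::
  "'a measure \<Rightarrow> (real \<Rightarrow> 'a \<Rightarrow> real) \<Rightarrow> (real \<Rightarrow> 'a \<Rightarrow> 'b::euclidean_space) set" where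
  "X_space M W =
     {X. adapted_continuous M W X \<and>
         (\<forall>T>0. (\<integral>\<^sup>+ \<omega>. (SUP t\<in>{0..T}. ennreal ((norm (X t \<omega>))\<^sup>2)) \<partial>M) < \<infinity>) \<and>
         sq_integrable M X}"

text \<open>
  The Ito integral over \<open>[0, T]\<close>. An elementary process
  \<open>\<Sum>i<n. \<xi> i * 1 {\<tau> i <.. \<tau> (Suc i)}\<close> has bounded coefficients \<open>\<xi> i\<close> known at time \<open>\<tau> i\<close>, and its
  integral is the corresponding sum of increments of \<open>W\<close> stopped at \<open>T\<close>. In general the integral
  of a progressive process is the mean-square limit of the integrals of elementary processes that
  approximate it in mean square on \<open>[0, T] \<times> \<Omega>\<close>. It is unique up to null sets, so it is given as a
  relation.
\<close>

definition elementary ::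
  "'a measure \<Rightarrow> (real \<Rightarrow> 'a \<Rightarrow> real) \<Rightarrow> nat \<Rightarrow> (nat \<Rightarrow> real) \<Rightarrow>
     (nat \<Rightarrow> 'a \<Rightarrow> 'b::euclidean_space) \<Rightarrow> bool" where
  "elementary M W n \<tau> \<xi> \<longleftrightarrow>
     0 \<le> \<tau> 0 \<and> (\<forall>i<n. \<tau> i \<le> \<tau> (Suc i)) \<and>
     (\<forall>i<n. \<xi> i \<in> borel_measurable (augmented_filtration M W (\<tau> i)) \<and>
            bounded (\<xi> i ` space M))"

definition elementary_process ::
  "nat \<Rightarrow> (nat \<Rightarrow> real) \<Rightarrow> (nat \<Rightarrow> 'a \<Rightarrow> 'b::euclidean_space) \<Rightarrow> real \<Rightarrow> 'a \<Rightarrow> 'b" where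
  "elementary_process n \<tau> \<xi> s \<omega> = (\<Sum>i<n. indicator {\<tau> i<..\<tau> (Suc i)} s *\<^sub>R \<xi> i \<omega>)"

definition elementary_integral ::
  "(real \<Rightarrow> 'a \<Rightarrow> real) \<Rightarrow> nat \<Rightarrow> (nat \<Rightarrow> real) \<Rightarrow> (nat \<Rightarrow> 'a \<Rightarrow> 'b::euclidean_space) \<Rightarrow>
     real \<Rightarrow> 'a \<Rightarrow> 'b" where
  "elementary_integral W n \<tau> \<xi> T \<omega> =
     (\<Sum>i<n. (W (min T (\<tau> (Suc i))) \<omega> - W (min T (\<tau> i)) \<omega>) *\<^sub>R \<xi> i \<omega>)"

definition has_ito_integral ::
  "'a measure \<Rightarrow> (real \<Rightarrow> 'a \<Rightarrow> real) \<Rightarrow> (real \<Rightarrow> 'a \<Rightarrow> 'b::euclidean_space) \<Rightarrow> real \<Rightarrow>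
     ('a \<Rightarrow> 'b) \<Rightarrow> bool" where
  "has_ito_integral M W \<phi> T J \<longleftrightarrow>
     progressive M W \<phi> \<and> J \<in> borel_measurable M \<and>
     (\<exists>n \<tau> \<xi>.
        (\<forall>k::nat. elementary M W (n k) (\<tau> k) (\<xi> k)) \<and>
        (\<lambda>k. \<integral>\<^sup>+ \<omega>. (\<integral>\<^sup>+ s\<in>{0..T}.
               ennreal ((norm (elementary_process (n k) (\<tau> k) (\<xi> k) s \<omega> - \<phi> s \<omega>))\<^sup>2) \<partial>lborel) \<partial>M)
          \<longlonglongrightarrow> 0 \<and>
        (\<lambda>k. \<integral>\<^sup>+ \<omega>.
               ennreal ((norm (elementary_integral W (n k) (\<tau> k) (\<xi> k) T \<omega> - J \<omega>))\<^sup>2) \<partial>M)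
          \<longlonglongrightarrow> 0)"

text \<open>
  \<open>X\<close> solves \<open>dX = (A X + \<beta>) dt + (C X + \<gamma>) dW\<close>, \<open>X 0 = x\<close>. For \<open>\<beta>\<close> and \<open>\<gamma>\<close> in \<open>L2F\<close> there is
  exactly one such \<open>X\<close> up to indistinguishability.
\<close>

definition sde_solution ::
  "'a measure \<Rightarrow> (real \<Rightarrow> 'a \<Rightarrow> real) \<Rightarrow> real^'n^'n \<Rightarrow> real^'n^'n \<Rightarrow>
     (real \<Rightarrow> 'a \<Rightarrow> real^'n) \<Rightarrow> (real \<Rightarrow> 'a \<Rightarrow> real^'n) \<Rightarrow> real^'n \<Rightarrow>
     (real \<Rightarrow> 'a \<Rightarrow> real^'n) \<Rightarrow> bool" where
  "sde_solution M W A C \<beta> \<gamma> x X \<longleftrightarrow>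
     adapted_continuous M W X \<and>
     (\<forall>t\<ge>0. \<exists>J. has_ito_integral M W (\<lambda>s \<omega>. C *v X s \<omega> + \<gamma> s \<omega>) t J \<and>
        (AE \<omega> in M. X t \<omega> = x + (LINT s:{0..t}|lborel. A *v X s \<omega> + \<beta> s \<omega>) + J \<omega>))"

definition controlled_solution ::
  "'a measure \<Rightarrow> (real \<Rightarrow> 'a \<Rightarrow> real) \<Rightarrow> real^'n^'n \<Rightarrow> real^'n^'n \<Rightarrow> real^'m^'n \<Rightarrow> real^'m^'n \<Rightarrow>
     (real \<Rightarrow> 'a \<Rightarrow> real^'n) \<Rightarrow> (real \<Rightarrow> 'a \<Rightarrow> real^'n) \<Rightarrow> real^'n \<Rightarrow>
     (real \<Rightarrow> 'a \<Rightarrow> real^'m) \<Rightarrow> (real \<Rightarrow> 'a \<Rightarrow> real^'n) \<Rightarrow> bool" where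
  "controlled_solution M W A C B D b \<sigma> x u X \<longleftrightarrow>
     sde_solution M W A C (\<lambda>t \<omega>. B *v u t \<omega> + b t \<omega>) (\<lambda>t \<omega>. D *v u t \<omega> + \<sigma> t \<omega>) x X"

text \<open>
  ``The solution has property \<open>P\<close>'' is read as: there is a solution, and every solution has \<open>P\<close>.
\<close>

definition admissible_controls ::
  "'a measure \<Rightarrow> (real \<Rightarrow> 'a \<Rightarrow> real) \<Rightarrow> real^'n^'n \<Rightarrow> real^'n^'n \<Rightarrow> real^'m^'n \<Rightarrow> real^'m^'n \<Rightarrow>
     (real \<Rightarrow> 'a \<Rightarrow> real^'n) \<Rightarrow> (real \<Rightarrow> 'a \<Rightarrow> real^'n) \<Rightarrow> real^'n \<Rightarrow>
     (real \<Rightarrow> 'a \<Rightarrow> real^'m) set" where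
  "admissible_controls M W A C B D b \<sigma> x =
     {u \<in> L2F M W.
        (\<exists>X. controlled_solution M W A C B D b \<sigma> x u X) \<and>
        (\<forall>X. controlled_solution M W A C B D b \<sigma> x u X \<longrightarrow> sq_integrable M X)}"

definition L2_stable ::
  "'a measure \<Rightarrow> (real \<Rightarrow> 'a \<Rightarrow> real) \<Rightarrow> real^'n^'n \<Rightarrow> real^'n^'n \<Rightarrow> bool" where
  "L2_stable M W A C \<longleftrightarrow>
     (\<forall>x. (\<exists>X. sde_solution M W A C (\<lambda>_ _. 0) (\<lambda>_ _. 0) x X) \<and>
          (\<forall>X. sde_solution M W A C (\<lambda>_ _. 0) (\<lambda>_ _. 0) x X \<longrightarrow> X \<in> X_space M W))"

definition stabilizers ::
  "'a measure \<Rightarrow> (real \<Rightarrow> 'a \<Rightarrow> real) \<Rightarrow> real^'n^'n \<Rightarrow> real^'n^'n \<Rightarrow> real^'m^'n \<Rightarrow> real^'m^'n \<Rightarrow>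
     (real^'n^'m) set" where
  "stabilizers M W A C B D = {\<Theta>. L2_stable M W (A + B ** \<Theta>) (C + D ** \<Theta>)}"

end

theory Submission
  imports Defs
begin

text \<open>
  With \<open>u = \<Theta> X + v\<close> the open-loop and the closed-loop equations have the same coefficients, so
  they have the same solutions. What has to be proved is that closed-loop solutions are square
  integrable over \<open>[0, \<infinity>)\<close> whenever \<open>v\<close> is, and that square integrability does not depend on the
  version of the solution.

  For the former, the expectation of Ito's formula for a quadratic form gives
  \<open>E \<langle>P X(T), X(T)\<rangle> = \<langle>P x, x\<rangle> + E \<integral>\<^bsub>[0, T]\<^esub> \<langle>L(P) X, X\<rangle> + \<dots>\<close>, where
  \<open>L(P) = A\<^sup>T P + P A + C\<^sup>T P C\<close> and the dots vanish for the homogeneous equation. If \<open>L(P) \<le> 0\<close> and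
  the homogeneous solutions are square integrable, then \<open>P \<ge> 0\<close>; hence \<open>L\<close> is injective on
  symmetric matrices, and there is \<open>P \<ge> 0\<close> with \<open>L(P) = - I\<close>. For this \<open>P\<close> the identity bounds
  \<open>E \<integral>\<^bsub>[0, T]\<^esub> |X|\<^sup>2\<close> uniformly in \<open>T\<close>, also for the inhomogeneous equation.
\<close>

subsection \<open>Square integrable functions\<close>


text \<open>The integral is a relation at one fixed horizon, given by mean-square limits, so every
  stochastic argument has to survive such limits. Two facts do: the isometry, polarised to
  \<open>E h(J, K) = E \<integral> h(\<phi>, \<psi>)\<close> for a bilinear form \<open>h\<close>,
  and the martingale property tested against square integrable variables of the earlier time. Forms
  are kept general because the inner product, flipped forms and \<open>y \<bullet> (P *v z)\<close>
  all occur. A solution comes without second moments, and \<open>C\<close> may be singular, so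
  square integrability of \<open>C X + \<gamma>\<close> does not give that of \<open>X\<close>; a
  Gronwall argument in expectation would presuppose finiteness. Continuity bounds each path on
  \<open>[0, T]\<close>, so Gronwall is applied path by path and averaged afterwards. That
  \<open>P \<ge> 0\<close> rests on the infinite horizon: if
  \<open>\<langle>P x, x\<rangle> < 0\<close> and \<open>L(P) \<le> 0\<close>, then
  \<open>E |X(t)|\<^sup>2\<close> stays away from zero for all \<open>t\<close>, against
  integrability. For symmetric \<open>S\<close> with \<open>L(S) = 0\<close> this applies to
  \<open>S\<close> and to \<open>-S\<close>, whence \<open>S = 0\<close>.\<close>

definition L2 :: "'a measure \<Rightarrow> ('a \<Rightarrow> 'b::euclidean_space) \<Rightarrow> bool" where
  "L2 N f \<longleftrightarrow> f \<in> borel_measurable N \<and> integrable N (\<lambda>x. (norm (f x))\<^sup>2)"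

lemma L2_measurable: "L2 N f \<Longrightarrow> f \<in> borel_measurable N"
  by (simp add: L2_def)

lemma L2I_nn_integral:
  assumes "f \<in> borel_measurable N" "(\<integral>\<^sup>+x. ennreal ((norm (f x))\<^sup>2) \<partial>N) < \<infinity>"
  shows "L2 N f"
  using assms by (auto simp: L2_def integrable_iff_bounded)

lemma L2_nn_integral:
  assumes "L2 N f"
  shows "(\<integral>\<^sup>+x. ennreal ((norm (f x))\<^sup>2) \<partial>N) = ennreal (\<integral>x. (norm (f x))\<^sup>2 \<partial>N)"
  using assms by (auto simp: L2_def intro!: nn_integral_eq_integral)

lemma norm_add_power2_le:
  fixes x y :: "'b::real_normed_vector"
  shows "(norm (x + y))\<^sup>2 \<le> 2 * (norm x)\<^sup>2 + 2 * (norm y)\<^sup>2"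
proof -
  have "(norm (x + y))\<^sup>2 \<le> (norm x + norm y)\<^sup>2"
    by (intro power_mono norm_triangle_ineq) simp
  also have "\<dots> \<le> 2 * (norm x)\<^sup>2 + 2 * (norm y)\<^sup>2"
    using sum_squares_bound[of "norm x" "norm y"] by (simp add: power2_sum)
  finally show ?thesis .
qed

lemma L2_bound:
  assumes "f \<in> borel_measurable N" "L2 N g" "\<And>x. x \<in> space N \<Longrightarrow> norm (f x) \<le> K * norm (g x)"
  shows "L2 N f"
  unfolding L2_def
proof (intro conjI)
  show "integrable N (\<lambda>x. (norm (f x))\<^sup>2)"
  proof (rule Bochner_Integration.integrable_bound[where f="\<lambda>x. K\<^sup>2 * (norm (g x))\<^sup>2"])
    show "AE x in N. norm ((norm (f x))\<^sup>2) \<le> norm (K\<^sup>2 * (norm (g x))\<^sup>2)"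
      using power_mono[OF assms(3) norm_ge_zero, of _ 2]
      by (simp add: power_mult_distrib abs_mult)
  qed (use assms in \<open>auto simp: L2_def\<close>)
qed fact

lemma L2_add:
  assumes "L2 N f" "L2 N g"
  shows "L2 N (\<lambda>x. f x + g x)"
  unfolding L2_def
proof (intro conjI)
  show "integrable N (\<lambda>x. (norm (f x + g x))\<^sup>2)"
    by (rule Bochner_Integration.integrable_bound
        [where f="\<lambda>x. 2 * (norm (f x))\<^sup>2 + 2 * (norm (g x))\<^sup>2"])
      (use assms in \<open>auto simp: L2_def norm_add_power2_le\<close>)
qed (use assms in \<open>auto simp: L2_def\<close>)

lemma L2_linear:
  assumes "L2 N f" "bounded_linear F"
  shows "L2 N (\<lambda>x. F (f x))"
proof -
  obtain K where "\<And>x. norm (F x) \<le> norm x * K"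
    using bounded_linear.bounded[OF assms(2)] by blast
  moreover have "F \<in> borel_measurable borel"
    using assms(2) by (simp add: borel_measurable_continuous_onI linear_continuous_on)
  ultimately show ?thesis
    using assms(1) by (intro L2_bound[OF _ assms(1), of _ K]) (auto simp: L2_def mult.commute)
qed

lemma L2_diff:
  assumes "L2 N f" "L2 N g"
  shows "L2 N (\<lambda>x. f x - g x)"
  using L2_add[OF assms(1) L2_linear[OF assms(2), of uminus]]
  by (simp add: bounded_linear_minus)

lemma L2_sum:
  assumes "\<And>i. i \<in> I \<Longrightarrow> L2 N (f i)"
  shows "L2 N (\<lambda>x. \<Sum>i\<in>I. f i x)"
  using assms
proof (induction I rule: infinite_finite_induct)
  case (insert i I)
  then show ?case by (simp add: L2_add)
qed (simp_all add: L2_def)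

lemma L2_cong_AE:
  assumes "L2 N f" "g \<in> borel_measurable N" "AE x in N. g x = f x"
  shows "L2 N g"
proof (rule L2I_nn_integral[OF assms(2)])
  have "(\<integral>\<^sup>+x. ennreal ((norm (g x))\<^sup>2) \<partial>N) = (\<integral>\<^sup>+x. ennreal ((norm (f x))\<^sup>2) \<partial>N)"
    using assms(3) by (intro nn_integral_cong_AE) (auto elim: eventually_mono)
  then show "(\<integral>\<^sup>+x. ennreal ((norm (g x))\<^sup>2) \<partial>N) < \<infinity>"
    using L2_nn_integral[OF assms(1)] by simp
qed

lemma L2_bounded:
  assumes "finite_measure N" "f \<in> borel_measurable N" "\<And>x. x \<in> space N \<Longrightarrow> norm (f x) \<le> K"
  shows "L2 N f"
proof -
  interpret finite_measure N by fact
  have "L2 N (\<lambda>_. 1::real)" by (simp add: L2_def)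
  then show ?thesis by (rule L2_bound[OF assms(2)]) (use assms(3) in auto)
qed

lemma nn_integral_norm_add_le:
  fixes f g :: "'c \<Rightarrow> 'b::euclidean_space"
  assumes "f \<in> borel_measurable N" "g \<in> borel_measurable N"
  shows "(\<integral>\<^sup>+x. ennreal ((norm (f x + g x))\<^sup>2) \<partial>N) \<le>
    2 * (\<integral>\<^sup>+x. ennreal ((norm (f x))\<^sup>2) \<partial>N) + 2 * (\<integral>\<^sup>+x. ennreal ((norm (g x))\<^sup>2) \<partial>N)"
proof -
  have "(\<integral>\<^sup>+x. ennreal ((norm (f x + g x))\<^sup>2) \<partial>N) \<le>
      (\<integral>\<^sup>+x. 2 * ennreal ((norm (f x))\<^sup>2) + 2 * ennreal ((norm (g x))\<^sup>2) \<partial>N)"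
    by (intro nn_integral_mono) (simp add: norm_add_power2_le flip: ennreal_mult' ennreal_numeral ennreal_plus)
  also have "\<dots> = 2 * (\<integral>\<^sup>+x. ennreal ((norm (f x))\<^sup>2) \<partial>N) + 2 * (\<integral>\<^sup>+x. ennreal ((norm (g x))\<^sup>2) \<partial>N)"
    using assms by (simp add: nn_integral_add nn_integral_cmult)
  finally show ?thesis .
qed

text \<open>One approximant at finite distance is enough: \<open>f = e k - (e k - f)\<close> is a
  difference of two square integrable functions.\<close>

lemma L2_of_approximation:
  fixes f :: "'c \<Rightarrow> 'b::euclidean_space"
  assumes "\<And>k. L2 N (e k)" "f \<in> borel_measurable N"
    and lim: "(\<lambda>k::nat. \<integral>\<^sup>+x. ennreal ((norm (e k x - f x))\<^sup>2) \<partial>N) \<longlonglongrightarrow> 0"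
  shows "L2 N f"
proof -
  have "eventually (\<lambda>k. (\<integral>\<^sup>+x. ennreal ((norm (e k x - f x))\<^sup>2) \<partial>N) < 1) sequentially"
    by (rule order_tendstoD(2)[OF lim]) simp
  then obtain k where k: "(\<integral>\<^sup>+x. ennreal ((norm (e k x - f x))\<^sup>2) \<partial>N) < 1"
    by (auto dest: eventually_happens)
  have "L2 N (\<lambda>x. e k x - f x)"
    using assms(1)[of k] assms(2) less_trans[OF k, of \<infinity>]
    by (intro L2I_nn_integral) (auto dest: L2_measurable)
  from L2_diff[OF assms(1)[of k] this] show ?thesis by simp
qed

text \<open>A negative \<open>T\<close> gives the empty space with measure zero, so the statement
  covers every real horizon.\<close>

lemma finite_measure_restrict_Icc: "finite_measure (restrict_space lborel {0..T::real})"
  by (cases "0 \<le> T")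
    (auto intro!: finite_measureI simp: emeasure_restrict_space space_restrict_space)

section \<open>Bilinear forms of square integrable functions and their mean-square limits\<close>

lemma bilinear_borel_measurable:
  fixes h :: "'b::euclidean_space \<Rightarrow> 'c::euclidean_space \<Rightarrow> 'd::real_normed_vector"
  assumes "bounded_bilinear h" "f \<in> borel_measurable N" "g \<in> borel_measurable N"
  shows "(\<lambda>x. h (f x) (g x)) \<in> borel_measurable N"
proof (rule borel_measurable_continuous_Pair[OF assms(2,3)])
  show "continuous_on UNIV (\<lambda>x. h (fst x) (snd x))"
    by (intro bounded_bilinear.continuous_on[OF assms(1)] continuous_intros)
qed

text \<open>Young's inequality with a free weight \<open>d\<close>, without the sharp factor 1/2. It
  takes the place of Cauchy-Schwarz in the integral estimates below, where the weight is chosen to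
  suit.\<close>

lemma mult_le_weighted_squares:
  fixes a b d :: real
  assumes "d > 0" "a \<ge> 0" "b \<ge> 0"
  shows "a * b \<le> a\<^sup>2 / d + d * b\<^sup>2"
proof -
  have "2 * (a * b) \<le> a\<^sup>2 / d + d * b\<^sup>2"
    using sum_squares_bound[of "a / sqrt d" "sqrt d * b"] assms
    by (simp add: power_mult_distrib power_divide)
  moreover have "0 \<le> a * b" using assms by simp
  ultimately show ?thesis by linarith
qed

lemma L2_bilinear_integrable:
  fixes f :: "'a \<Rightarrow> 'b::euclidean_space" and g :: "'a \<Rightarrow> 'c::euclidean_space"
    and h :: "'b \<Rightarrow> 'c \<Rightarrow> real"
  assumes h: "bounded_bilinear h" and "L2 N f" "L2 N g"
  shows "integrable N (\<lambda>x. h (f x) (g x))"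
proof -
  obtain K where K: "K > 0" "\<And>x y. norm (h x y) \<le> norm x * norm y * K"
    using bounded_bilinear.pos_bounded[OF h] by blast
  show ?thesis
  proof (rule Bochner_Integration.integrable_bound
      [where f="\<lambda>x. ((norm (f x))\<^sup>2 + (norm (g x))\<^sup>2) * K"])
    show "AE x in N. norm (h (f x) (g x)) \<le> norm (((norm (f x))\<^sup>2 + (norm (g x))\<^sup>2) * K)"
    proof (rule AE_I2)
      fix x
      have "norm (f x) * norm (g x) \<le> (norm (f x))\<^sup>2 + (norm (g x))\<^sup>2"
        using mult_le_weighted_squares[of 1 "norm (f x)" "norm (g x)"] by simp
      then have "norm (f x) * norm (g x) * K \<le> ((norm (f x))\<^sup>2 + (norm (g x))\<^sup>2) * K"
        using K(1) by simp
      also have "\<dots> = norm (((norm (f x))\<^sup>2 + (norm (g x))\<^sup>2) * K)" using K(1) by simp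
      finally show "norm (h (f x) (g x)) \<le> norm (((norm (f x))\<^sup>2 + (norm (g x))\<^sup>2) * K)"
        using K(2)[of "f x" "g x"] by linarith
    qed
  qed (use assms in \<open>auto simp: L2_def bilinear_borel_measurable\<close>)
qed

text \<open>The difference of the two integrands splits into three terms, each containing at least
  one of the errors \<open>fs k - f\<close> and \<open>gs k - g\<close>. The product of both errors
  is small at once; in the mixed terms a weight that tends to zero with \<open>k\<close> is put on
  the fixed function, and the error is divided by it.\<close>

lemma L2_bilinear_tendsto:
  fixes f :: "'a \<Rightarrow> 'b::euclidean_space" and g :: "'a \<Rightarrow> 'c::euclidean_space"
    and h :: "'b \<Rightarrow> 'c \<Rightarrow> real"
  assumes h: "bounded_bilinear h"
    and L2: "L2 N f" "L2 N g" "\<And>k. L2 N (fs k)" "\<And>k. L2 N (gs k)"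
    and f: "(\<lambda>k. \<integral>\<^sup>+x. ennreal ((norm (fs k x - f x))\<^sup>2) \<partial>N) \<longlonglongrightarrow> 0"
    and g: "(\<lambda>k. \<integral>\<^sup>+x. ennreal ((norm (gs k x - g x))\<^sup>2) \<partial>N) \<longlonglongrightarrow> 0"
  shows "(\<lambda>k. \<integral>x. h (fs k x) (gs k x) \<partial>N) \<longlonglongrightarrow> (\<integral>x. h (f x) (g x) \<partial>N)"
proof -
  interpret bounded_bilinear h by fact
  obtain K where K: "K > 0" "\<And>x y. norm (h x y) \<le> norm x * norm y * K"
    using pos_bounded by blast
  define a where "a k = (\<integral>x. (norm (fs k x - f x))\<^sup>2 \<partial>N)" for k
  define b where "b k = (\<integral>x. (norm (gs k x - g x))\<^sup>2 \<partial>N)" for k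
  define F where "F = (\<integral>x. (norm (f x))\<^sup>2 \<partial>N)"
  define G where "G = (\<integral>x. (norm (g x))\<^sup>2 \<partial>N)"
  define s where "s k = sqrt (a k + b k)" for k
  \<comment> \<open>The weight has to tend to zero, yet so slowly that
    \<open>(a k + b k) / d k\<close> still does. Since \<open>a k + b k\<close> is the square of
    \<open>s k\<close>, any \<open>d k\<close> above \<open>s k\<close> gives a quotient of at most
    \<open>s k\<close>; the summand \<open>1 / (real k + 1)\<close> keeps the weight positive when
    \<open>s k\<close> vanishes.\<close>
  define d where "d k = s k + 1 / (real k + 1)" for k
  have a0: "a k \<ge> 0" and b0: "b k \<ge> 0" and F0: "F \<ge> 0" and G0: "G \<ge> 0" for k
    by (simp_all add: a_def b_def F_def G_def)
  have fd: "L2 N (\<lambda>x. fs k x - f x)" and gd: "L2 N (\<lambda>x. gs k x - g x)" for k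
    using L2 by (simp_all add: L2_diff)
  have "a \<longlonglongrightarrow> 0"
    using f a0 unfolding L2_nn_integral[OF fd] a_def[symmetric]
    by (simp flip: ennreal_0)
  moreover have "b \<longlonglongrightarrow> 0"
    using g b0 unfolding L2_nn_integral[OF gd] b_def[symmetric]
    by (simp flip: ennreal_0)
  ultimately have "(\<lambda>k. sqrt (a k + b k)) \<longlonglongrightarrow> sqrt (0 + 0)"
    by (intro tendsto_intros)
  then have s: "s \<longlonglongrightarrow> 0" by (simp add: s_def[abs_def])
  have s0: "s k \<ge> 0" for k using a0 b0 by (simp add: s_def)
  have d0: "d k > 0" for k using s0[of k] unfolding d_def by (simp add: add_nonneg_pos)
  have d: "d \<longlonglongrightarrow> 0"
    using tendsto_add[OF s LIMSEQ_inverse_real_of_nat]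
    by (simp add: d_def[abs_def] inverse_eq_divide add.commute)
  have bound: "\<bar>(\<integral>x. h (fs k x) (gs k x) \<partial>N) - (\<integral>x. h (f x) (g x) \<partial>N)\<bar>
      \<le> ((s k)\<^sup>2 + s k + d k * (F + G)) * K" for k
  proof -
    let ?B = "\<lambda>x. ((norm (fs k x - f x))\<^sup>2 + (norm (gs k x - g x))\<^sup>2 +
        (((norm (fs k x - f x))\<^sup>2 + (norm (gs k x - g x))\<^sup>2) / d k +
         d k * ((norm (f x))\<^sup>2 + (norm (g x))\<^sup>2))) * K"
    have int: "integrable N (\<lambda>x. h (fs k x) (gs k x))" "integrable N (\<lambda>x. h (f x) (g x))"
      using L2 by (auto intro: L2_bilinear_integrable[OF h])
    have intB: "integrable N ?B"
      using L2 fd gd unfolding L2_def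
      by (intro integrable_mult_left Bochner_Integration.integrable_add integrable_divide
          integrable_mult_right) auto
    have pw: "\<bar>h (fs k x) (gs k x) - h (f x) (g x)\<bar> \<le> ?B x" for x
    proof -
      let ?u = "norm (fs k x - f x)" and ?v = "norm (gs k x - g x)"
      have "h (fs k x) (gs k x) - h (f x) (g x) =
          h (fs k x - f x) (gs k x - g x) + h (fs k x - f x) (g x) + h (f x) (gs k x - g x)"
        by (simp add: diff_left diff_right)
      then have "\<bar>h (fs k x) (gs k x) - h (f x) (g x)\<bar> \<le>
          \<bar>h (fs k x - f x) (gs k x - g x)\<bar> + \<bar>h (fs k x - f x) (g x)\<bar> + \<bar>h (f x) (gs k x - g x)\<bar>"
        by linarith
      also have "\<dots> \<le> ?u * ?v * K + ?u * norm (g x) * K + norm (f x) * ?v * K"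
        by (intro add_mono K(2)[unfolded real_norm_def])
      also have "\<dots> = (?u * ?v + ?u * norm (g x) + ?v * norm (f x)) * K"
        by (simp add: algebra_simps)
      also have "\<dots> \<le> ((?u\<^sup>2 + ?v\<^sup>2) + (?u\<^sup>2 / d k + d k * (norm (g x))\<^sup>2) +
          (?v\<^sup>2 / d k + d k * (norm (f x))\<^sup>2)) * K"
        using K(1) d0[of k] mult_le_weighted_squares[of 1 ?u ?v]
        by (intro mult_right_mono add_mono mult_le_weighted_squares) auto
      also have "\<dots> = ?B x" by (simp add: algebra_simps add_divide_distrib)
      finally show ?thesis .
    qed
    have "\<bar>(\<integral>x. h (fs k x) (gs k x) \<partial>N) - (\<integral>x. h (f x) (g x) \<partial>N)\<bar> =
        \<bar>\<integral>x. h (fs k x) (gs k x) - h (f x) (g x) \<partial>N\<bar>"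
      using int by simp
    also have "\<dots> \<le> (\<integral>x. \<bar>h (fs k x) (gs k x) - h (f x) (g x)\<bar> \<partial>N)"
      by (rule integral_abs_bound)
    also have "\<dots> \<le> (\<integral>x. ?B x \<partial>N)"
      using int intB pw by (intro integral_mono) auto
    also have "\<dots> = (a k + b k + ((a k + b k) / d k + d k * (F + G))) * K"
      using L2 fd gd unfolding L2_def a_def b_def F_def G_def
      by (simp add: Bochner_Integration.integrable_add integrable_divide integrable_mult_right)
    also have "(a k + b k) / d k \<le> s k"
    proof -
      have "a k + b k = s k * s k" using a0 b0 by (simp add: s_def)
      also have "\<dots> \<le> s k * d k" by (intro mult_left_mono s0) (simp add: d_def)
      finally show ?thesis using d0[of k] by (simp add: field_simps)
    qed
    also have "a k + b k = (s k)\<^sup>2" using a0 b0 by (simp add: s_def)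
    finally show ?thesis using K(1) by (simp add: add.assoc)
  qed
  have "(\<lambda>k. ((s k)\<^sup>2 + s k + d k * (F + G)) * K) \<longlonglongrightarrow> (0\<^sup>2 + 0 + 0 * (F + G)) * K"
    by (intro tendsto_intros s d)
  then have "(\<lambda>k. ((s k)\<^sup>2 + s k + d k * (F + G)) * K) \<longlonglongrightarrow> 0" by simp
  then have "(\<lambda>k. (\<integral>x. h (fs k x) (gs k x) \<partial>N) - (\<integral>x. h (f x) (g x) \<partial>N)) \<longlonglongrightarrow> 0"
    by (rule Lim_null_comparison[rotated]) (use bound in auto)
  then show ?thesis by (simp add: LIM_zero_iff)
qed

subsection \<open>Brownian increments\<close>

locale brownian =
  fixes M :: "'a measure" and W :: "real \<Rightarrow> 'a \<Rightarrow> real"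
  assumes basis: "brownian_basis M W"
begin

sublocale prob_space M
  using basis by (simp add: brownian_basis_def)

abbreviation "\<F> \<equiv> augmented_filtration M W"

lemma W_measurable: "0 \<le> t \<Longrightarrow> W t \<in> borel_measurable M"
  using basis by (simp add: brownian_basis_def)

lemma space_filtration [simp]: "space (\<F> t) = space M"
  by (simp add: augmented_filtration_def space_measure_of_conv)

lemma sets_filtration:
  "sets (\<F> t) = sigma_sets (space M)
     ({W s -` S \<inter> space M | s S. 0 \<le> s \<and> s \<le> t \<and> S \<in> sets borel} \<union> null_sets M)"
  unfolding augmented_filtration_def
  by (rule sets_measure_of) (auto dest: null_setsD2 sets.sets_into_space)

lemma filtration_mono: "s \<le> t \<Longrightarrow> sets (\<F> s) \<subseteq> sets (\<F> t)"
  unfolding sets_filtration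
proof (intro sigma_sets_mono' Un_mono subset_refl subsetI)
  fix A assume "s \<le> t" "A \<in> {W r -` S \<inter> space M | r S. 0 \<le> r \<and> r \<le> s \<and> S \<in> sets borel}"
  then obtain r S where "A = W r -` S \<inter> space M" "0 \<le> r" "r \<le> t" "S \<in> sets borel"
    by fastforce
  then show "A \<in> {W r -` S \<inter> space M | r S. 0 \<le> r \<and> r \<le> t \<and> S \<in> sets borel}"
    by blast
qed

lemma subalgebra_filtration: "subalgebra M (\<F> t)"
proof -
  have "sets (\<F> t) \<subseteq> sets M"
    unfolding sets_filtration
    using measurable_sets[OF W_measurable]
    by (intro sets.sigma_sets_subset Un_least) auto
  then show ?thesis by (simp add: subalgebra_def)
qed

lemma measurable_filtration: "f \<in> measurable (\<F> t) N \<Longrightarrow> f \<in> measurable M N"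
  by (rule measurable_from_subalg[OF subalgebra_filtration])

lemma measurable_filtration_mono:
  assumes "f \<in> measurable (\<F> s) N" "s \<le> t"
  shows "f \<in> measurable (\<F> t) N"
proof (rule measurable_from_subalg[OF _ assms(1)])
  show "subalgebra (\<F> t) (\<F> s)"
    using filtration_mono[OF assms(2)] unfolding subalgebra_def space_filtration by blast
qed

lemma W_measurable_filtration: "0 \<le> s \<Longrightarrow> s \<le> t \<Longrightarrow> W s \<in> borel_measurable (\<F> t)"
proof (rule measurableI)
  fix S :: "real set" assume st: "0 \<le> s" "s \<le> t" and S: "S \<in> sets borel"
  show "W s -` S \<inter> space (\<F> t) \<in> sets (\<F> t)"
    unfolding sets_filtration space_filtration
    by (intro sigma_sets.Basic UnI1 CollectI exI conjI) (rule refl, rule st, rule st, rule S)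
qed simp

text \<open>\<open>indep_var\<close> speaks of generated sigma-algebras. The preimages under the
  increment already form one, and the one generated by \<open>Y\<close> lies inside that of the
  filtration at time \<open>s\<close>, so the independence in \<open>brownian_basis\<close> only has
  to be restricted.\<close>

lemma W_increment_indep:
  assumes "0 \<le> s" "s < t" "Y \<in> borel_measurable (\<F> s)"
  shows "indep_var borel Y borel (\<lambda>\<omega>. W t \<omega> - W s \<omega>)"
  unfolding indep_var_eq
proof (intro conjI)
  let ?V = "\<lambda>\<omega>. W t \<omega> - W s \<omega>"
  show "Y \<in> borel_measurable M" using assms(3) by (rule measurable_filtration)
  show V: "?V \<in> borel_measurable M"
    using assms by (intro borel_measurable_diff W_measurable) auto
  define B where "B = {?V -` S \<inter> space M | S. S \<in> sets borel}"
  define A where "A = sigma_sets (space M) {Y -` S \<inter> space M | S. S \<in> sets borel}"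
  have ind: "indep_set (sets (\<F> s)) B"
    using basis assms(1,2) unfolding B_def brownian_basis_def by blast
  have B: "sigma_sets (space M) B = B"
    unfolding B_def sets_vimage_algebra[symmetric] by (rule sets_vimage_algebra2) simp
  have "A \<subseteq> sets (\<F> s)"
    unfolding A_def
  proof (rule sets.sigma_sets_subset[of _ "\<F> s", unfolded space_filtration])
    show "{Y -` S \<inter> space M | S. S \<in> sets borel} \<subseteq> sets (\<F> s)"
      using measurable_sets[OF assms(3)] unfolding space_filtration by blast
  qed
  then have "indep_set A B" using ind unfolding indep_sets2_eq by blast
  then have "indep_set A (sigma_sets (space M) B)" unfolding B .
  then show "indep_set (sigma_sets (space M) {Y -` A \<inter> space M | A. A \<in> sets borel})
      (sigma_sets (space M) {?V -` A \<inter> space M | A. A \<in> sets borel})"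
    unfolding A_def B_def .
qed

text \<open>The case \<open>s = t\<close> is included because truncating intervals at a horizon
  produces empty ones, whereas the distribution is prescribed only for \<open>s < t\<close>.\<close>

lemma W_increment_moments:
  assumes "0 \<le> s" "s \<le> t"
  shows "integrable M (\<lambda>\<omega>. W t \<omega> - W s \<omega>)"
    and "integrable M (\<lambda>\<omega>. (W t \<omega> - W s \<omega>)\<^sup>2)"
    and "expectation (\<lambda>\<omega>. W t \<omega> - W s \<omega>) = 0"
    and "expectation (\<lambda>\<omega>. (W t \<omega> - W s \<omega>)\<^sup>2) = t - s"
proof -
  have "integrable M (\<lambda>\<omega>. W t \<omega> - W s \<omega>) \<and> integrable M (\<lambda>\<omega>. (W t \<omega> - W s \<omega>)\<^sup>2) \<and>
    expectation (\<lambda>\<omega>. W t \<omega> - W s \<omega>) = 0 \<and> expectation (\<lambda>\<omega>. (W t \<omega> - W s \<omega>)\<^sup>2) = t - s"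
  proof (cases "s = t")
    case False
    then have st: "s < t" using assms by simp
    let ?\<sigma> = "sqrt (t - s)"
    have \<sigma>: "0 < ?\<sigma>" using st by simp
    have D: "distributed M lborel (\<lambda>\<omega>. W t \<omega> - W s \<omega>) (normal_density 0 ?\<sigma>)"
      using basis assms(1) st by (simp add: brownian_basis_def)
    have E: "expectation (\<lambda>\<omega>. W t \<omega> - W s \<omega>) = 0"
      by (rule normal_distributed_expectation[OF \<sigma> D])
    moreover have "integrable M (\<lambda>\<omega>. W t \<omega> - W s \<omega>)"
      using distributed_integrable[OF D, of "\<lambda>x. x"] integrable_normal_moment[OF \<sigma>, of 0 1]
      by simp
    moreover have "integrable M (\<lambda>\<omega>. (W t \<omega> - W s \<omega>)\<^sup>2)"
      using distributed_integrable[OF D, of "\<lambda>x. x\<^sup>2"] integrable_normal_moment[OF \<sigma>, of 0 2]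
      by simp
    moreover have "expectation (\<lambda>\<omega>. (W t \<omega> - W s \<omega>)\<^sup>2) = t - s"
      using normal_distributed_variance[OF \<sigma> D] st unfolding E by simp
    ultimately show ?thesis by simp
  qed simp
  then show "integrable M (\<lambda>\<omega>. W t \<omega> - W s \<omega>)"
    and "integrable M (\<lambda>\<omega>. (W t \<omega> - W s \<omega>)\<^sup>2)"
    and "expectation (\<lambda>\<omega>. W t \<omega> - W s \<omega>) = 0"
    and "expectation (\<lambda>\<omega>. (W t \<omega> - W s \<omega>)\<^sup>2) = t - s"
    by auto
qed

lemma W_increment_mult:
  assumes "0 \<le> s" "s \<le> t" "Y \<in> borel_measurable (\<F> s)" "integrable M Y"
  shows "integrable M (\<lambda>\<omega>. (W t \<omega> - W s \<omega>) * Y \<omega>)"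
    and "expectation (\<lambda>\<omega>. (W t \<omega> - W s \<omega>) * Y \<omega>) = 0"
proof -
  have "integrable M (\<lambda>\<omega>. (W t \<omega> - W s \<omega>) * Y \<omega>) \<and>
    expectation (\<lambda>\<omega>. (W t \<omega> - W s \<omega>) * Y \<omega>) = 0"
  proof (cases "s = t")
    case False
    then have "s < t" using assms by simp
    note ind = W_increment_indep[OF assms(1) this assms(3)]
    note W = W_increment_moments[OF assms(1,2)]
    show ?thesis
      using indep_var_integrable[OF ind assms(4) W(1)]
        indep_var_lebesgue_integral[OF ind assms(4) W(1)] W(3)
      by (simp add: mult.commute)
  qed simp
  then show "integrable M (\<lambda>\<omega>. (W t \<omega> - W s \<omega>) * Y \<omega>)"
    and "expectation (\<lambda>\<omega>. (W t \<omega> - W s \<omega>) * Y \<omega>) = 0" by auto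
qed

lemma W_increment_square_mult:
  assumes "0 \<le> s" "s \<le> t" "Y \<in> borel_measurable (\<F> s)" "integrable M Y"
  shows "integrable M (\<lambda>\<omega>. (W t \<omega> - W s \<omega>)\<^sup>2 * Y \<omega>)"
    and "expectation (\<lambda>\<omega>. (W t \<omega> - W s \<omega>)\<^sup>2 * Y \<omega>) = (t - s) * expectation Y"
proof -
  have "integrable M (\<lambda>\<omega>. (W t \<omega> - W s \<omega>)\<^sup>2 * Y \<omega>) \<and>
    expectation (\<lambda>\<omega>. (W t \<omega> - W s \<omega>)\<^sup>2 * Y \<omega>) = (t - s) * expectation Y"
  proof (cases "s = t")
    case False
    then have "s < t" using assms by simp
    have "indep_var borel ((\<lambda>x. x) \<circ> Y) borel ((\<lambda>x. x\<^sup>2) \<circ> (\<lambda>\<omega>. W t \<omega> - W s \<omega>))"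
      by (rule indep_var_compose[OF W_increment_indep[OF assms(1) \<open>s < t\<close> assms(3)]]) auto
    then have ind: "indep_var borel Y borel (\<lambda>\<omega>. (W t \<omega> - W s \<omega>)\<^sup>2)"
      by (simp add: comp_def)
    note W = W_increment_moments[OF assms(1,2)]
    show ?thesis
      using indep_var_integrable[OF ind assms(4) W(2)]
        indep_var_lebesgue_integral[OF ind assms(4) W(2)] W(4)
      by (simp add: mult.commute)
  qed simp
  then show "integrable M (\<lambda>\<omega>. (W t \<omega> - W s \<omega>)\<^sup>2 * Y \<omega>)"
    and "expectation (\<lambda>\<omega>. (W t \<omega> - W s \<omega>)\<^sup>2 * Y \<omega>) = (t - s) * expectation Y" by auto
qed

text \<open>Here boundedness of \<open>Z\<close> stands in for independence: \<open>Z\<close> may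
  depend on the increment, as happens when \<open>Z\<close> is known only at a time after
  \<open>s\<close>.\<close>

lemma W_increment_bounded_mult_integrable:
  assumes "0 \<le> s" "s \<le> t" "Z \<in> borel_measurable M" "\<And>\<omega>. \<omega> \<in> space M \<Longrightarrow> \<bar>Z \<omega>\<bar> \<le> K"
  shows "integrable M (\<lambda>\<omega>. (W t \<omega> - W s \<omega>) * Z \<omega>)"
proof (rule Bochner_Integration.integrable_bound[where f="\<lambda>\<omega>. (W t \<omega> - W s \<omega>) * K"])
  show "AE \<omega> in M. norm ((W t \<omega> - W s \<omega>) * Z \<omega>) \<le> norm ((W t \<omega> - W s \<omega>) * K)"
  proof (rule AE_I2)
    fix \<omega> assume "\<omega> \<in> space M"
    then have "\<bar>Z \<omega>\<bar> \<le> \<bar>K\<bar>" using assms(4) by fastforce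
    then show "norm ((W t \<omega> - W s \<omega>) * Z \<omega>) \<le> norm ((W t \<omega> - W s \<omega>) * K)"
      by (simp add: abs_mult mult_left_mono)
  qed
qed (use assms(3) W_increment_moments[OF assms(1,2)] in auto)

text \<open>The increments over \<open>[a, b]\<close> and \<open>[c, d]\<close> are split at \<open>c\<close> and at \<open>min b d\<close>; only the
  square of the increment over the overlap has a nonzero expectation.\<close>

lemma W_increment_product:
  assumes "0 \<le> a" "a \<le> b" "a \<le> c" "c \<le> d" "Z \<in> borel_measurable (\<F> c)"
    and Z: "\<And>\<omega>. \<omega> \<in> space M \<Longrightarrow> \<bar>Z \<omega>\<bar> \<le> K"
  shows "integrable M (\<lambda>\<omega>. (W b \<omega> - W a \<omega>) * (W d \<omega> - W c \<omega>) * Z \<omega>)" (is "?I")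
    and "expectation (\<lambda>\<omega>. (W b \<omega> - W a \<omega>) * (W d \<omega> - W c \<omega>) * Z \<omega>) =
      max 0 (min b d - c) * expectation Z" (is "?E")
proof -
  have ZM: "Z \<in> borel_measurable M" using assms(5) by (rule measurable_filtration)
  have intZ: "integrable M Z"
    by (rule integrable_const_bound[where B=K]) (use Z ZM in auto)
  \<comment> \<open>The later increment, over \<open>[t, u]\<close>, is centred and independent of
    everything known at time \<open>t\<close>. The earlier increment and \<open>Z\<close> are both
    known then.\<close>
  have 1: "integrable M (\<lambda>\<omega>. (W u \<omega> - W t \<omega>) * ((W s \<omega> - W r \<omega>) * Z \<omega>)) \<and>
      expectation (\<lambda>\<omega>. (W u \<omega> - W t \<omega>) * ((W s \<omega> - W r \<omega>) * Z \<omega>)) = 0"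
    if "0 \<le> r" "r \<le> s" "s \<le> t" "t \<le> u" "c \<le> t" for r s t u
  proof -
    have "Z \<in> borel_measurable (\<F> t)" using assms(5) that by (auto intro: measurable_filtration_mono)
    moreover have "W s \<in> borel_measurable (\<F> t)" "W r \<in> borel_measurable (\<F> t)"
      using that by (auto intro: W_measurable_filtration)
    ultimately have "(\<lambda>\<omega>. (W s \<omega> - W r \<omega>) * Z \<omega>) \<in> borel_measurable (\<F> t)" by simp
    then show ?thesis
      using W_increment_mult[of t u] W_increment_bounded_mult_integrable[OF _ _ ZM Z] that by simp
  qed
  have c: "0 \<le> c" using assms by simp
  consider (sep) "b \<le> c" | (2) "c \<le> b" "b \<le> d" | (3) "c \<le> b" "d \<le> b" by linarith
  then have "?I \<and> ?E"
  proof cases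
    case sep
    have "max 0 (min b d - c) = 0" using sep by simp
    moreover have "(\<lambda>\<omega>. (W b \<omega> - W a \<omega>) * (W d \<omega> - W c \<omega>) * Z \<omega>) =
        (\<lambda>\<omega>. (W d \<omega> - W c \<omega>) * ((W b \<omega> - W a \<omega>) * Z \<omega>))" by (simp add: algebra_simps)
    ultimately show ?thesis using 1[of a b c d] assms sep by simp
  next
    case 2
    have "max 0 (min b d - c) = b - c" using 2 by simp
    moreover have "(\<lambda>\<omega>. (W b \<omega> - W a \<omega>) * (W d \<omega> - W c \<omega>) * Z \<omega>) =
        (\<lambda>\<omega>. (W d \<omega> - W b \<omega>) * ((W b \<omega> - W a \<omega>) * Z \<omega>) +
             (W b \<omega> - W c \<omega>) * ((W c \<omega> - W a \<omega>) * Z \<omega>) + (W b \<omega> - W c \<omega>)\<^sup>2 * Z \<omega>)"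
      by (simp add: algebra_simps power2_eq_square)
    ultimately show ?thesis
      using 1[of a b b d] 1[of a c c b] W_increment_square_mult[OF c 2(1) assms(5) intZ] assms 2
      by simp
  next
    case 3
    have "max 0 (min b d - c) = d - c" using 3 assms by simp
    moreover have "(\<lambda>\<omega>. (W b \<omega> - W a \<omega>) * (W d \<omega> - W c \<omega>) * Z \<omega>) =
        (\<lambda>\<omega>. (W b \<omega> - W d \<omega>) * ((W d \<omega> - W c \<omega>) * Z \<omega>) +
             (W d \<omega> - W c \<omega>) * ((W c \<omega> - W a \<omega>) * Z \<omega>) + (W d \<omega> - W c \<omega>)\<^sup>2 * Z \<omega>)"
      by (simp add: algebra_simps power2_eq_square)
    ultimately show ?thesis
      using 1[of c d d b] 1[of a c c d] W_increment_square_mult[OF c assms(4) assms(5) intZ] assms 3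
      by simp
  qed
  then show ?I ?E by auto
qed

subsection \<open>The Ito isometry\<close>

text \<open>The second factor carries all of \<open>M\<close>, not the sigma-algebra of time
  \<open>T\<close>: this space serves for norms and for Fubini, while adaptedness stays in
  \<open>progressive\<close>. Restricting Lebesgue measure makes it a finite measure space.\<close>

definition time_space :: "real \<Rightarrow> (real \<times> 'a) measure" where
  "time_space T = restrict_space lborel {0..T} \<Otimes>\<^sub>M M"

lemma pair_sigma_finite_time_space: "pair_sigma_finite (restrict_space lborel {0..T::real}) M"
proof -
  interpret T: finite_measure "restrict_space lborel {0..T::real}"
    by (rule finite_measure_restrict_Icc)
  show ?thesis ..
qed

lemma finite_measure_time_space: "finite_measure (time_space T)"
  unfolding time_space_def
  by (rule finite_measure_pair_measure) (rule finite_measure_axioms, rule finite_measure_restrict_Icc)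

lemma space_time_space: "space (time_space T) = {0..T} \<times> space M"
  by (simp add: time_space_def space_pair_measure space_restrict_space)

lemma sets_time_space: "sets (time_space T) = sets (restrict_space borel {0..T} \<Otimes>\<^sub>M M)"
  unfolding time_space_def by (intro sets_pair_measure_cong sets_restrict_space_cong) simp_all

lemma measurable_time_space_cong:
  "measurable (time_space T) N = measurable (restrict_space borel {0..T} \<Otimes>\<^sub>M M) N"
  by (rule measurable_cong_sets) (simp_all add: sets_time_space)

lemma measurable_time_fst [measurable]: "fst \<in> borel_measurable (time_space T)"
proof -
  have "fst \<in> measurable (time_space T) (restrict_space borel {0..T})"
    unfolding measurable_time_space_cong by (rule measurable_fst)
  then show ?thesis by (rule measurable_restrict_space2_iff[THEN iffD1, THEN conjunct1])
qed

lemma measurable_time_snd [measurable]: "snd \<in> measurable (time_space T) M"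
  unfolding measurable_time_space_cong by (rule measurable_snd)

text \<open>Tonelli, in the order of integration that \<open>sq_integrable\<close> and
  \<open>has_ito_integral\<close> prescribe: time inside, expectation outside.\<close>

lemma nn_integral_time_space:
  assumes "f \<in> borel_measurable (time_space T)"
  shows "(\<integral>\<^sup>+p. f p \<partial>time_space T) = (\<integral>\<^sup>+\<omega>. (\<integral>\<^sup>+t\<in>{0..T}. f (t, \<omega>) \<partial>lborel) \<partial>M)"
proof -
  interpret pair_sigma_finite "restrict_space lborel {0..T}" M
    by (rule pair_sigma_finite_time_space)
  show ?thesis
    unfolding time_space_def using nn_integral_snd[of f] assms
    by (simp add: time_space_def nn_integral_restrict_space)
qed

lemma nn_integral_time_space_mono:
  assumes "0 \<le> s" "s \<le> t" "f \<in> borel_measurable (time_space s)" "f \<in> borel_measurable (time_space t)"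
  shows "(\<integral>\<^sup>+p. f p \<partial>time_space s) \<le> (\<integral>\<^sup>+p. f p \<partial>time_space t)"
  unfolding nn_integral_time_space[OF assms(3)] nn_integral_time_space[OF assms(4)]
  using assms(1,2) by (intro nn_integral_mono mult_left_mono) (auto simp: indicator_def)

lemma progressive_measurable:
  assumes "progressive M W \<phi>" "0 \<le> T"
  shows "(\<lambda>p. \<phi> (fst p) (snd p)) \<in> borel_measurable (time_space T)"
proof -
  have "(\<lambda>p. (fst p, snd p)) \<in>
      measurable (time_space T) (restrict_space borel {0..T} \<Otimes>\<^sub>M \<F> T)"
  proof (rule measurable_Pair)
    show "fst \<in> measurable (time_space T) (restrict_space borel {0..T})"
      unfolding measurable_time_space_cong by (rule measurable_fst)
    show "snd \<in> measurable (time_space T) (\<F> T)"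
      by (rule measurable_compose[OF measurable_time_snd, of "\<lambda>x. x"])
        (rule measurable_from_subalg[OF subalgebra_filtration measurable_ident_sets[OF refl]])
  qed
  moreover have "(\<lambda>(t, \<omega>). \<phi> t \<omega>) \<in> borel_measurable (restrict_space borel {0..T} \<Otimes>\<^sub>M \<F> T)"
    using assms unfolding progressive_def by blast
  ultimately have "(\<lambda>p. case (fst p, snd p) of (t, \<omega>) \<Rightarrow> \<phi> t \<omega>) \<in> borel_measurable (time_space T)"
    by (rule measurable_compose)
  then show ?thesis by (simp only: prod.case)
qed

text \<open>Progressive processes are adapted: take the horizon \<open>t\<close> itself and the
  section at its right end.\<close>

lemma progressive_measurable_filtration:
  assumes "progressive M W \<phi>" "0 \<le> t"
  shows "\<phi> t \<in> borel_measurable (\<F> t)"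
proof -
  have "(\<lambda>\<omega>. (t, \<omega>)) \<in> measurable (\<F> t) (restrict_space borel {0..t} \<Otimes>\<^sub>M \<F> t)"
    using assms(2) by (intro measurable_Pair) (auto simp: space_restrict_space)
  moreover have "(\<lambda>(t, \<omega>). \<phi> t \<omega>) \<in> borel_measurable (restrict_space borel {0..t} \<Otimes>\<^sub>M \<F> t)"
    using assms unfolding progressive_def by blast
  ultimately have "(\<lambda>\<omega>. case (t, \<omega>) of (t, \<omega>) \<Rightarrow> \<phi> t \<omega>) \<in> borel_measurable (\<F> t)"
    by (rule measurable_compose)
  then show ?thesis by simp
qed

lemma elementary_progressive:
  fixes \<xi> :: "nat \<Rightarrow> 'a \<Rightarrow> 'b::euclidean_space"
  assumes "elementary M W n \<tau> \<xi>"
  shows "progressive M W (elementary_process n \<tau> \<xi>)"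
  unfolding progressive_def elementary_process_def split_beta
proof (intro allI impI borel_measurable_sum)
  fix T :: real and i assume T: "0 \<le> T" and i: "i \<in> {..<n}"
  let ?N = "restrict_space borel {0..T} \<Otimes>\<^sub>M \<F> T"
  have fst: "fst \<in> borel_measurable ?N"
    by (rule measurable_restrict_space2_iff[THEN iffD1, THEN conjunct1], rule measurable_fst)
  show "(\<lambda>p. indicator {\<tau> i<..\<tau> (Suc i)} (fst p) *\<^sub>R \<xi> i (snd p)) \<in> borel_measurable ?N"
  proof (cases "\<tau> i \<le> T")
    case True
    have "\<xi> i \<in> borel_measurable (\<F> T)"
      using assms i True by (auto simp: elementary_def intro: measurable_filtration_mono)
    then have "(\<lambda>p. \<xi> i (snd p)) \<in> borel_measurable ?N"
      by (rule measurable_compose[OF measurable_snd])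
    moreover have "(\<lambda>p. indicat_real {\<tau> i<..\<tau> (Suc i)} (fst p)) \<in> borel_measurable ?N"
      by (rule measurable_compose[OF fst]) simp
    ultimately show ?thesis by (rule borel_measurable_scaleR[rotated])
  next
    \<comment> \<open>Here \<open>\<xi> i\<close> may not be known at time \<open>T\<close>, but the
      step begins after \<open>T\<close> and vanishes on \<open>[0, T]\<close>.\<close>
    case False
    have "(\<lambda>p. indicator {\<tau> i<..\<tau> (Suc i)} (fst p) *\<^sub>R \<xi> i (snd p)) \<in> borel_measurable ?N
        \<longleftrightarrow> (\<lambda>p. 0::'b) \<in> borel_measurable ?N"
      using False by (intro measurable_cong)
        (auto simp: space_pair_measure space_restrict_space indicator_def)
    then show ?thesis by simp
  qed
qed

text \<open>Since \<open>a \<le> c\<close>, both coefficients are known at time \<open>c\<close>,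
  hence so is \<open>h (\<xi> \<omega>) (\<zeta> \<omega>)\<close>, and the formula for products of
  increments applies. Both sides are then the length of the overlap of the two intervals within
  \<open>[0, T]\<close>, multiplied by the expectation of this variable.\<close>

lemma step_isometry_ordered:
  fixes h :: "'b::euclidean_space \<Rightarrow> 'c::euclidean_space \<Rightarrow> real"
  assumes h: "bounded_bilinear h" and ord: "0 \<le> T" "0 \<le> a" "a \<le> b" "a \<le> c" "c \<le> d"
    and \<xi>: "\<xi> \<in> borel_measurable (\<F> a)" "bounded (\<xi> ` space M)"
    and \<zeta>: "\<zeta> \<in> borel_measurable (\<F> c)" "bounded (\<zeta> ` space M)"
  shows "integrable M (\<lambda>\<omega>. h ((W (min T b) \<omega> - W (min T a) \<omega>) *\<^sub>R \<xi> \<omega>)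
      ((W (min T d) \<omega> - W (min T c) \<omega>) *\<^sub>R \<zeta> \<omega>))" (is ?I)
    and "expectation (\<lambda>\<omega>. h ((W (min T b) \<omega> - W (min T a) \<omega>) *\<^sub>R \<xi> \<omega>)
      ((W (min T d) \<omega> - W (min T c) \<omega>) *\<^sub>R \<zeta> \<omega>)) =
      (\<integral>p. h (indicator {a<..b} (fst p) *\<^sub>R \<xi> (snd p)) (indicator {c<..d} (fst p) *\<^sub>R \<zeta> (snd p))
        \<partial>time_space T)" (is ?E)
proof -
  interpret bounded_bilinear h by fact
  interpret TM: pair_sigma_finite "restrict_space lborel {0..T}" M
    by (rule pair_sigma_finite_time_space)
  define Z where "Z \<omega> = h (\<xi> \<omega>) (\<zeta> \<omega>)" for \<omega>
  have \<xi>M: "\<xi> \<in> borel_measurable M" and \<zeta>M: "\<zeta> \<in> borel_measurable M"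
    using \<xi> \<zeta> by (auto intro: measurable_filtration)
  obtain K1 where K1: "\<And>\<omega>. \<omega> \<in> space M \<Longrightarrow> norm (\<xi> \<omega>) \<le> K1"
    using \<xi>(2) unfolding bounded_iff by auto
  obtain K2 where K2: "\<And>\<omega>. \<omega> \<in> space M \<Longrightarrow> norm (\<zeta> \<omega>) \<le> K2"
    using \<zeta>(2) unfolding bounded_iff by auto
  obtain K where K: "K > 0" "\<And>x y. norm (h x y) \<le> norm x * norm y * K"
    using pos_bounded by blast
  have Zm: "Z \<in> borel_measurable (\<F> c)"
    unfolding Z_def using \<xi> \<zeta> ord
    by (intro bilinear_borel_measurable[OF h]) (auto intro: measurable_filtration_mono)
  have Zb: "\<bar>Z \<omega>\<bar> \<le> K1 * K2 * K" if "\<omega> \<in> space M" for \<omega>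
  proof -
    have "norm (\<xi> \<omega>) * norm (\<zeta> \<omega>) * K \<le> K1 * K2 * K"
      using K1[OF that] K2[OF that] K(1)
      by (intro mult_right_mono mult_mono) (auto intro: order_trans[OF norm_ge_zero])
    with K(2)[of "\<xi> \<omega>" "\<zeta> \<omega>"] show ?thesis by (simp add: Z_def)
  qed
  have ZM: "integrable M Z"
    using Zb by (intro integrable_const_bound[where B="K1 * K2 * K"])
      (auto intro: measurable_filtration[OF Zm])
  \<comment> \<open>The length of the set of times up to \<open>T\<close> at which both steps are
    active; by \<open>a \<le> c\<close> the overlap begins at \<open>c\<close>.\<close>
  let ?L = "max 0 (min (min T b) (min T d) - c)"
  have lhs: "(\<lambda>\<omega>. h ((W (min T b) \<omega> - W (min T a) \<omega>) *\<^sub>R \<xi> \<omega>)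
      ((W (min T d) \<omega> - W (min T c) \<omega>) *\<^sub>R \<zeta> \<omega>)) =
    (\<lambda>\<omega>. (W (min T b) \<omega> - W (min T a) \<omega>) * (W (min T d) \<omega> - W (min T c) \<omega>) * Z \<omega>)"
    by (simp add: Z_def scaleR_left scaleR_right mult.assoc mult.left_commute)
  have L: "?I \<and> expectation (\<lambda>\<omega>. h ((W (min T b) \<omega> - W (min T a) \<omega>) *\<^sub>R \<xi> \<omega>)
      ((W (min T d) \<omega> - W (min T c) \<omega>) *\<^sub>R \<zeta> \<omega>)) = ?L * expectation Z"
  proof (cases "c \<le> T")
    case True
    then have "min T c = c" "min T a = a" using ord by auto
    then show ?thesis
      unfolding lhs using W_increment_product[of a "min T b" c "min T d" Z "K1 * K2 * K"] Zm Zb True ord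
      by auto
  next
    \<comment> \<open>The second interval lies beyond \<open>T\<close>: its truncated increment is
      zero, and so is the overlap.\<close>
    case False
    then have "min T c = T" "min T d = T" "?L = 0" using ord by auto
    then show ?thesis unfolding lhs by simp
  qed
  then show ?I by simp
  let ?e = "\<lambda>p. indicator {a<..b} (fst p) *\<^sub>R \<xi> (snd p)"
  let ?f = "\<lambda>p. indicator {c<..d} (fst p) *\<^sub>R \<zeta> (snd p)"
  have "L2 (time_space T) ?e"
    using K1 \<xi>M by (intro L2_bounded[OF finite_measure_time_space, of _ _ K1])
      (auto simp: space_time_space indicator_def intro: order_trans[OF norm_ge_zero])
  moreover have "L2 (time_space T) ?f"
    using K2 \<zeta>M by (intro L2_bounded[OF finite_measure_time_space, of _ _ K2])
      (auto simp: space_time_space indicator_def intro: order_trans[OF norm_ge_zero])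
  ultimately have int: "integrable (time_space T) (\<lambda>p. h (?e p) (?f p))"
    by (rule L2_bilinear_integrable[OF h])
  have eq: "h (?e p) (?f p) = indicator ({a<..b} \<inter> {c<..d}) (fst p) * Z (snd p)" for p
    unfolding indicator_inter_arith Z_def scaleR_left scaleR_right real_scaleR_def
    by (simp only: mult_ac)
  have "(\<integral>p. h (?e p) (?f p) \<partial>time_space T) =
      (\<integral>t. (\<integral>\<omega>. indicator ({a<..b} \<inter> {c<..d}) t * Z \<omega> \<partial>M) \<partial>restrict_space lborel {0..T})"
    using TM.integral_fst'[of "\<lambda>p. h (?e p) (?f p)"] int
    unfolding eq time_space_def by simp
  also have "\<dots> = (\<integral>t. indicator ({a<..b} \<inter> {c<..d}) t \<partial>restrict_space lborel {0..T}) * expectation Z"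
    by simp
  also have "(\<integral>t. indicator ({a<..b} \<inter> {c<..d}) t \<partial>restrict_space lborel {0..T}) =
      measure lborel ({0..T} \<inter> ({a<..b} \<inter> {c<..d}))"
    by (subst integral_restrict_space) (auto simp flip: indicator_inter_arith)
  also have "{0..T} \<inter> ({a<..b} \<inter> {c<..d}) = {c<..min (min T b) (min T d)}"
    using ord by auto
  also have "measure lborel {c<..min (min T b) (min T d)} = ?L"
    by (cases "c \<le> min (min T b) (min T d)") auto
  finally show ?E using L by simp
qed

text \<open>The interval that starts first can be taken as the first one: flipping \<open>h\<close>
  exchanges the two roles.\<close>

lemma step_isometry:
  fixes h :: "'b::euclidean_space \<Rightarrow> 'c::euclidean_space \<Rightarrow> real"
  assumes h: "bounded_bilinear h" and ord: "0 \<le> T" "0 \<le> a" "a \<le> b" "0 \<le> c" "c \<le> d"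
    and \<xi>: "\<xi> \<in> borel_measurable (\<F> a)" "bounded (\<xi> ` space M)"
    and \<zeta>: "\<zeta> \<in> borel_measurable (\<F> c)" "bounded (\<zeta> ` space M)"
  shows "integrable M (\<lambda>\<omega>. h ((W (min T b) \<omega> - W (min T a) \<omega>) *\<^sub>R \<xi> \<omega>)
      ((W (min T d) \<omega> - W (min T c) \<omega>) *\<^sub>R \<zeta> \<omega>))"
    and "expectation (\<lambda>\<omega>. h ((W (min T b) \<omega> - W (min T a) \<omega>) *\<^sub>R \<xi> \<omega>)
      ((W (min T d) \<omega> - W (min T c) \<omega>) *\<^sub>R \<zeta> \<omega>)) =
      (\<integral>p. h (indicator {a<..b} (fst p) *\<^sub>R \<xi> (snd p)) (indicator {c<..d} (fst p) *\<^sub>R \<zeta> (snd p))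
        \<partial>time_space T)"
proof -
  note 1 = step_isometry_ordered[OF h ord(1-3) _ ord(5) \<xi> \<zeta>]
  note 2 = step_isometry_ordered[OF bounded_bilinear.flip[OF h] ord(1,4,5) _ ord(3) \<zeta> \<xi>]
  show "integrable M (\<lambda>\<omega>. h ((W (min T b) \<omega> - W (min T a) \<omega>) *\<^sub>R \<xi> \<omega>)
      ((W (min T d) \<omega> - W (min T c) \<omega>) *\<^sub>R \<zeta> \<omega>))"
    using 1(1) 2(1) by (cases "a \<le> c") auto
  show "expectation (\<lambda>\<omega>. h ((W (min T b) \<omega> - W (min T a) \<omega>) *\<^sub>R \<xi> \<omega>)
      ((W (min T d) \<omega> - W (min T c) \<omega>) *\<^sub>R \<zeta> \<omega>)) =
      (\<integral>p. h (indicator {a<..b} (fst p) *\<^sub>R \<xi> (snd p)) (indicator {c<..d} (fst p) *\<^sub>R \<zeta> (snd p))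
        \<partial>time_space T)"
    using 1(2) 2(2) by (cases "a \<le> c") auto
qed

section \<open>Elementary integrals: square integrability and isometry\<close>

lemma elementary_step:
  assumes "elementary M W n \<tau> \<xi>" "i < n"
  shows "0 \<le> \<tau> i" "\<tau> i \<le> \<tau> (Suc i)" "\<xi> i \<in> borel_measurable (\<F> (\<tau> i))"
    "bounded (\<xi> i ` space M)"
proof -
  have "i < n \<longrightarrow> 0 \<le> \<tau> i"
    using assms(1) by (induction i) (auto simp: elementary_def intro: order_trans)
  then show "0 \<le> \<tau> i" using assms(2) by simp
qed (use assms in \<open>auto simp: elementary_def\<close>)

lemma elementary_process_L2:
  fixes \<xi> :: "nat \<Rightarrow> 'a \<Rightarrow> 'b::euclidean_space"
  assumes "elementary M W n \<tau> \<xi>"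
  shows "L2 (time_space T) (\<lambda>p. elementary_process n \<tau> \<xi> (fst p) (snd p))"
  unfolding elementary_process_def
proof (rule L2_sum)
  fix i assume "i \<in> {..<n}"
  note i = elementary_step[OF assms this[unfolded lessThan_iff]]
  obtain K where K: "\<And>\<omega>. \<omega> \<in> space M \<Longrightarrow> norm (\<xi> i \<omega>) \<le> K"
    using i(4) unfolding bounded_iff by auto
  have "\<xi> i \<in> borel_measurable M" using i(3) by (rule measurable_filtration)
  then show "L2 (time_space T) (\<lambda>p. indicator {\<tau> i<..\<tau> (Suc i)} (fst p) *\<^sub>R \<xi> i (snd p))"
    using K by (intro L2_bounded[OF finite_measure_time_space, of _ _ K])
      (auto simp: space_time_space indicator_def intro: order_trans[OF norm_ge_zero])
qed

text \<open>Square integrability of one summand is the integrability half of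
  \<open>step_isometry\<close> for the inner product, with both steps taken equal.\<close>

lemma elementary_integral_L2:
  fixes \<xi> :: "nat \<Rightarrow> 'a \<Rightarrow> 'b::euclidean_space"
  assumes "elementary M W n \<tau> \<xi>" "0 \<le> T"
  shows "L2 M (elementary_integral W n \<tau> \<xi> T)"
  unfolding elementary_integral_def
proof (rule L2_sum)
  fix i assume "i \<in> {..<n}"
  note i = elementary_step[OF assms(1) this[unfolded lessThan_iff]]
  have "\<xi> i \<in> borel_measurable M" using i(3) by (rule measurable_filtration)
  then show "L2 M (\<lambda>\<omega>. (W (min T (\<tau> (Suc i))) \<omega> - W (min T (\<tau> i)) \<omega>) *\<^sub>R \<xi> i \<omega>)"
    using step_isometry(1)[OF bounded_bilinear_inner assms(2) i(1,2) i(1,2) i(3,4) i(3,4)]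
      i(1,2) assms(2)
    unfolding L2_def power2_norm_eq_inner
    by (intro conjI borel_measurable_scaleR borel_measurable_diff W_measurable) auto
qed

text \<open>The two processes may live on different grids. No common refinement is formed: the
  double sum is expanded, and \<open>step_isometry\<close> accepts any pair of intervals.\<close>

lemma elementary_isometry:
  fixes h :: "'b::euclidean_space \<Rightarrow> 'c::euclidean_space \<Rightarrow> real"
  assumes h: "bounded_bilinear h" and e: "elementary M W n \<tau> \<xi>" and f: "elementary M W m \<rho> \<zeta>"
    and T: "0 \<le> T"
  shows "expectation (\<lambda>\<omega>. h (elementary_integral W n \<tau> \<xi> T \<omega>) (elementary_integral W m \<rho> \<zeta> T \<omega>)) =
    (\<integral>p. h (elementary_process n \<tau> \<xi> (fst p) (snd p)) (elementary_process m \<rho> \<zeta> (fst p) (snd p))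
      \<partial>time_space T)"
proof -
  interpret bounded_bilinear h by fact
  let ?I = "\<lambda>i \<omega>. (W (min T (\<tau> (Suc i))) \<omega> - W (min T (\<tau> i)) \<omega>) *\<^sub>R \<xi> i \<omega>"
  let ?J = "\<lambda>j \<omega>. (W (min T (\<rho> (Suc j))) \<omega> - W (min T (\<rho> j)) \<omega>) *\<^sub>R \<zeta> j \<omega>"
  let ?e = "\<lambda>i p. indicator {\<tau> i<..\<tau> (Suc i)} (fst p) *\<^sub>R \<xi> i (snd p)"
  let ?f = "\<lambda>j p. indicator {\<rho> j<..\<rho> (Suc j)} (fst p) *\<^sub>R \<zeta> j (snd p)"
  have iso: "integrable M (\<lambda>\<omega>. h (?I i \<omega>) (?J j \<omega>))"
    "expectation (\<lambda>\<omega>. h (?I i \<omega>) (?J j \<omega>)) = (\<integral>p. h (?e i p) (?f j p) \<partial>time_space T)"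
    if "i < n" "j < m" for i j
    using step_isometry[OF h T elementary_step(1,2)[OF e that(1)] elementary_step(1,2)[OF f that(2)]
        elementary_step(3,4)[OF e that(1)] elementary_step(3,4)[OF f that(2)]] by auto
  \<comment> \<open>A single step is an elementary process with one interval; the index shift makes
    \<open>\<tau> i\<close> and \<open>\<tau> (Suc i)\<close> its two grid points.\<close>
  have "L2 (time_space T) (?e i)" if "i < n" for i
    using elementary_process_L2[of 1 "\<lambda>k. \<tau> (i + k)" "\<lambda>_. \<xi> i" T] elementary_step[OF e that]
    by (simp add: elementary_def elementary_process_def)
  moreover have "L2 (time_space T) (?f j)" if "j < m" for j
    using elementary_process_L2[of 1 "\<lambda>k. \<rho> (j + k)" "\<lambda>_. \<zeta> j" T] elementary_step[OF f that]
    by (simp add: elementary_def elementary_process_def)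
  ultimately have int: "integrable (time_space T) (\<lambda>p. h (?e i p) (?f j p))"
    if "i < n" "j < m" for i j using that by (intro L2_bilinear_integrable[OF h])
  have "expectation (\<lambda>\<omega>. h (elementary_integral W n \<tau> \<xi> T \<omega>) (elementary_integral W m \<rho> \<zeta> T \<omega>)) =
      expectation (\<lambda>\<omega>. \<Sum>i<n. \<Sum>j<m. h (?I i \<omega>) (?J j \<omega>))"
    unfolding elementary_integral_def sum_left by (simp only: sum_right)
  also have "\<dots> = (\<Sum>i<n. expectation (\<lambda>\<omega>. \<Sum>j<m. h (?I i \<omega>) (?J j \<omega>)))"
    by (intro Bochner_Integration.integral_sum Bochner_Integration.integrable_sum iso(1)) auto
  also have "\<dots> = (\<Sum>i<n. \<Sum>j<m. expectation (\<lambda>\<omega>. h (?I i \<omega>) (?J j \<omega>)))"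
    by (intro sum.cong refl Bochner_Integration.integral_sum iso(1)) auto
  also have "\<dots> = (\<Sum>i<n. \<Sum>j<m. (\<integral>p. h (?e i p) (?f j p) \<partial>time_space T))"
    using iso(2) by simp
  also have "\<dots> = (\<Sum>i<n. (\<integral>p. (\<Sum>j<m. h (?e i p) (?f j p)) \<partial>time_space T))"
    by (intro sum.cong refl Bochner_Integration.integral_sum[symmetric] int) auto
  also have "\<dots> = (\<integral>p. (\<Sum>i<n. \<Sum>j<m. h (?e i p) (?f j p)) \<partial>time_space T)"
    by (intro Bochner_Integration.integral_sum[symmetric] Bochner_Integration.integrable_sum int) auto
  also have "\<dots> = (\<integral>p. h (elementary_process n \<tau> \<xi> (fst p) (snd p))
      (elementary_process m \<rho> \<zeta> (fst p) (snd p)) \<partial>time_space T)"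
    unfolding elementary_process_def sum_left by (simp only: sum_right)
  finally show ?thesis .
qed

section \<open>General integrands as mean-square limits\<close>

lemma has_ito_integralE:
  fixes \<phi> :: "real \<Rightarrow> 'a \<Rightarrow> 'b::euclidean_space"
  assumes "has_ito_integral M W \<phi> T J" "0 \<le> T"
  obtains n \<tau> \<xi> where "\<And>k::nat. elementary M W (n k) (\<tau> k) (\<xi> k)"
    "(\<lambda>k. \<integral>\<^sup>+p. ennreal ((norm (elementary_process (n k) (\<tau> k) (\<xi> k) (fst p) (snd p) - \<phi> (fst p) (snd p)))\<^sup>2)
        \<partial>time_space T) \<longlonglongrightarrow> 0"
    "(\<lambda>k. \<integral>\<^sup>+\<omega>. ennreal ((norm (elementary_integral W (n k) (\<tau> k) (\<xi> k) T \<omega> - J \<omega>))\<^sup>2) \<partial>M)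
        \<longlonglongrightarrow> 0"
proof -
  obtain n \<tau> \<xi> where el: "\<And>k::nat. elementary M W (n k) (\<tau> k) (\<xi> k)"
    and lim: "(\<lambda>k. \<integral>\<^sup>+ \<omega>. (\<integral>\<^sup>+ s\<in>{0..T}.
        ennreal ((norm (elementary_process (n k) (\<tau> k) (\<xi> k) s \<omega> - \<phi> s \<omega>))\<^sup>2) \<partial>lborel) \<partial>M)
      \<longlonglongrightarrow> 0"
    "(\<lambda>k. \<integral>\<^sup>+\<omega>. ennreal ((norm (elementary_integral W (n k) (\<tau> k) (\<xi> k) T \<omega> - J \<omega>))\<^sup>2) \<partial>M)
        \<longlonglongrightarrow> 0"
    using assms(1) unfolding has_ito_integral_def by blast
  have "(\<lambda>p. \<phi> (fst p) (snd p)) \<in> borel_measurable (time_space T)"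
    using assms by (intro progressive_measurable) (auto simp: has_ito_integral_def)
  then have "(\<integral>\<^sup>+ \<omega>. (\<integral>\<^sup>+ s\<in>{0..T}.
        ennreal ((norm (elementary_process (n k) (\<tau> k) (\<xi> k) s \<omega> - \<phi> s \<omega>))\<^sup>2) \<partial>lborel) \<partial>M) =
      (\<integral>\<^sup>+p. ennreal ((norm (elementary_process (n k) (\<tau> k) (\<xi> k) (fst p) (snd p) - \<phi> (fst p) (snd p)))\<^sup>2)
        \<partial>time_space T)" for k
    using L2_measurable[OF elementary_process_L2[OF el[of k], of T]]
    by (subst nn_integral_time_space) auto
  then show thesis using that[OF el] lim by simp
qed

text \<open>\<open>has_ito_integral\<close> asks for measurability only, but the convergence in it
  places the integrand and the integral at finite distance from square integrable elementary
  ones.\<close>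

lemma has_ito_integral_L2:
  fixes \<phi> :: "real \<Rightarrow> 'a \<Rightarrow> 'b::euclidean_space"
  assumes "has_ito_integral M W \<phi> T J" "0 \<le> T"
  shows "L2 (time_space T) (\<lambda>p. \<phi> (fst p) (snd p))" "L2 M J"
proof -
  from assms show "L2 (time_space T) (\<lambda>p. \<phi> (fst p) (snd p))"
  proof (rule has_ito_integralE)
    fix n \<tau> \<xi> assume el: "\<And>k::nat. elementary M W (n k) (\<tau> k) (\<xi> k)"
      and lim: "(\<lambda>k. \<integral>\<^sup>+p. ennreal ((norm (elementary_process (n k) (\<tau> k) (\<xi> k) (fst p) (snd p) -
        \<phi> (fst p) (snd p)))\<^sup>2) \<partial>time_space T) \<longlonglongrightarrow> 0"
    show ?thesis
      using assms by (intro L2_of_approximation[OF elementary_process_L2[OF el] _ lim]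
          progressive_measurable) (auto simp: has_ito_integral_def)
  qed
  from assms show "L2 M J"
  proof (rule has_ito_integralE)
    fix n \<tau> \<xi> assume el: "\<And>k::nat. elementary M W (n k) (\<tau> k) (\<xi> k)"
      and lim: "(\<lambda>k. \<integral>\<^sup>+\<omega>. ennreal ((norm (elementary_integral W (n k) (\<tau> k) (\<xi> k) T \<omega> - J \<omega>))\<^sup>2) \<partial>M)
        \<longlonglongrightarrow> 0"
    show ?thesis
      using assms by (intro L2_of_approximation[OF elementary_integral_L2[OF el] _ lim])
        (auto simp: has_ito_integral_def)
  qed
qed

text \<open>Along approximations of both integrands the elementary isometry equates two sequences,
  and both converge by continuity of \<open>h\<close> in mean square. Having two integrands and an
  arbitrary \<open>h\<close> is what later evaluates quadratic forms and differences.\<close>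

lemma ito_isometry:
  fixes h :: "'b::euclidean_space \<Rightarrow> 'c::euclidean_space \<Rightarrow> real"
  assumes h: "bounded_bilinear h" and T: "0 \<le> T"
    and J: "has_ito_integral M W \<phi> T J" and K: "has_ito_integral M W \<psi> T K"
  shows "expectation (\<lambda>\<omega>. h (J \<omega>) (K \<omega>)) =
    (\<integral>p. h (\<phi> (fst p) (snd p)) (\<psi> (fst p) (snd p)) \<partial>time_space T)"
proof -
  from J T obtain n \<tau> \<xi> where e: "\<And>k::nat. elementary M W (n k) (\<tau> k) (\<xi> k)"
    and e_lim: "(\<lambda>k. \<integral>\<^sup>+p. ennreal ((norm (elementary_process (n k) (\<tau> k) (\<xi> k) (fst p) (snd p) - \<phi> (fst p) (snd p)))\<^sup>2)
        \<partial>time_space T) \<longlonglongrightarrow> 0"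
    "(\<lambda>k. \<integral>\<^sup>+\<omega>. ennreal ((norm (elementary_integral W (n k) (\<tau> k) (\<xi> k) T \<omega> - J \<omega>))\<^sup>2) \<partial>M)
        \<longlonglongrightarrow> 0"
    by (rule has_ito_integralE) (rule that)
  from K T obtain m \<rho> \<zeta> where f: "\<And>k::nat. elementary M W (m k) (\<rho> k) (\<zeta> k)"
    and f_lim: "(\<lambda>k. \<integral>\<^sup>+p. ennreal ((norm (elementary_process (m k) (\<rho> k) (\<zeta> k) (fst p) (snd p) - \<psi> (fst p) (snd p)))\<^sup>2)
        \<partial>time_space T) \<longlonglongrightarrow> 0"
    "(\<lambda>k. \<integral>\<^sup>+\<omega>. ennreal ((norm (elementary_integral W (m k) (\<rho> k) (\<zeta> k) T \<omega> - K \<omega>))\<^sup>2) \<partial>M)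
        \<longlonglongrightarrow> 0"
    by (rule has_ito_integralE) (rule that)
  note L2 = has_ito_integral_L2[OF J T] has_ito_integral_L2[OF K T]
  show ?thesis
    by (rule LIMSEQ_unique
        [OF L2_bilinear_tendsto[OF h L2(2,4) elementary_integral_L2[OF e T]
            elementary_integral_L2[OF f T] e_lim(2) f_lim(2)]
          L2_bilinear_tendsto[OF h L2(1,3) elementary_process_L2[OF e]
            elementary_process_L2[OF f] e_lim(1) f_lim(1),
            folded elementary_isometry[OF h e f T]]])
qed

text \<open>No integral of \<open>\<phi> - \<psi>\<close> is constructed: the square of the
  difference is expanded, and the polarised isometry is applied to each of the three products. With
  \<open>\<phi> = \<psi>\<close> this contains the almost sure uniqueness of the integral.\<close>

lemma ito_isometry_diff:
  fixes \<phi> \<psi> :: "real \<Rightarrow> 'a \<Rightarrow> 'b::euclidean_space"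
  assumes J: "has_ito_integral M W \<phi> T J" and K: "has_ito_integral M W \<psi> T K" and T: "0 \<le> T"
  shows "(\<integral>\<^sup>+\<omega>. ennreal ((norm (J \<omega> - K \<omega>))\<^sup>2) \<partial>M) =
    (\<integral>\<^sup>+p. ennreal ((norm (\<phi> (fst p) (snd p) - \<psi> (fst p) (snd p)))\<^sup>2) \<partial>time_space T)"
proof -
  let ?\<phi> = "\<lambda>p. \<phi> (fst p) (snd p)" and ?\<psi> = "\<lambda>p. \<psi> (fst p) (snd p)"
  note L2 = has_ito_integral_L2[OF J T] has_ito_integral_L2[OF K T]
  note iso = ito_isometry[OF bounded_bilinear_inner T]
  note int = L2_bilinear_integrable[OF bounded_bilinear_inner]
  have eq: "(norm (x - y))\<^sup>2 = x \<bullet> x - 2 * (x \<bullet> y) + y \<bullet> y" for x y :: 'b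
    by (simp add: power2_norm_eq_inner inner_diff_left inner_diff_right inner_commute)
  have "(\<integral>\<omega>. (norm (J \<omega> - K \<omega>))\<^sup>2 \<partial>M) = (\<integral>p. (norm (?\<phi> p - ?\<psi> p))\<^sup>2 \<partial>time_space T)"
    unfolding eq using int[OF L2(2,2)] int[OF L2(2,4)] int[OF L2(4,4)]
      int[OF L2(1,1)] int[OF L2(1,3)] int[OF L2(3,3)] iso[OF J J] iso[OF J K] iso[OF K K]
    by simp
  then show ?thesis
    using L2_nn_integral[OF L2_diff[OF L2(2,4)]] L2_nn_integral[OF L2_diff[OF L2(1,3)]] by simp
qed

lemma elementary_has_ito_integral:
  fixes \<xi> :: "nat \<Rightarrow> 'a \<Rightarrow> 'b::euclidean_space"
  assumes "elementary M W n \<tau> \<xi>" "0 \<le> T"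
  shows "has_ito_integral M W (elementary_process n \<tau> \<xi>) T (elementary_integral W n \<tau> \<xi> T)"
  unfolding has_ito_integral_def
proof (intro conjI exI)
  show "\<forall>k::nat. elementary M W n \<tau> \<xi>" using assms by simp
qed (use assms elementary_progressive L2_measurable[OF elementary_integral_L2] in auto)

text \<open>The martingale property in weak form, tested against \<open>\<eta>\<close>, which avoids
  conditional expectations. Between \<open>s\<close> and \<open>t\<close> the integral gains, for
  each step, an increment over the part of its interval inside \<open>[s, t]\<close>. That increment
  is centred and independent of \<open>\<xi> i\<close> and \<open>\<eta>\<close>, which are both
  known when it begins.\<close>

lemma elementary_integral_martingale:
  fixes h :: "'b::euclidean_space \<Rightarrow> 'c::euclidean_space \<Rightarrow> real"
  assumes h: "bounded_bilinear h" and e: "elementary M W n \<tau> \<xi>" and st: "0 \<le> s" "s \<le> t"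
    and \<eta>: "\<eta> \<in> borel_measurable (\<F> s)" "L2 M \<eta>"
  shows "expectation (\<lambda>\<omega>. h (elementary_integral W n \<tau> \<xi> t \<omega>) (\<eta> \<omega>)) =
    expectation (\<lambda>\<omega>. h (elementary_integral W n \<tau> \<xi> s \<omega>) (\<eta> \<omega>))"
proof -
  interpret bounded_bilinear h by fact
  \<comment> \<open>Clamping both grid points to \<open>[s, t]\<close> describes the gained
    increment uniformly, including the intervals that lie outside or straddle an end.\<close>
  let ?\<Delta> = "\<lambda>i \<omega>. W (min t (max s (\<tau> (Suc i)))) \<omega> - W (min t (max s (\<tau> i))) \<omega>"
  have \<Delta>: "h (elementary_integral W n \<tau> \<xi> t \<omega>) (\<eta> \<omega>) - h (elementary_integral W n \<tau> \<xi> s \<omega>) (\<eta> \<omega>) =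
      (\<Sum>i<n. ?\<Delta> i \<omega> * h (\<xi> i \<omega>) (\<eta> \<omega>))" for \<omega>
  proof -
    have W: "W (min t r) \<omega> - W (min s r) \<omega> = W (min t (max s r)) \<omega> - W s \<omega>" for r
      using st by (cases "r \<le> s") (auto simp: min_def max_def)
    have "(W (min t (\<tau> (Suc i))) \<omega> - W (min t (\<tau> i)) \<omega>) - (W (min s (\<tau> (Suc i))) \<omega> - W (min s (\<tau> i)) \<omega>)
      = ?\<Delta> i \<omega>" for i
      using W[of "\<tau> (Suc i)"] W[of "\<tau> i"] by linarith
    then show ?thesis
      unfolding elementary_integral_def
      by (simp add: sum_left scaleR_left flip: sum_subtractf left_diff_distrib)
  qed
  have step: "integrable M (\<lambda>\<omega>. ?\<Delta> i \<omega> * h (\<xi> i \<omega>) (\<eta> \<omega>)) \<and>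
    expectation (\<lambda>\<omega>. ?\<Delta> i \<omega> * h (\<xi> i \<omega>) (\<eta> \<omega>)) = 0" if "i < n" for i
  proof (cases "\<tau> i \<le> t")
    case True
    note i = elementary_step[OF e that]
    obtain K where K: "\<And>\<omega>. \<omega> \<in> space M \<Longrightarrow> norm (\<xi> i \<omega>) \<le> K"
      using i(4) unfolding bounded_iff by auto
    let ?r = "max s (\<tau> i)"
    have "L2 M (\<xi> i)"
      using K measurable_filtration[OF i(3)] by (intro L2_bounded[OF finite_measure_axioms])
    then have "integrable M (\<lambda>\<omega>. h (\<xi> i \<omega>) (\<eta> \<omega>))"
      using \<eta>(2) by (rule L2_bilinear_integrable[OF h])
    moreover have "(\<lambda>\<omega>. h (\<xi> i \<omega>) (\<eta> \<omega>)) \<in> borel_measurable (\<F> ?r)"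
      using i(3) \<eta>(1) by (intro bilinear_borel_measurable[OF h])
        (auto intro: measurable_filtration_mono)
    moreover have "min t ?r = ?r" "?r \<le> min t (max s (\<tau> (Suc i)))" "0 \<le> ?r"
      using True st i by auto
    ultimately show ?thesis
      using W_increment_mult[of ?r "min t (max s (\<tau> (Suc i)))" "\<lambda>\<omega>. h (\<xi> i \<omega>) (\<eta> \<omega>)"] by simp
  next
    case False
    \<comment> \<open>The step begins after \<open>t\<close>, so both clamped points are
      \<open>t\<close> and nothing is gained.\<close>
    then have "min t (max s (\<tau> (Suc i))) = t" "min t (max s (\<tau> i)) = t"
      using elementary_step(2)[OF e that] st by auto
    then show ?thesis by simp
  qed
  have int: "integrable M (\<lambda>\<omega>. h (elementary_integral W n \<tau> \<xi> r \<omega>) (\<eta> \<omega>))" if "0 \<le> r" for r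
    by (rule L2_bilinear_integrable[OF h elementary_integral_L2[OF e that] \<eta>(2)])
  have "expectation (\<lambda>\<omega>. h (elementary_integral W n \<tau> \<xi> t \<omega>) (\<eta> \<omega>)) -
      expectation (\<lambda>\<omega>. h (elementary_integral W n \<tau> \<xi> s \<omega>) (\<eta> \<omega>)) =
      expectation (\<lambda>\<omega>. \<Sum>i<n. ?\<Delta> i \<omega> * h (\<xi> i \<omega>) (\<eta> \<omega>))"
    using int[of s] int[of t] st by (simp flip: \<Delta>)
  also have "\<dots> = 0"
    using step by (simp add: Bochner_Integration.integral_sum)
  finally show ?thesis by simp
qed

text \<open>The approximants chosen for \<open>J\<close> also serve for \<open>K\<close>, which may
  come from other approximants: by the isometry of differences their distance from \<open>K\<close>
  is the distance of the integrands on \<open>[0, s]\<close>, which the one on \<open>[0, t]\<close>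
  dominates. The elementary identity can therefore pass to the limit on both sides.\<close>

lemma ito_integral_martingale:
  fixes h :: "'b::euclidean_space \<Rightarrow> 'c::euclidean_space \<Rightarrow> real"
  assumes h: "bounded_bilinear h" and st: "0 \<le> s" "s \<le> t"
    and J: "has_ito_integral M W \<phi> t J" and K: "has_ito_integral M W \<phi> s K"
    and \<eta>: "\<eta> \<in> borel_measurable (\<F> s)" "L2 M \<eta>"
  shows "expectation (\<lambda>\<omega>. h (J \<omega>) (\<eta> \<omega>)) = expectation (\<lambda>\<omega>. h (K \<omega>) (\<eta> \<omega>))"
proof -
  have t: "0 \<le> t" using st by simp
  from J t obtain n \<tau> \<xi> where e: "\<And>k::nat. elementary M W (n k) (\<tau> k) (\<xi> k)"
    and lim: "(\<lambda>k. \<integral>\<^sup>+p. ennreal ((norm (elementary_process (n k) (\<tau> k) (\<xi> k) (fst p) (snd p) - \<phi> (fst p) (snd p)))\<^sup>2)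
        \<partial>time_space t) \<longlonglongrightarrow> 0"
    "(\<lambda>k. \<integral>\<^sup>+\<omega>. ennreal ((norm (elementary_integral W (n k) (\<tau> k) (\<xi> k) t \<omega> - J \<omega>))\<^sup>2) \<partial>M)
        \<longlonglongrightarrow> 0"
    by (rule has_ito_integralE) (rule that)
  let ?d = "\<lambda>k p. ennreal ((norm (elementary_process (n k) (\<tau> k) (\<xi> k) (fst p) (snd p) -
      \<phi> (fst p) (snd p)))\<^sup>2)"
  have "(\<integral>\<^sup>+\<omega>. ennreal ((norm (elementary_integral W (n k) (\<tau> k) (\<xi> k) s \<omega> - K \<omega>))\<^sup>2) \<partial>M) =
      (\<integral>\<^sup>+p. ?d k p \<partial>time_space s)" for k
    by (rule ito_isometry_diff[OF elementary_has_ito_integral[OF e st(1)] K st(1)])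
  also have "(\<integral>\<^sup>+p. ?d k p \<partial>time_space s) \<le> (\<integral>\<^sup>+p. ?d k p \<partial>time_space t)" for k
  proof -
    have m: "?d k \<in> borel_measurable (time_space r)" if "0 \<le> r" for r
    proof -
      have "progressive M W \<phi>" using J by (simp add: has_ito_integral_def)
      with progressive_measurable[OF this that] L2_measurable[OF elementary_process_L2[OF e[of k], of r]]
      show ?thesis by simp
    qed
    show ?thesis by (rule nn_integral_time_space_mono[OF st m[OF st(1)] m[OF t]])
  qed
  finally have bound: "(\<integral>\<^sup>+\<omega>. ennreal ((norm (elementary_integral W (n k) (\<tau> k) (\<xi> k) s \<omega> - K \<omega>))\<^sup>2) \<partial>M)
      \<le> (\<integral>\<^sup>+p. ?d k p \<partial>time_space t)" for k .
  have s_lim: "(\<lambda>k. \<integral>\<^sup>+\<omega>. ennreal ((norm (elementary_integral W (n k) (\<tau> k) (\<xi> k) s \<omega> - K \<omega>))\<^sup>2) \<partial>M)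
      \<longlonglongrightarrow> 0"
    by (rule tendsto_sandwich[OF _ _ tendsto_const lim(1)]) (use bound in auto)
  note L2 = has_ito_integral_L2(2)[OF J t] has_ito_integral_L2(2)[OF K st(1)]
  have "(\<lambda>k. expectation (\<lambda>\<omega>. h (elementary_integral W (n k) (\<tau> k) (\<xi> k) t \<omega>) (\<eta> \<omega>)))
      \<longlonglongrightarrow> expectation (\<lambda>\<omega>. h (J \<omega>) (\<eta> \<omega>))"
    by (rule L2_bilinear_tendsto[OF h L2(1) \<eta>(2) elementary_integral_L2[OF e t] \<eta>(2) lim(2)]) simp
  moreover have "(\<lambda>k. expectation (\<lambda>\<omega>. h (elementary_integral W (n k) (\<tau> k) (\<xi> k) s \<omega>) (\<eta> \<omega>)))
      \<longlonglongrightarrow> expectation (\<lambda>\<omega>. h (K \<omega>) (\<eta> \<omega>))"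
    by (rule L2_bilinear_tendsto[OF h L2(2) \<eta>(2) elementary_integral_L2[OF e st(1)] \<eta>(2) s_lim]) simp
  ultimately show ?thesis
    unfolding elementary_integral_martingale[OF h e st \<eta>] by (rule LIMSEQ_unique)
qed

end

subsection \<open>A Gronwall inequality\<close>

lemma matrix_vector_mult_bound:
  fixes A :: "real^'n^'m"
  obtains K where "K > 0" "\<And>x. (norm (A *v x))\<^sup>2 \<le> K * (norm x)\<^sup>2"
proof -
  obtain k where k: "k > 0" "\<And>x. norm (A *v x) \<le> norm x * k"
    using bounded_linear.pos_bounded[OF matrix_vector_mul_bounded_linear[of A]] by blast
  have "(norm (A *v x))\<^sup>2 \<le> k\<^sup>2 * (norm x)\<^sup>2" for x
    using power_mono[OF k(2)[of x] norm_ge_zero, of 2] by (simp add: power_mult_distrib mult.commute)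
  with k(1) show thesis by (intro that[of "k\<^sup>2"]) auto
qed

lemma L2_integrable:
  fixes f :: "'a \<Rightarrow> 'b::euclidean_space"
  assumes "finite_measure N" "L2 N f"
  shows "integrable N f"
proof (rule Bochner_Integration.integrable_bound[where f="\<lambda>x. 1 + (norm (f x))\<^sup>2"])
  interpret finite_measure N by fact
  show "integrable N (\<lambda>x. 1 + (norm (f x))\<^sup>2)" using assms(2) by (simp add: L2_def)
  show "AE x in N. norm (f x) \<le> norm (1 + (norm (f x))\<^sup>2)"
    using mult_le_weighted_squares[of 1 1] by (intro AE_I2) simp
qed (use assms in \<open>simp add: L2_def\<close>)

text \<open>Cauchy-Schwarz against the constant 1, obtained as nonnegativity of a variance: with
  total mass \<open>m\<close> and integral \<open>I\<close>, expand the integral of the square of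
  \<open>|m f - I|\<close> and cancel one factor \<open>m\<close>.\<close>

lemma norm_integral_square_le:
  fixes f :: "'a \<Rightarrow> 'b::euclidean_space"
  assumes "finite_measure N" "L2 N f"
  shows "(norm (\<integral>x. f x \<partial>N))\<^sup>2 \<le> measure N (space N) * (\<integral>x. (norm (f x))\<^sup>2 \<partial>N)"
proof -
  interpret finite_measure N by fact
  let ?m = "measure N (space N)" and ?I = "\<integral>x. f x \<partial>N"
  have int: "integrable N f" by (rule L2_integrable[OF assms])
  have sq: "integrable N (\<lambda>x. (norm (f x))\<^sup>2)" using assms(2) by (simp add: L2_def)
  have "0 \<le> (\<integral>x. (norm (?m *\<^sub>R f x - ?I))\<^sup>2 \<partial>N)" by simp
  also have "(\<lambda>x. (norm (?m *\<^sub>R f x - ?I))\<^sup>2) =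
      (\<lambda>x. ?m\<^sup>2 * (norm (f x))\<^sup>2 - (2 * ?m) * (f x \<bullet> ?I) + ?I \<bullet> ?I)"
    by (simp add: fun_eq_iff power2_norm_eq_inner inner_diff_left inner_diff_right
        inner_commute power2_eq_square[of ?m] mult.assoc)
  also have "(\<integral>x. ?m\<^sup>2 * (norm (f x))\<^sup>2 - (2 * ?m) * (f x \<bullet> ?I) + ?I \<bullet> ?I \<partial>N) =
      ?m\<^sup>2 * (\<integral>x. (norm (f x))\<^sup>2 \<partial>N) - 2 * ?m * (?I \<bullet> ?I) + ?m * (?I \<bullet> ?I)"
    using int sq by simp
  finally have *: "?m * (norm ?I)\<^sup>2 \<le> ?m * (?m * (\<integral>x. (norm (f x))\<^sup>2 \<partial>N))"
    by (simp add: power2_norm_eq_inner power2_eq_square[of ?m] mult.assoc)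
  show ?thesis
  proof (cases "?m = 0")
    \<comment> \<open>The factor cannot be cancelled, but then every function vanishes almost
      everywhere.\<close>
    case True
    then have "space N \<in> null_sets N" by (simp add: null_sets_def emeasure_eq_measure)
    then have "AE x in N. f x = 0" by (rule AE_I') auto
    then have "?I = 0" by (rule integral_eq_zero_AE)
    then show ?thesis by simp
  next
    case False
    then have "?m > 0" using measure_nonneg[of N "space N"] by linarith
    with * show ?thesis by simp
  qed
qed

text \<open>Stated in \<open>ennreal\<close> so as to apply to every path, including those on which
  the right-hand side is infinite.\<close>

lemma norm_set_integral_square_le:
  fixes f :: "real \<Rightarrow> 'b::euclidean_space"
  assumes f: "f \<in> borel_measurable (restrict_space lborel {0..t})" and t: "0 \<le> t"
  shows "ennreal ((norm (LINT s:{0..t}|lborel. f s))\<^sup>2) \<le>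
    ennreal t * (\<integral>\<^sup>+s\<in>{0..t}. ennreal ((norm (f s))\<^sup>2) \<partial>lborel)"
proof (cases "(\<integral>\<^sup>+s\<in>{0..t}. ennreal ((norm (f s))\<^sup>2) \<partial>lborel) = \<infinity>")
  case True
  show ?thesis
  proof (cases "t = 0")
    \<comment> \<open>Zero times infinity is zero in \<open>ennreal\<close>, so for
      \<open>t = 0\<close> the left-hand side must be shown to vanish; a single point is a null
      set.\<close>
    case True
    have "AE s in lborel. s \<noteq> (0::real)" by (rule AE_lborel_singleton)
    then have "(LINT s:{0..0::real}|lborel. f s) = 0"
      unfolding set_lebesgue_integral_def
      by (intro integral_eq_zero_AE) (auto elim!: eventually_mono)
    then show ?thesis using True by simp
  next
    case False
    then show ?thesis using True t by (simp add: ennreal_mult_top)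
  qed
next
  case False
  let ?N = "restrict_space lborel {0..t}"
  have N: "finite_measure ?N" by (rule finite_measure_restrict_Icc)
  have nn: "(\<integral>\<^sup>+s\<in>{0..t}. ennreal ((norm (f s))\<^sup>2) \<partial>lborel) = (\<integral>\<^sup>+s. ennreal ((norm (f s))\<^sup>2) \<partial>?N)"
    by (simp add: nn_integral_restrict_space)
  have L2: "L2 ?N f" using False f by (intro L2I_nn_integral) (auto simp: nn top.not_eq_extremum)
  have "(norm (\<integral>s. f s \<partial>?N))\<^sup>2 \<le> t * (\<integral>s. (norm (f s))\<^sup>2 \<partial>?N)"
    using norm_integral_square_le[OF N L2] t
    by (simp add: space_restrict_space measure_restrict_space)
  moreover have "(\<integral>s. f s \<partial>?N) = (LINT s:{0..t}|lborel. f s)"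
    by (simp add: set_lebesgue_integral_def integral_restrict_space)
  ultimately show ?thesis
    unfolding nn L2_nn_integral[OF L2] using t by (simp flip: ennreal_mult)
qed

lemma nn_integral_exp_Icc_le:
  fixes c :: real
  assumes "c > 0" "s \<le> T"
  shows "(\<integral>\<^sup>+t\<in>{s..T}. ennreal (exp (- c * t)) \<partial>lborel) \<le> ennreal (exp (- c * s) / c)"
proof -
  have "(\<integral>\<^sup>+t\<in>{s..T}. ennreal (exp (- c * t)) \<partial>lborel) =
      ennreal (- exp (- c * T) / c - - exp (- c * s) / c)"
    by (rule nn_integral_FTC_Icc) (use assms in \<open>auto intro!: derivative_eq_intros\<close>)
  also have "\<dots> \<le> ennreal (exp (- c * s) / c)"
    using assms by (intro ennreal_leI) (simp add: field_simps)
  finally show ?thesis .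
qed

text \<open>The weight \<open>exp (- 2 * K * t)\<close> makes the operator \<open>f \<mapsto> K * \<integral>\<^bsub>[0, t]\<^esub> f\<close> a
  contraction with constant \<open>1 / 2\<close>.\<close>

lemma gronwall_nn_integral:
  fixes f g :: "real \<Rightarrow> ennreal" and K T :: real
  assumes f: "f \<in> borel_measurable borel" and g: "g \<in> borel_measurable borel" and K: "K > 0"
    and le: "\<And>t. 0 \<le> t \<Longrightarrow> t \<le> T \<Longrightarrow> f t \<le> g t + ennreal K * (\<integral>\<^sup>+s\<in>{0..t}. f s \<partial>lborel)"
    and fin: "(\<integral>\<^sup>+t\<in>{0..T}. f t \<partial>lborel) < \<infinity>"
  shows "(\<integral>\<^sup>+t\<in>{0..T}. f t \<partial>lborel) \<le>
    ennreal (2 * exp (2 * K * T)) * (\<integral>\<^sup>+t\<in>{0..T}. g t \<partial>lborel)"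
proof -
  note [measurable] = f g
  define w where "w t = ennreal (exp (- (2 * K) * t))" for t
  have w_m[measurable]: "w \<in> borel_measurable borel" unfolding w_def by measurable
  have w1: "w t \<le> 1" if "0 \<le> t" for t
    using that K by (simp add: w_def)
  define A where "A = (\<integral>\<^sup>+t\<in>{0..T}. w t * f t \<partial>lborel)"
  \<comment> \<open>Finiteness is what later permits half of \<open>A\<close> to be absorbed into
    the left-hand side.\<close>
  have A_fin: "A < \<infinity>"
  proof -
    have "A \<le> (\<integral>\<^sup>+t\<in>{0..T}. f t \<partial>lborel)"
      unfolding A_def using mult_right_mono[OF w1]
      by (intro nn_integral_mono) (fastforce simp: indicator_def)
    then show ?thesis using fin by (rule le_less_trans)
  qed
  have "(\<integral>\<^sup>+t\<in>{0..T}. w t * (\<integral>\<^sup>+s\<in>{0..t}. f s \<partial>lborel) \<partial>lborel) =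
      (\<integral>\<^sup>+t. (\<integral>\<^sup>+s. w t * f s * indicator {p. 0 \<le> snd p \<and> snd p \<le> fst p \<and> fst p \<le> T} (t, s)
        \<partial>lborel) \<partial>lborel)"
  proof (intro nn_integral_cong)
    fix t :: real
    have "w t * (\<integral>\<^sup>+s\<in>{0..t}. f s \<partial>lborel) * indicator {0..T} t =
        (\<integral>\<^sup>+s. w t * indicator {0..T} t * (f s * indicator {0..t} s) \<partial>lborel)"
      by (subst nn_integral_cmult) (auto simp: mult_ac)
    also have "\<dots> = (\<integral>\<^sup>+s. w t * f s *
        indicator {p. 0 \<le> snd p \<and> snd p \<le> fst p \<and> fst p \<le> T} (t, s) \<partial>lborel)"
      by (intro nn_integral_cong) (auto simp: indicator_def)
    finally show "w t * (\<integral>\<^sup>+s\<in>{0..t}. f s \<partial>lborel) * indicator {0..T} t = \<dots>" .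
  qed
  also have "\<dots> = (\<integral>\<^sup>+s. (\<integral>\<^sup>+t. w t * f s *
      indicator {p. 0 \<le> snd p \<and> snd p \<le> fst p \<and> fst p \<le> T} (t, s) \<partial>lborel) \<partial>lborel)"
    by (rule lborel_pair.Fubini') measurable
  also have "\<dots> = (\<integral>\<^sup>+s\<in>{0..T}. f s * (\<integral>\<^sup>+t\<in>{s..T}. w t \<partial>lborel) \<partial>lborel)"
  proof (intro nn_integral_cong)
    fix s :: real
    have "f s * (\<integral>\<^sup>+t\<in>{s..T}. w t \<partial>lborel) * indicator {0..T} s =
        (\<integral>\<^sup>+t. f s * indicator {0..T} s * (w t * indicator {s..T} t) \<partial>lborel)"
      by (subst nn_integral_cmult) (auto simp: mult_ac)
    also have "\<dots> = (\<integral>\<^sup>+t. w t * f s *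
        indicator {p. 0 \<le> snd p \<and> snd p \<le> fst p \<and> fst p \<le> T} (t, s) \<partial>lborel)"
      by (intro nn_integral_cong) (auto simp: indicator_def mult.commute)
    finally show "(\<integral>\<^sup>+t. w t * f s *
        indicator {p. 0 \<le> snd p \<and> snd p \<le> fst p \<and> fst p \<le> T} (t, s) \<partial>lborel) =
        f s * (\<integral>\<^sup>+t\<in>{s..T}. w t \<partial>lborel) * indicator {0..T} s" ..
  qed
  \<comment> \<open>After the exchange of integrals the inner one runs over \<open>[s, T]\<close>
    and is at most \<open>w s / (2 * K)\<close>. Multiplied by \<open>K\<close> this leaves the
    contraction constant 1/2.\<close>
  also have "\<dots> \<le> (\<integral>\<^sup>+s\<in>{0..T}. ennreal (1 / (2 * K)) * (w s * f s) \<partial>lborel)"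
  proof (intro nn_integral_mono)
    fix s :: real
    show "f s * (\<integral>\<^sup>+t\<in>{s..T}. w t \<partial>lborel) * indicator {0..T} s \<le>
        ennreal (1 / (2 * K)) * (w s * f s) * indicator {0..T} s"
    proof (cases "s \<in> {0..T}")
      case True
      then have "(\<integral>\<^sup>+t\<in>{s..T}. w t \<partial>lborel) \<le> ennreal (exp (- (2 * K) * s) / (2 * K))"
        unfolding w_def using K by (intro nn_integral_exp_Icc_le) auto
      also have "\<dots> = ennreal (1 / (2 * K)) * w s"
        using K by (simp add: w_def flip: ennreal_mult)
      finally have "f s * (\<integral>\<^sup>+t\<in>{s..T}. w t \<partial>lborel) \<le> f s * (ennreal (1 / (2 * K)) * w s)"
        by (rule mult_left_mono) simp
      then show ?thesis using True by (simp add: mult_ac)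
    qed simp
  qed
  also have "\<dots> = ennreal (1 / (2 * K)) * A"
    unfolding A_def by (subst nn_integral_cmult[symmetric]) (auto simp: mult.assoc)
  finally have double: "(\<integral>\<^sup>+t\<in>{0..T}. w t * (\<integral>\<^sup>+s\<in>{0..t}. f s \<partial>lborel) \<partial>lborel) \<le>
      ennreal (1 / (2 * K)) * A" .
  have F_m: "(\<lambda>t. \<integral>\<^sup>+s\<in>{0..t}. f s \<partial>lborel) \<in> borel_measurable borel"
  proof -
    have "(\<lambda>t. \<integral>\<^sup>+s. f s * indicator {p. 0 \<le> snd p \<and> snd p \<le> fst p} (t, s) \<partial>lborel)
        \<in> borel_measurable borel"
      by measurable
    then show ?thesis by (simp add: indicator_def cong: if_cong)
  qed
  note [measurable] = F_m
  have "A \<le> (\<integral>\<^sup>+t. w t * g t * indicator {0..T} t +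
      ennreal K * (w t * (\<integral>\<^sup>+s\<in>{0..t}. f s \<partial>lborel) * indicator {0..T} t) \<partial>lborel)"
    unfolding A_def
  proof (intro nn_integral_mono)
    fix t :: real
    show "w t * f t * indicator {0..T} t \<le> w t * g t * indicator {0..T} t +
      ennreal K * (w t * (\<integral>\<^sup>+s\<in>{0..t}. f s \<partial>lborel) * indicator {0..T} t)"
      using mult_left_mono[OF le[of t], of "w t"]
      by (cases "t \<in> {0..T}") (auto simp: distrib_left mult_ac)
  qed
  also have "\<dots> = (\<integral>\<^sup>+t\<in>{0..T}. w t * g t \<partial>lborel) +
      ennreal K * (\<integral>\<^sup>+t\<in>{0..T}. w t * (\<integral>\<^sup>+s\<in>{0..t}. f s \<partial>lborel) \<partial>lborel)"
    by (subst nn_integral_add) (auto simp: nn_integral_cmult)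
  also have "\<dots> \<le> (\<integral>\<^sup>+t\<in>{0..T}. g t \<partial>lborel) + ennreal K * (ennreal (1 / (2 * K)) * A)"
  proof (intro add_mono mult_left_mono double nn_integral_mono)
    fix t :: real
    show "w t * g t * indicator {0..T} t \<le> g t * indicator {0..T} t"
      using mult_right_mono[OF w1[of t], of "g t"] by (cases "t \<in> {0..T}") auto
  qed simp
  also have "ennreal K * (ennreal (1 / (2 * K)) * A) = ennreal (1 / 2) * A"
    using K by (simp flip: mult.assoc ennreal_mult)
  finally have A_step: "A \<le> (\<integral>\<^sup>+t\<in>{0..T}. g t \<partial>lborel) + ennreal (1 / 2) * A" .
  have A_le: "A \<le> 2 * (\<integral>\<^sup>+t\<in>{0..T}. g t \<partial>lborel)"
  proof (cases "(\<integral>\<^sup>+t\<in>{0..T}. g t \<partial>lborel)")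
    case (real r)
    obtain a where a: "A = ennreal a" "0 \<le> a"
      using A_fin by (cases A) auto
    have "ennreal r + ennreal (1 / 2) * ennreal a = ennreal (r + 1 / 2 * a)"
      using a(2) real(1) by (subst ennreal_mult[symmetric]) (auto simp flip: ennreal_plus)
    then have "ennreal a \<le> ennreal (r + 1 / 2 * a)"
      using A_step unfolding real(2) a(1) by simp
    then have "a \<le> 2 * r" using a(2) real(1) by (subst (asm) ennreal_le_iff) auto
    then have "ennreal a \<le> ennreal (2 * r)" by (rule ennreal_leI)
    then show ?thesis using a real by (simp add: ennreal_mult)
  qed (simp add: ennreal_mult_top)
  have "(\<integral>\<^sup>+t\<in>{0..T}. f t \<partial>lborel) \<le> (\<integral>\<^sup>+t. ennreal (exp (2 * K * T)) * (w t * f t * indicator {0..T} t) \<partial>lborel)"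
  proof (intro nn_integral_mono)
    fix t :: real
    show "f t * indicator {0..T} t \<le> ennreal (exp (2 * K * T)) * (w t * f t * indicator {0..T} t)"
    proof (cases "t \<in> {0..T}")
      \<comment> \<open>On \<open>[0, T]\<close> the weight is at least
        \<open>exp (- 2 * K * T)\<close>; removing it costs the exponential in the
        conclusion.\<close>
      case True
      then have "1 \<le> exp (2 * K * T) * exp (- (2 * K) * t)"
        using K by (simp flip: exp_add)
      then have "1 \<le> ennreal (exp (2 * K * T)) * w t"
        unfolding w_def by (simp flip: ennreal_mult)
      from mult_right_mono[OF this, of "f t"] True show ?thesis by (simp add: mult_ac)
    qed simp
  qed
  also have "\<dots> = ennreal (exp (2 * K * T)) * A"
    unfolding A_def by (simp add: nn_integral_cmult)
  also have "\<dots> \<le> ennreal (exp (2 * K * T)) * (2 * (\<integral>\<^sup>+t\<in>{0..T}. g t \<partial>lborel))"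
    by (rule mult_left_mono[OF A_le]) simp
  finally show ?thesis by (simp add: ennreal_mult mult_ac)
qed

context brownian
begin

subsection \<open>A priori estimates\<close>

text \<open>The process is a pointwise limit of processes with time frozen at grid points. Each of
  these takes countably many times, all within \<open>[0, T]\<close>, and is jointly measurable;
  continuity of paths gives the limit.\<close>

lemma adapted_continuous_progressive:
  fixes X :: "real \<Rightarrow> 'a \<Rightarrow> 'b::euclidean_space"
  assumes X: "adapted_continuous M W X"
  shows "progressive M W X"
  unfolding progressive_def split_beta
proof (intro allI impI)
  fix T :: real assume T: "0 \<le> T"
  let ?N = "restrict_space borel {0..T} \<Otimes>\<^sub>M \<F> T"
  \<comment> \<open>Times are rounded upwards, which can overshoot the horizon; the clamp to
    \<open>[0, T]\<close> keeps every value known at time \<open>T\<close>.\<close>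
  define r where "r k i = min T (max 0 (real_of_int i / real (Suc k)))" for k and i :: int
  have fst: "fst \<in> borel_measurable ?N"
    by (rule measurable_restrict_space2_iff[THEN iffD1, THEN conjunct1], rule measurable_fst)
  show "(\<lambda>p. X (fst p) (snd p)) \<in> borel_measurable ?N"
  proof (rule borel_measurable_LIMSEQ_metric)
    fix k :: nat
    show "(\<lambda>p. X (r k \<lceil>fst p * real (Suc k)\<rceil>) (snd p)) \<in> borel_measurable ?N"
    proof (rule measurable_compose_countable)
      fix i :: int
      have "0 \<le> r k i" "r k i \<le> T" using T by (auto simp: r_def)
      then have "X (r k i) \<in> borel_measurable (\<F> T)"
        using X unfolding adapted_continuous_def adapted_def
        by (blast intro: measurable_filtration_mono)
      then show "(\<lambda>p. X (r k i) (snd p)) \<in> borel_measurable ?N"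
        by (rule measurable_compose[OF measurable_snd])
    next
      have "(\<lambda>p. fst p * real (Suc k)) \<in> borel_measurable ?N"
        using fst by (intro borel_measurable_times) auto
      then show "(\<lambda>p. \<lceil>fst p * real (Suc k)\<rceil>) \<in> measurable ?N (count_space UNIV)"
        by (rule measurable_compose[OF _ measurable_real_ceiling])
    qed
  next
    fix p assume "p \<in> space ?N"
    then have p: "fst p \<in> {0..T}" "snd p \<in> space M"
      by (auto simp: space_pair_measure space_restrict_space)
    have "(\<lambda>k. real_of_int \<lceil>fst p * real (Suc k)\<rceil> / real (Suc k)) \<longlonglongrightarrow> fst p"
    proof (rule tendsto_sandwich)
      show "(\<lambda>k. fst p) \<longlonglongrightarrow> fst p" by simp
      show "(\<lambda>k. fst p + inverse (real (Suc k))) \<longlonglongrightarrow> fst p"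
        using tendsto_add[OF tendsto_const LIMSEQ_inverse_real_of_nat, of "fst p"] by simp
      show "\<forall>\<^sub>F k in sequentially. fst p \<le> real_of_int \<lceil>fst p * real (Suc k)\<rceil> / real (Suc k)"
        by (intro always_eventually allI) (simp add: pos_le_divide_eq del: of_nat_Suc)
      have "real_of_int \<lceil>fst p * real (Suc k)\<rceil> \<le> fst p * real (Suc k) + 1" for k
        by linarith
      then show "\<forall>\<^sub>F k in sequentially.
          real_of_int \<lceil>fst p * real (Suc k)\<rceil> / real (Suc k) \<le> fst p + inverse (real (Suc k))"
        by (intro always_eventually allI)
          (simp add: pos_divide_le_eq distrib_right del: of_nat_Suc)
    qed
    then have "(\<lambda>k. r k \<lceil>fst p * real (Suc k)\<rceil>) \<longlonglongrightarrow> min T (max 0 (fst p))"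
      unfolding r_def by (intro tendsto_intros)
    then have lim: "(\<lambda>k. r k \<lceil>fst p * real (Suc k)\<rceil>) \<longlonglongrightarrow> fst p" using p by simp
    have cont: "continuous_on {0..} (\<lambda>t. X t (snd p))"
      using X p by (auto simp: adapted_continuous_def)
    show "(\<lambda>k. X (r k \<lceil>fst p * real (Suc k)\<rceil>) (snd p)) \<longlonglongrightarrow> X (fst p) (snd p)"
      by (rule continuous_on_tendsto_compose[OF cont lim]) (use p T in \<open>auto simp: r_def\<close>)
  qed
qed

section \<open>Sections and iterated integrals over bounded horizons\<close>

lemma time_space_section:
  assumes "f \<in> borel_measurable (time_space T)"
  shows "\<omega> \<in> space M \<Longrightarrow> (\<lambda>t. f (t, \<omega>)) \<in> borel_measurable (restrict_space lborel {0..T})"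
    and "0 \<le> t \<Longrightarrow> t \<le> T \<Longrightarrow> (\<lambda>\<omega>. f (t, \<omega>)) \<in> borel_measurable M"
  using assms unfolding time_space_def
  by (auto intro: measurable_compose[OF measurable_Pair2'] measurable_compose[OF measurable_Pair1']
      simp: space_restrict_space)

lemma nn_integral_time_space_fst:
  assumes "f \<in> borel_measurable (time_space T)"
  shows "(\<integral>\<^sup>+p. f p \<partial>time_space T) = (\<integral>\<^sup>+t\<in>{0..T}. (\<integral>\<^sup>+\<omega>. f (t, \<omega>) \<partial>M) \<partial>lborel)"
    and "(\<lambda>t. (\<integral>\<^sup>+\<omega>. f (t, \<omega>) \<partial>M) * indicator {0..T} t) \<in> borel_measurable borel"
proof -
  show "(\<integral>\<^sup>+p. f p \<partial>time_space T) = (\<integral>\<^sup>+t\<in>{0..T}. (\<integral>\<^sup>+\<omega>. f (t, \<omega>) \<partial>M) \<partial>lborel)"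
    using assms unfolding time_space_def
    by (simp add: nn_integral_restrict_space flip: nn_integral_fst)
  have "(\<lambda>t. \<integral>\<^sup>+\<omega>. f (t, \<omega>) \<partial>M) \<in> borel_measurable (restrict_space lborel {0..T})"
    using assms unfolding time_space_def by (rule borel_measurable_nn_integral_fst)
  then show "(\<lambda>t. (\<integral>\<^sup>+\<omega>. f (t, \<omega>) \<partial>M) * indicator {0..T} t) \<in> borel_measurable borel"
    by (simp add: borel_measurable_restrict_space_iff_ennreal)
qed

lemma nn_integral_time_section_measurable:
  assumes "f \<in> borel_measurable (time_space T)"
  shows "(\<lambda>\<omega>. \<integral>\<^sup>+t\<in>{0..T}. f (t, \<omega>) \<partial>lborel) \<in> borel_measurable M"
proof -
  interpret T: finite_measure "restrict_space lborel {0..T}"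
    by (rule finite_measure_restrict_Icc)
  have "(\<lambda>(\<omega>, t). f (t, \<omega>)) \<in> borel_measurable (M \<Otimes>\<^sub>M restrict_space lborel {0..T})"
    using measurable_compose[OF measurable_pair_swap' assms[unfolded time_space_def]]
    by (simp add: split_beta)
  from T.borel_measurable_nn_integral[OF this] show ?thesis
    by (simp add: nn_integral_restrict_space)
qed

lemma L2_time_section:
  fixes \<phi> :: "real \<Rightarrow> 'a \<Rightarrow> 'b::euclidean_space"
  assumes "L2 (time_space T) (\<lambda>p. \<phi> (fst p) (snd p))"
  shows "AE \<omega> in M. L2 (restrict_space lborel {0..T}) (\<lambda>t. \<phi> t \<omega>)"
proof -
  interpret pair_sigma_finite "restrict_space lborel {0..T}" M
    by (rule pair_sigma_finite_time_space)
  have "AE \<omega> in M. integrable (restrict_space lborel {0..T}) (\<lambda>t. (norm (\<phi> t \<omega>))\<^sup>2)"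
    using assms by (intro AE_integrable_snd) (simp add: L2_def time_space_def split_beta')
  moreover have "(\<lambda>t. \<phi> t \<omega>) \<in> borel_measurable (restrict_space lborel {0..T})"
    if "\<omega> \<in> space M" for \<omega>
    using time_space_section(1)[OF L2_measurable[OF assms] that] by simp
  ultimately show ?thesis by (auto simp: L2_def)
qed

lemma L2F_L2_time_space:
  fixes \<phi> :: "real \<Rightarrow> 'a \<Rightarrow> 'b::euclidean_space"
  assumes \<phi>: "progressive M W \<phi>" "sq_integrable M \<phi>" and T: "0 \<le> T"
  shows "L2 (time_space T) (\<lambda>p. \<phi> (fst p) (snd p))"
    and "(\<integral>\<^sup>+p. ennreal ((norm (\<phi> (fst p) (snd p)))\<^sup>2) \<partial>time_space T) \<le>
      (\<integral>\<^sup>+\<omega>. (\<integral>\<^sup>+t\<in>{0..}. ennreal ((norm (\<phi> t \<omega>))\<^sup>2) \<partial>lborel) \<partial>M)"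
proof -
  note m = progressive_measurable[OF \<phi>(1) T]
  have "(\<integral>\<^sup>+p. ennreal ((norm (\<phi> (fst p) (snd p)))\<^sup>2) \<partial>time_space T) =
      (\<integral>\<^sup>+\<omega>. (\<integral>\<^sup>+t\<in>{0..T}. ennreal ((norm (\<phi> t \<omega>))\<^sup>2) \<partial>lborel) \<partial>M)"
    using m by (subst nn_integral_time_space) auto
  also have "\<dots> \<le> (\<integral>\<^sup>+\<omega>. (\<integral>\<^sup>+t\<in>{0..}. ennreal ((norm (\<phi> t \<omega>))\<^sup>2) \<partial>lborel) \<partial>M)"
    by (intro nn_integral_mono mult_left_mono) (auto simp: indicator_def)
  finally show le: "(\<integral>\<^sup>+p. ennreal ((norm (\<phi> (fst p) (snd p)))\<^sup>2) \<partial>time_space T) \<le>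
      (\<integral>\<^sup>+\<omega>. (\<integral>\<^sup>+t\<in>{0..}. ennreal ((norm (\<phi> t \<omega>))\<^sup>2) \<partial>lborel) \<partial>M)" .
  show "L2 (time_space T) (\<lambda>p. \<phi> (fst p) (snd p))"
    using le_less_trans[OF le] \<phi>(2) m by (intro L2I_nn_integral) (auto simp: sq_integrable_def)
qed

text \<open>\<open>progressive\<close> supplies joint measurability one horizon at a time, so the
  half-line is reached by monotone convergence along integer horizons: once in time for a fixed
  path, once in expectation.\<close>

lemma sq_integrableI:
  fixes \<phi> :: "real \<Rightarrow> 'a \<Rightarrow> 'b::euclidean_space"
  assumes \<phi>: "progressive M W \<phi>" and K: "K < \<infinity>"
    and le: "\<And>T. 0 \<le> T \<Longrightarrow>
      (\<integral>\<^sup>+p. ennreal ((norm (\<phi> (fst p) (snd p)))\<^sup>2) \<partial>time_space T) \<le> K"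
  shows "sq_integrable M \<phi>"
proof -
  let ?f = "\<lambda>p. ennreal ((norm (\<phi> (fst p) (snd p)))\<^sup>2)"
  define g where "g n \<omega> = (\<integral>\<^sup>+t\<in>{0..real n}. ?f (t, \<omega>) \<partial>lborel)" for n \<omega>
  have f_m: "?f \<in> borel_measurable (time_space (real n))" for n
    using progressive_measurable[OF \<phi>, of "real n"] by simp
  have "(\<integral>\<^sup>+t\<in>{0..}. ?f (t, \<omega>) \<partial>lborel) = (SUP n. g n \<omega>)" if "\<omega> \<in> space M" for \<omega>
  proof -
    have "(\<integral>\<^sup>+t. (SUP n. ?f (t, \<omega>) * indicator {0..real n} t) \<partial>lborel) = (SUP n. g n \<omega>)"
      unfolding g_def
    proof (rule nn_integral_monotone_convergence_SUP)
      show "incseq (\<lambda>n t. ?f (t, \<omega>) * indicator {0..real n} t)"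
        by (intro incseq_SucI le_funI mult_left_mono) (auto simp: indicator_def)
      show "(\<lambda>t. ?f (t, \<omega>) * indicator {0..real n} t) \<in> borel_measurable lborel" for n
        using time_space_section(1)[OF f_m[of n] that]
        by (subst (asm) borel_measurable_restrict_space_iff_ennreal) auto
    qed
    also have "(\<lambda>t. SUP n. ?f (t, \<omega>) * indicator {0..real n} t) = (\<lambda>t. ?f (t, \<omega>) * indicator {0..} t)"
    proof
      fix t :: real
      show "(SUP n. ?f (t, \<omega>) * indicator {0..real n} t) = ?f (t, \<omega>) * indicator {0..} t"
      proof (rule antisym)
        show "(SUP n. ?f (t, \<omega>) * indicator {0..real n} t) \<le> ?f (t, \<omega>) * indicator {0..} t"
          by (intro SUP_least mult_left_mono) (auto simp: indicator_def)
        obtain n where "t \<le> real n" using real_arch_simple by blast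
        then have "?f (t, \<omega>) * indicator {0..} t = ?f (t, \<omega>) * indicator {0..real n} t"
          by (simp add: indicator_def)
        then show "?f (t, \<omega>) * indicator {0..} t \<le> (SUP n. ?f (t, \<omega>) * indicator {0..real n} t)"
          by (metis (mono_tags, lifting) SUP_upper UNIV_I)
      qed
    qed
    finally show ?thesis .
  qed
  then have "(\<integral>\<^sup>+\<omega>. (\<integral>\<^sup>+t\<in>{0..}. ?f (t, \<omega>) \<partial>lborel) \<partial>M) = (\<integral>\<^sup>+\<omega>. (SUP n. g n \<omega>) \<partial>M)"
    by (rule nn_integral_cong)
  also have "\<dots> = (SUP n. \<integral>\<^sup>+\<omega>. g n \<omega> \<partial>M)"
  proof (rule nn_integral_monotone_convergence_SUP)
    show "incseq g"
      unfolding g_def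
      by (intro incseq_SucI le_funI nn_integral_mono mult_left_mono) (auto simp: indicator_def)
    show "g n \<in> borel_measurable M" for n
      unfolding g_def by (rule nn_integral_time_section_measurable[OF f_m])
  qed
  also have "\<dots> \<le> K"
  proof (rule SUP_least)
    fix n
    show "(\<integral>\<^sup>+\<omega>. g n \<omega> \<partial>M) \<le> K"
      using le[of "real n"] nn_integral_time_space[OF f_m[of n]] by (simp add: g_def)
  qed
  finally show ?thesis using K by (simp add: sq_integrable_def)
qed

section \<open>The drift integral as a process\<close>

definition drift :: "(real \<Rightarrow> 'a \<Rightarrow> 'b::euclidean_space) \<Rightarrow> real \<Rightarrow> 'a \<Rightarrow> 'b" where
  "drift a t \<omega> = (LINT s:{0..t}|lborel. a s \<omega>)"

lemma drift_restrict: "drift a t \<omega> = (\<integral>s. a s \<omega> \<partial>restrict_space lborel {0..t})"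
  by (simp add: drift_def set_lebesgue_integral_def integral_restrict_space)

text \<open>The variable upper end becomes an indicator over a fixed interval, so that the drift is
  a parameter integral to which measurability theorems and Fubini apply.\<close>

lemma drift_eq:
  assumes "t \<le> T"
  shows "drift a t \<omega> = (\<integral>s. indicator {..t} s *\<^sub>R a s \<omega> \<partial>restrict_space lborel {0..T})"
  unfolding drift_def set_lebesgue_integral_def using assms
  by (auto simp: integral_restrict_space indicator_def intro!: Bochner_Integration.integral_cong)

lemma drift_measurable:
  fixes a :: "real \<Rightarrow> 'a \<Rightarrow> 'b::euclidean_space"
  assumes a: "(\<lambda>p. a (fst p) (snd p)) \<in> borel_measurable (time_space T)"
  shows "(\<lambda>p. drift a (fst p) (snd p)) \<in> borel_measurable (time_space T)"
proof -
  interpret T: finite_measure "restrict_space lborel {0..T}"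
    by (rule finite_measure_restrict_Icc)
  let ?N = "time_space T \<Otimes>\<^sub>M restrict_space lborel {0..T}"
  have "(\<lambda>q. (snd q, snd (fst q))) \<in> measurable ?N (time_space T)"
    unfolding time_space_def[of T]
    by (intro measurable_Pair measurable_snd measurable_compose[OF measurable_fst measurable_snd])
  from measurable_compose[OF this a]
  have 1: "(\<lambda>q. a (snd q) (snd (fst q))) \<in> borel_measurable ?N" by simp
  have "snd \<in> measurable ?N (restrict_space lborel {0..T})" by (rule measurable_snd)
  then have 2: "snd \<in> borel_measurable ?N"
    by (simp add: measurable_restrict_space2_iff)
  have 3: "(\<lambda>q. fst (fst q)) \<in> borel_measurable ?N"
    by (rule measurable_compose[OF measurable_fst measurable_time_fst])
  have "{q \<in> space ?N. snd q \<le> fst (fst q)} \<in> sets ?N"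
    by (rule borel_measurable_le[OF 2 3])
  then have "(\<lambda>q. indicator {q \<in> space ?N. snd q \<le> fst (fst q)} q *\<^sub>R a (snd q) (snd (fst q)))
      \<in> borel_measurable ?N"
    using 1 by simp
  then have "(\<lambda>q. indicator {..fst (fst q)} (snd q) *\<^sub>R a (snd q) (snd (fst q))) \<in> borel_measurable ?N"
    by (rule measurable_cong[THEN iffD1, rotated]) (simp add: indicator_def)
  then have "(\<lambda>(p, s). indicator {..fst p} s *\<^sub>R a s (snd p)) \<in> borel_measurable ?N"
    by (simp add: split_beta')
  from T.borel_measurable_lebesgue_integral[OF this]
  have "(\<lambda>p. \<integral>s. indicator {..fst p} s *\<^sub>R a s (snd p) \<partial>restrict_space lborel {0..T})
      \<in> borel_measurable (time_space T)" .
  then show ?thesis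
    by (rule measurable_cong[THEN iffD1, rotated]) (auto simp: space_time_space drift_eq)
qed

lemma ito_isometry_norm:
  fixes \<phi> :: "real \<Rightarrow> 'a \<Rightarrow> 'b::euclidean_space"
  assumes J: "has_ito_integral M W \<phi> T J" and T: "0 \<le> T"
  shows "(\<integral>\<^sup>+\<omega>. ennreal ((norm (J \<omega>))\<^sup>2) \<partial>M) =
    (\<integral>\<^sup>+p. ennreal ((norm (\<phi> (fst p) (snd p)))\<^sup>2) \<partial>time_space T)"
  using L2_nn_integral[OF has_ito_integral_L2(1)[OF J T]]
    L2_nn_integral[OF has_ito_integral_L2(2)[OF J T]]
    ito_isometry[OF bounded_bilinear_inner T J J]
  by (simp add: power2_norm_eq_inner)

end

section \<open>Second moments of solutions on bounded horizons\<close>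

lemma matrix_vector_mult_measurable:
  fixes A :: "real^'n^'m"
  assumes "f \<in> borel_measurable N"
  shows "(\<lambda>x. A *v f x) \<in> borel_measurable N"
  using assms by (rule measurable_compose)
    (intro borel_measurable_continuous_onI linear_continuous_on matrix_vector_mul_bounded_linear)

context brownian
begin

lemma sde_solutionD:
  fixes X :: "real \<Rightarrow> 'a \<Rightarrow> real^'n"
  assumes "sde_solution M W A C \<beta> \<gamma> x X"
  shows "progressive M W X" "\<omega> \<in> space M \<Longrightarrow> continuous_on {0..} (\<lambda>t. X t \<omega>)"
    and "0 \<le> t \<Longrightarrow> \<exists>J. has_ito_integral M W (\<lambda>s \<omega>. C *v X s \<omega> + \<gamma> s \<omega>) t J \<and>
      (AE \<omega> in M. X t \<omega> = x + drift (\<lambda>s \<omega>. A *v X s \<omega> + \<beta> s \<omega>) t \<omega> + J \<omega>)"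
  using assms by (auto simp: sde_solution_def drift_def adapted_continuous_def
      intro: adapted_continuous_progressive)

text \<open>Existence of the Ito integral puts \<open>C X + \<gamma>\<close> in mean-square space,
  so the isometry controls the martingale part. The drift contains \<open>X\<close> itself and is
  treated by Gronwall along each path. The resulting bound is linear in the path integral of
  \<open>g\<close>, so it can be averaged.\<close>

lemma sde_solution_L2:
  fixes X :: "real \<Rightarrow> 'a \<Rightarrow> real^'n"
  assumes sde: "sde_solution M W A C \<beta> \<gamma> x X" and T: "0 \<le> T"
    and \<beta>: "L2 (time_space T) (\<lambda>p. \<beta> (fst p) (snd p))"
  shows "L2 (time_space T) (\<lambda>p. X (fst p) (snd p))"
proof (rule L2I_nn_integral)
  define a where "a s \<omega> = A *v X s \<omega> + \<beta> s \<omega>" for s \<omega>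
  define c where "c s \<omega> = C *v X s \<omega> + \<gamma> s \<omega>" for s \<omega>
  \<comment> \<open>What remains after the drift is removed. At each fixed time it equals
    \<open>x + J\<close> almost surely, but unlike the separately chosen integrals \<open>J\<close>
    it is jointly measurable in time and path.\<close>
  define U where "U t \<omega> = X t \<omega> - drift a t \<omega>" for t \<omega>
  define b where "b \<omega> = (\<integral>\<^sup>+s\<in>{0..T}. ennreal ((norm (\<beta> s \<omega>))\<^sup>2) \<partial>lborel)" for \<omega>
  obtain k where k: "k > 0" "\<And>y. (norm (A *v y))\<^sup>2 \<le> k * (norm y)\<^sup>2"
    by (rule matrix_vector_mult_bound[of A]) (rule that)
  note sol = sde_solutionD(3)[OF sde, folded a_def c_def]
  show X_m: "(\<lambda>p. X (fst p) (snd p)) \<in> borel_measurable (time_space T)"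
    by (rule progressive_measurable[OF sde_solutionD(1)[OF sde] T])
  have a_m: "(\<lambda>p. a (fst p) (snd p)) \<in> borel_measurable (time_space T)"
    unfolding a_def by (intro borel_measurable_add matrix_vector_mult_measurable X_m L2_measurable[OF \<beta>])
  have U_m: "(\<lambda>p. U (fst p) (snd p)) \<in> borel_measurable (time_space T)"
    unfolding U_def by (intro borel_measurable_diff X_m drift_measurable a_m)
  \<comment> \<open>Squaring \<open>X = U + drift\<close> gives a factor 2, splitting the drift
    integrand another 2, and Cauchy-Schwarz in time a factor of at most \<open>T\<close>. The
    summand 1 keeps \<open>K\<close> positive at \<open>T = 0\<close>.\<close>
  define K where "K = 4 * T * k + 1"
  have K: "K > 0" using T k(1) by (simp add: K_def add_nonneg_pos)
  define g where "g t \<omega> = 2 * ennreal ((norm (U t \<omega>))\<^sup>2) + ennreal (4 * T) * b \<omega>" for t \<omega>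
  have path: "(\<integral>\<^sup>+t\<in>{0..T}. ennreal ((norm (X t \<omega>))\<^sup>2) \<partial>lborel) \<le>
      ennreal (2 * exp (2 * K * T)) * (\<integral>\<^sup>+t\<in>{0..T}. g t \<omega> \<partial>lborel)" if \<omega>: "\<omega> \<in> space M" for \<omega>
  proof -
    have X\<omega>: "(\<lambda>t. X t \<omega>) \<in> borel_measurable (restrict_space lborel {0..T})"
      and \<beta>\<omega>: "(\<lambda>t. \<beta> t \<omega>) \<in> borel_measurable (restrict_space lborel {0..T})"
      and a\<omega>: "(\<lambda>t. a t \<omega>) \<in> borel_measurable (restrict_space lborel {0..T})"
      and U\<omega>: "(\<lambda>t. U t \<omega>) \<in> borel_measurable (restrict_space lborel {0..T})"
      using time_space_section(1)[OF X_m \<omega>] time_space_section(1)[OF L2_measurable[OF \<beta>] \<omega>]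
        time_space_section(1)[OF a_m \<omega>] time_space_section(1)[OF U_m \<omega>] by simp_all
    let ?f = "\<lambda>t. ennreal ((norm (X t \<omega>))\<^sup>2) * indicator {0..T} t"
    let ?g = "\<lambda>t. g t \<omega> * indicator {0..T} t"
    have f_m: "?f \<in> borel_measurable borel"
      using X\<omega> by (subst borel_measurable_restrict_space_iff_ennreal[of "{0..T}" lborel, symmetric, simplified]) simp_all
    have \<beta>_m: "(\<lambda>t. ennreal ((norm (\<beta> t \<omega>))\<^sup>2) * indicator {0..T} t) \<in> borel_measurable borel"
      using \<beta>\<omega> by (subst borel_measurable_restrict_space_iff_ennreal[of "{0..T}" lborel, symmetric, simplified]) simp_all
    have g_m: "?g \<in> borel_measurable borel"
      using U\<omega> unfolding g_def
      by (subst borel_measurable_restrict_space_iff_ennreal[of "{0..T}" lborel, symmetric, simplified]) simp_all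
    \<comment> \<open>The finiteness that Gronwall requires comes from continuity: each path is
      bounded on the compact interval.\<close>
    have f_fin: "(\<integral>\<^sup>+t\<in>{0..T}. ?f t \<partial>lborel) < \<infinity>"
    proof -
      have "compact ((\<lambda>t. X t \<omega>) ` {0..T})"
        by (intro compact_continuous_image continuous_on_subset[OF sde_solutionD(2)[OF sde \<omega>]]) auto
      then obtain B where B: "\<And>t. t \<in> {0..T} \<Longrightarrow> norm (X t \<omega>) \<le> B"
        using compact_imp_bounded bounded_iff by (metis image_eqI)
      have "(\<integral>\<^sup>+t\<in>{0..T}. ?f t \<partial>lborel) \<le> (\<integral>\<^sup>+t. ennreal (B\<^sup>2) * indicator {0..T} t \<partial>lborel)"
        using B by (intro nn_integral_mono) (auto simp: indicator_def intro!: ennreal_leI power_mono)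
      also have "\<dots> < \<infinity>" using T by (simp add: nn_integral_cmult_indicator ennreal_mult_less_top)
      finally show ?thesis .
    qed
    have step: "?f t \<le> ?g t + ennreal K * (\<integral>\<^sup>+s\<in>{0..t}. ?f s \<partial>lborel)" if t: "0 \<le> t" "t \<le> T" for t
    proof -
      have sub: "h \<in> borel_measurable (restrict_space lborel {0..t})"
        if "h \<in> borel_measurable (restrict_space lborel {0..T})" for h :: "real \<Rightarrow> real^'n"
        using that t by (auto intro: measurable_restrict_mono)
      have "ennreal ((norm (drift a t \<omega>))\<^sup>2) \<le>
          ennreal t * (\<integral>\<^sup>+s\<in>{0..t}. ennreal ((norm (a s \<omega>))\<^sup>2) \<partial>lborel)"
        unfolding drift_def by (rule norm_set_integral_square_le[OF sub[OF a\<omega>] t(1)])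
      also have "(\<integral>\<^sup>+s\<in>{0..t}. ennreal ((norm (a s \<omega>))\<^sup>2) \<partial>lborel) \<le>
          (\<integral>\<^sup>+s. ennreal (2 * k) * (?f s * indicator {0..t} s) +
            2 * (ennreal ((norm (\<beta> s \<omega>))\<^sup>2) * indicator {0..T} s) \<partial>lborel)"
      proof (intro nn_integral_mono)
        fix s :: real
        have "(norm (a s \<omega>))\<^sup>2 \<le> 2 * k * (norm (X s \<omega>))\<^sup>2 + 2 * (norm (\<beta> s \<omega>))\<^sup>2"
          using norm_add_power2_le[of "A *v X s \<omega>" "\<beta> s \<omega>"] k(2)[of "X s \<omega>"] by (simp add: a_def)
        then have "ennreal ((norm (a s \<omega>))\<^sup>2) \<le>
            ennreal (2 * k) * ennreal ((norm (X s \<omega>))\<^sup>2) + 2 * ennreal ((norm (\<beta> s \<omega>))\<^sup>2)"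
          using k(1) by (subst ennreal_mult[symmetric]) (auto simp flip: ennreal_mult' ennreal_numeral ennreal_plus)
        then show "ennreal ((norm (a s \<omega>))\<^sup>2) * indicator {0..t} s \<le>
            ennreal (2 * k) * (?f s * indicator {0..t} s) +
            2 * (ennreal ((norm (\<beta> s \<omega>))\<^sup>2) * indicator {0..T} s)"
          using t by (cases "s \<in> {0..t}") auto
      qed
      also have "\<dots> = ennreal (2 * k) * (\<integral>\<^sup>+s\<in>{0..t}. ?f s \<partial>lborel) + 2 * b \<omega>"
        unfolding b_def using f_m \<beta>_m
        by (subst nn_integral_add) (auto simp: nn_integral_cmult)
      finally have drift_le: "ennreal ((norm (drift a t \<omega>))\<^sup>2) \<le>
          ennreal t * (ennreal (2 * k) * (\<integral>\<^sup>+s\<in>{0..t}. ?f s \<partial>lborel) + 2 * b \<omega>)"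
        by (simp add: mult_left_mono)
      have "?f t = ennreal ((norm (U t \<omega> + drift a t \<omega>))\<^sup>2)"
        using t by (simp add: U_def)
      also have "\<dots> \<le> ennreal (2 * (norm (U t \<omega>))\<^sup>2 + 2 * (norm (drift a t \<omega>))\<^sup>2)"
        by (intro ennreal_leI norm_add_power2_le)
      also have "\<dots> = 2 * ennreal ((norm (U t \<omega>))\<^sup>2) + 2 * ennreal ((norm (drift a t \<omega>))\<^sup>2)"
        by (simp add: ennreal_mult')
      also have "\<dots> \<le> 2 * ennreal ((norm (U t \<omega>))\<^sup>2) +
          2 * (ennreal T * (ennreal (2 * k) * (\<integral>\<^sup>+s\<in>{0..t}. ?f s \<partial>lborel) + 2 * b \<omega>))"
        using t by (intro add_mono mult_left_mono order_refl order_trans[OF drift_le] mult_right_mono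
            ennreal_leI) auto
      also have "\<dots> = ?g t + ennreal (4 * T * k) * (\<integral>\<^sup>+s\<in>{0..t}. ?f s \<partial>lborel)"
      proof -
        have "2 * (ennreal T * (ennreal (2 * k) * y + 2 * z)) =
            ennreal (4 * T) * z + ennreal (4 * T * k) * y" for y z
        proof -
          have "ennreal (4 * T) = 2 * (ennreal T * 2)" "ennreal (4 * T * k) = 2 * (ennreal T * ennreal (2 * k))"
            using T k(1) by (simp_all add: ennreal_mult mult_ac)
          then show ?thesis by (simp add: distrib_left mult_ac add.commute)
        qed
        then show ?thesis using t by (simp add: g_def add.assoc)
      qed
      also have "\<dots> \<le> ?g t + ennreal K * (\<integral>\<^sup>+s\<in>{0..t}. ?f s \<partial>lborel)"
        by (intro add_mono order_refl mult_right_mono ennreal_leI) (simp_all add: K_def)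
      finally show ?thesis .
    qed
    have ind: "y * indicator {0..T} t * indicator {0..T} t = y * indicator {0..T} t"
      for y :: ennreal and t :: real by (simp add: indicator_def)
    show ?thesis
      using gronwall_nn_integral[OF f_m g_m K step f_fin] unfolding ind by simp
  qed
  obtain J where J: "has_ito_integral M W c T J" using sol[OF T] by blast
  define G where "G = (\<integral>\<^sup>+p. ennreal ((norm (c (fst p) (snd p)))\<^sup>2) \<partial>time_space T)"
  have G: "G < \<infinity>"
    using L2_nn_integral[OF has_ito_integral_L2(1)[OF J T]] by (simp add: G_def)
  \<comment> \<open>The integral depends on \<open>t\<close>, but its second moment is the mass of
    the same integrand \<open>c\<close> over \<open>[0, t]\<close>, so \<open>G\<close> bounds all
    of them.\<close>
  have U_le: "(\<integral>\<^sup>+\<omega>. ennreal ((norm (U t \<omega>))\<^sup>2) \<partial>M) \<le> 2 * ennreal ((norm x)\<^sup>2) + 2 * G"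
    if t: "0 \<le> t" "t \<le> T" for t
  proof -
    obtain J where J: "has_ito_integral M W c t J" and eq: "AE \<omega> in M. X t \<omega> = x + drift a t \<omega> + J \<omega>"
      using sol[OF t(1)] by blast
    have c_m: "(\<lambda>p. ennreal ((norm (c (fst p) (snd p)))\<^sup>2)) \<in> borel_measurable (time_space r)"
      if "0 \<le> r" for r
      using progressive_measurable[OF _ that, of c] J by (simp add: has_ito_integral_def)
    have "(\<integral>\<^sup>+\<omega>. ennreal ((norm (U t \<omega>))\<^sup>2) \<partial>M) = (\<integral>\<^sup>+\<omega>. ennreal ((norm (x + J \<omega>))\<^sup>2) \<partial>M)"
      by (rule nn_integral_cong_AE) (use eq in \<open>auto simp: U_def algebra_simps elim: eventually_mono\<close>)
    also have "\<dots> \<le> 2 * (\<integral>\<^sup>+\<omega>. ennreal ((norm x)\<^sup>2) \<partial>M) + 2 * (\<integral>\<^sup>+\<omega>. ennreal ((norm (J \<omega>))\<^sup>2) \<partial>M)"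
      using J by (intro nn_integral_norm_add_le) (auto simp: has_ito_integral_def)
    also have "(\<integral>\<^sup>+\<omega>. ennreal ((norm (J \<omega>))\<^sup>2) \<partial>M) =
        (\<integral>\<^sup>+p. ennreal ((norm (c (fst p) (snd p)))\<^sup>2) \<partial>time_space t)"
      by (rule ito_isometry_norm[OF J t(1)])
    also have "\<dots> \<le> G"
      unfolding G_def using t T by (intro nn_integral_time_space_mono c_m) auto
    finally show ?thesis by (simp add: emeasure_space_1 add_left_mono mult_left_mono)
  qed
  have b_m: "b \<in> borel_measurable M"
    using nn_integral_time_section_measurable[of "\<lambda>p. ennreal ((norm (\<beta> (fst p) (snd p)))\<^sup>2)"]
      L2_measurable[OF \<beta>] by (simp add: b_def[abs_def])
  have g_m: "(\<lambda>p. g (fst p) (snd p)) \<in> borel_measurable (time_space T)"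
    unfolding g_def using U_m measurable_compose[OF measurable_time_snd b_m] by simp
  have b_fin: "(\<integral>\<^sup>+\<omega>. b \<omega> \<partial>M) < \<infinity>"
  proof -
    have "(\<integral>\<^sup>+\<omega>. b \<omega> \<partial>M) = (\<integral>\<^sup>+p. ennreal ((norm (\<beta> (fst p) (snd p)))\<^sup>2) \<partial>time_space T)"
      using L2_measurable[OF \<beta>] by (subst nn_integral_time_space) (auto simp: b_def[abs_def])
    then show ?thesis using L2_nn_integral[OF \<beta>] by simp
  qed
  have "(\<integral>\<^sup>+p. ennreal ((norm (X (fst p) (snd p)))\<^sup>2) \<partial>time_space T) =
      (\<integral>\<^sup>+\<omega>. (\<integral>\<^sup>+t\<in>{0..T}. ennreal ((norm (X t \<omega>))\<^sup>2) \<partial>lborel) \<partial>M)"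
    using X_m by (subst nn_integral_time_space) auto
  also have "\<dots> \<le> (\<integral>\<^sup>+\<omega>. ennreal (2 * exp (2 * K * T)) * (\<integral>\<^sup>+t\<in>{0..T}. g t \<omega> \<partial>lborel) \<partial>M)"
    using path by (rule nn_integral_mono)
  also have "\<dots> = ennreal (2 * exp (2 * K * T)) * (\<integral>\<^sup>+\<omega>. (\<integral>\<^sup>+t\<in>{0..T}. g t \<omega> \<partial>lborel) \<partial>M)"
    using nn_integral_time_section_measurable[OF g_m] by (intro nn_integral_cmult) simp
  also have "(\<integral>\<^sup>+\<omega>. (\<integral>\<^sup>+t\<in>{0..T}. g t \<omega> \<partial>lborel) \<partial>M) = (\<integral>\<^sup>+p. g (fst p) (snd p) \<partial>time_space T)"
    using nn_integral_time_space[OF g_m] by simp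
  also have "\<dots> = (\<integral>\<^sup>+t\<in>{0..T}. (\<integral>\<^sup>+\<omega>. g t \<omega> \<partial>M) \<partial>lborel)"
    using nn_integral_time_space_fst(1)[OF g_m] by simp
  also have "\<dots> \<le> (\<integral>\<^sup>+t. (2 * (2 * ennreal ((norm x)\<^sup>2) + 2 * G) + ennreal (4 * T) * (\<integral>\<^sup>+\<omega>. b \<omega> \<partial>M)) *
      indicator {0..T} t \<partial>lborel)"
  proof (intro nn_integral_mono)
    fix t :: real
    show "(\<integral>\<^sup>+\<omega>. g t \<omega> \<partial>M) * indicator {0..T} t \<le>
      (2 * (2 * ennreal ((norm x)\<^sup>2) + 2 * G) + ennreal (4 * T) * (\<integral>\<^sup>+\<omega>. b \<omega> \<partial>M)) * indicator {0..T} t"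
    proof (cases "t \<in> {0..T}")
      case True
      then have "U t \<in> borel_measurable M"
        using time_space_section(2)[OF U_m, of t] by simp
      then have "(\<integral>\<^sup>+\<omega>. g t \<omega> \<partial>M) =
          2 * (\<integral>\<^sup>+\<omega>. ennreal ((norm (U t \<omega>))\<^sup>2) \<partial>M) + ennreal (4 * T) * (\<integral>\<^sup>+\<omega>. b \<omega> \<partial>M)"
        unfolding g_def using b_m by (simp add: nn_integral_add nn_integral_cmult)
      also have "\<dots> \<le> 2 * (2 * ennreal ((norm x)\<^sup>2) + 2 * G) + ennreal (4 * T) * (\<integral>\<^sup>+\<omega>. b \<omega> \<partial>M)"
        using True by (intro add_mono mult_left_mono U_le order_refl) auto
      finally show ?thesis by (rule mult_right_mono) simp
    qed simp
  qed
  also have "\<dots> = (2 * (2 * ennreal ((norm x)\<^sup>2) + 2 * G) + ennreal (4 * T) * (\<integral>\<^sup>+\<omega>. b \<omega> \<partial>M)) * ennreal T"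
    using T by (simp add: nn_integral_cmult_indicator)
  finally have "(\<integral>\<^sup>+p. ennreal ((norm (X (fst p) (snd p)))\<^sup>2) \<partial>time_space T) \<le>
    ennreal (2 * exp (2 * K * T)) *
      ((2 * (2 * ennreal ((norm x)\<^sup>2) + 2 * G) + ennreal (4 * T) * (\<integral>\<^sup>+\<omega>. b \<omega> \<partial>M)) * ennreal T)"
    by (simp add: mult_left_mono)
  also have "\<dots> < \<infinity>"
    using G b_fin by (simp add: ennreal_mult_less_top)
  finally show "(\<integral>\<^sup>+p. ennreal ((norm (X (fst p) (snd p)))\<^sup>2) \<partial>time_space T) < \<infinity>" .
qed

end

subsection \<open>The energy identity\<close>

lemma bilinear_integral_right:
  fixes h :: "'b::euclidean_space \<Rightarrow> 'c::euclidean_space \<Rightarrow> real"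
  assumes "bounded_bilinear h" "integrable N f"
  shows "(\<integral>x. h y (f x) \<partial>N) = h y (\<integral>x. f x \<partial>N)"
  by (rule integral_bounded_linear[OF bounded_bilinear.bounded_linear_right[OF assms(1)] assms(2)])

lemma bilinear_integral_left:
  fixes h :: "'b::euclidean_space \<Rightarrow> 'c::euclidean_space \<Rightarrow> real"
  assumes "bounded_bilinear h" "integrable N f"
  shows "(\<integral>x. h (f x) y \<partial>N) = h (\<integral>x. f x \<partial>N) y"
  by (rule integral_bounded_linear[OF bounded_bilinear.bounded_linear_left[OF assms(1)] assms(2)])

lemma L2_fst:
  assumes "finite_measure N'" "L2 N f"
  shows "L2 (N \<Otimes>\<^sub>M N') (\<lambda>p. f (fst p))"
proof -
  interpret N': finite_measure N' by fact
  have f: "f \<in> borel_measurable N" by (rule L2_measurable[OF assms(2)])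
  have "(\<integral>\<^sup>+p. ennreal ((norm (f (fst p)))\<^sup>2) \<partial>(N \<Otimes>\<^sub>M N')) =
      (\<integral>\<^sup>+x. ennreal ((norm (f x))\<^sup>2) \<partial>N) * emeasure N' (space N')"
    using f by (subst N'.nn_integral_fst[symmetric]) (auto simp: nn_integral_multc)
  also have "\<dots> < \<infinity>"
    unfolding L2_nn_integral[OF assms(2)] by (simp add: ennreal_mult_less_top N'.emeasure_eq_measure)
  finally show ?thesis using f by (intro L2I_nn_integral) auto
qed

lemma L2_snd:
  assumes "finite_measure N" "sigma_finite_measure N'" "L2 N' f"
  shows "L2 (N \<Otimes>\<^sub>M N') (\<lambda>p. f (snd p))"
proof -
  interpret N: finite_measure N by fact
  interpret N': sigma_finite_measure N' by fact
  have f: "f \<in> borel_measurable N'" by (rule L2_measurable[OF assms(3)])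
  have "(\<integral>\<^sup>+p. ennreal ((norm (f (snd p)))\<^sup>2) \<partial>(N \<Otimes>\<^sub>M N')) =
      (\<integral>\<^sup>+x. ennreal ((norm (f x))\<^sup>2) \<partial>N') * emeasure N (space N)"
    using f by (subst N'.nn_integral_fst[symmetric]) auto
  also have "\<dots> < \<infinity>"
    unfolding L2_nn_integral[OF assms(3)] by (simp add: ennreal_mult_less_top N.emeasure_eq_measure)
  finally show ?thesis using f by (intro L2I_nn_integral) auto
qed

text \<open>The integrated product rule for \<open>h (F t) (F t)\<close>, where \<open>F\<close> is
  the primitive of \<open>f\<close>, proved by Fubini because \<open>F\<close> need not be
  differentiable at every point: the square is cut along the diagonal, and by symmetry of
  \<open>h\<close> the two triangles contribute equally.\<close>

lemma bilinear_square_integral: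
  fixes f :: "real \<Rightarrow> 'b::euclidean_space" and h :: "'b \<Rightarrow> 'b \<Rightarrow> real" and T :: real
  assumes h: "bounded_bilinear h" and sym: "\<And>y z. h y z = h z y"
    and f: "L2 (restrict_space lborel {0..T}) f"
  defines "N \<equiv> restrict_space lborel {0..T}"
  shows "h (\<integral>s. f s \<partial>N) (\<integral>s. f s \<partial>N) =
    2 * (\<integral>t. h (f t) (\<integral>s. indicator {..t} s *\<^sub>R f s \<partial>N) \<partial>N)"
proof -
  interpret bounded_bilinear h by fact
  have fin: "finite_measure N"
    unfolding N_def by (rule finite_measure_restrict_Icc)
  interpret N: finite_measure N by fact
  interpret pair_sigma_finite N N ..
  note f = f[folded N_def]
  have f_int: "integrable N f" by (rule L2_integrable[OF fin f])
  have sets_N: "A \<in> sets borel \<Longrightarrow> A \<inter> {0..T} \<in> sets N" for A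
    unfolding N_def by (subst sets_restrict_space) (auto simp: image_iff)
  have id_m: "(\<lambda>x. x) \<in> borel_measurable N"
    unfolding N_def by (intro measurable_restrict_space1) simp
  have fst_m: "fst \<in> borel_measurable (N \<Otimes>\<^sub>M N)"
    by (rule measurable_compose[OF measurable_fst id_m])
  have snd_m: "snd \<in> borel_measurable (N \<Otimes>\<^sub>M N)"
    by (rule measurable_compose[OF measurable_snd id_m])
  have int: "integrable (N \<Otimes>\<^sub>M N) (\<lambda>p. h (f (fst p)) (f (snd p)))"
    by (rule L2_bilinear_integrable[OF h L2_fst[OF fin f]
          L2_snd[OF fin N.sigma_finite_measure_axioms f]])
  let ?le = "{p \<in> space (N \<Otimes>\<^sub>M N). snd p \<le> fst p}"
  let ?gt = "{p \<in> space (N \<Otimes>\<^sub>M N). fst p < snd p}"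
  have le_m: "?le \<in> sets (N \<Otimes>\<^sub>M N)" by (rule borel_measurable_le[OF snd_m fst_m])
  have gt_m: "?gt \<in> sets (N \<Otimes>\<^sub>M N)" by (rule borel_measurable_less[OF fst_m snd_m])
  have int_le: "integrable (N \<Otimes>\<^sub>M N) (\<lambda>(t, s). indicator {..t} s * h (f t) (f s))"
    using integrable_real_mult_indicator[OF le_m int]
    by (rule Bochner_Integration.integrable_cong[THEN iffD1, rotated 2]) (auto simp: indicator_def)
  have int_gt: "integrable (N \<Otimes>\<^sub>M N) (\<lambda>(t, s). indicator {..<s} t * h (f t) (f s))"
    using integrable_real_mult_indicator[OF gt_m int]
    by (rule Bochner_Integration.integrable_cong[THEN iffD1, rotated 2]) (auto simp: indicator_def)
  define F where "F t = (\<integral>s. indicator {..t} s *\<^sub>R f s \<partial>N)" for t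
  have ind_int: "integrable N (\<lambda>s. indicator A s *\<^sub>R f s)" if "A \<in> sets borel" for A
  proof -
    have "integrable N (\<lambda>s. indicator (A \<inter> {0..T}) s *\<^sub>R f s)"
      by (rule integrable_mult_indicator[OF sets_N[OF that] f_int])
    then show ?thesis
      by (rule Bochner_Integration.integrable_cong[THEN iffD1, rotated 2])
        (auto simp: indicator_def N_def space_restrict_space)
  qed
  \<comment> \<open>One triangle is strict so that the two are disjoint; the excluded point has
    measure zero.\<close>
  have F_lt: "(\<integral>s. indicator {..<t} s *\<^sub>R f s \<partial>N) = F t" for t
    unfolding F_def
  proof (rule integral_cong_AE)
    have "AE s in lborel. s \<noteq> t" by (rule AE_lborel_singleton)
    then have "AE s in N. s \<noteq> t" unfolding N_def by (subst AE_restrict_space_iff) auto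
    then show "AE s in N. indicator {..<t} s *\<^sub>R f s = indicator {..t} s *\<^sub>R f s"
      by (rule eventually_mono) (simp add: indicator_def)
  qed (use ind_int in auto)
  have "h (\<integral>s. f s \<partial>N) (\<integral>s. f s \<partial>N) = (\<integral>t. (\<integral>s. h (f t) (f s) \<partial>N) \<partial>N)"
    using f_int by (simp add: bilinear_integral_left[OF h] bilinear_integral_right[OF h])
  also have "\<dots> = (\<integral>p. h (f (fst p)) (f (snd p)) \<partial>(N \<Otimes>\<^sub>M N))"
    using integral_fst'[OF int] by simp
  also have "\<dots> = (\<integral>p. (case p of (t, s) \<Rightarrow> indicator {..t} s * h (f t) (f s)) +
      (case p of (t, s) \<Rightarrow> indicator {..<s} t * h (f t) (f s)) \<partial>(N \<Otimes>\<^sub>M N))"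
    by (rule Bochner_Integration.integral_cong) (auto simp: indicator_def split_beta)
  also have "\<dots> = (\<integral>p. (case p of (t, s) \<Rightarrow> indicator {..t} s * h (f t) (f s)) \<partial>(N \<Otimes>\<^sub>M N)) +
      (\<integral>p. (case p of (t, s) \<Rightarrow> indicator {..<s} t * h (f t) (f s)) \<partial>(N \<Otimes>\<^sub>M N))"
    by (rule Bochner_Integration.integral_add[OF int_le int_gt])
  also have "(\<integral>p. (case p of (t, s) \<Rightarrow> indicator {..t} s * h (f t) (f s)) \<partial>(N \<Otimes>\<^sub>M N)) =
      (\<integral>t. (\<integral>s. h (f t) (indicator {..t} s *\<^sub>R f s) \<partial>N) \<partial>N)"
    using integral_fst[OF int_le] by (simp add: scaleR_right)
  also have "\<dots> = (\<integral>t. h (f t) (F t) \<partial>N)"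
    unfolding F_def by (intro Bochner_Integration.integral_cong refl bilinear_integral_right[OF h] ind_int) auto
  also have "(\<integral>p. (case p of (t, s) \<Rightarrow> indicator {..<s} t * h (f t) (f s)) \<partial>(N \<Otimes>\<^sub>M N)) =
      (\<integral>s. (\<integral>t. h (indicator {..<s} t *\<^sub>R f t) (f s) \<partial>N) \<partial>N)"
    using integral_snd[OF int_gt] by (simp add: scaleR_left)
  also have "\<dots> = (\<integral>s. h (F s) (f s) \<partial>N)"
    unfolding F_lt[symmetric]
    by (intro Bochner_Integration.integral_cong refl bilinear_integral_left[OF h] ind_int) auto
  also have "\<dots> = (\<integral>s. h (f s) (F s) \<partial>N)" by (simp only: sym)
  finally show ?thesis by (simp add: F_def)
qed

context brownian
begin

section \<open>Expectations of the drift and martingale parts\<close>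

lemma nn_integral_drift_le:
  fixes a :: "real \<Rightarrow> 'a \<Rightarrow> 'b::euclidean_space"
  assumes a: "(\<lambda>p. a (fst p) (snd p)) \<in> borel_measurable (time_space t)" and t: "0 \<le> t"
  shows "(\<integral>\<^sup>+\<omega>. ennreal ((norm (drift a t \<omega>))\<^sup>2) \<partial>M) \<le>
    ennreal t * (\<integral>\<^sup>+p. ennreal ((norm (a (fst p) (snd p)))\<^sup>2) \<partial>time_space t)"
proof -
  have "(\<integral>\<^sup>+\<omega>. ennreal ((norm (drift a t \<omega>))\<^sup>2) \<partial>M) \<le>
      (\<integral>\<^sup>+\<omega>. ennreal t * (\<integral>\<^sup>+s\<in>{0..t}. ennreal ((norm (a s \<omega>))\<^sup>2) \<partial>lborel) \<partial>M)"
  proof (rule nn_integral_mono)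
    fix \<omega> assume "\<omega> \<in> space M"
    then show "ennreal ((norm (drift a t \<omega>))\<^sup>2) \<le>
        ennreal t * (\<integral>\<^sup>+s\<in>{0..t}. ennreal ((norm (a s \<omega>))\<^sup>2) \<partial>lborel)"
      unfolding drift_def using time_space_section(1)[OF a]
      by (intro norm_set_integral_square_le t) simp
  qed
  also have "\<dots> = ennreal t * (\<integral>\<^sup>+\<omega>. (\<integral>\<^sup>+s\<in>{0..t}. ennreal ((norm (a s \<omega>))\<^sup>2) \<partial>lborel) \<partial>M)"
    using nn_integral_time_section_measurable[of "\<lambda>p. ennreal ((norm (a (fst p) (snd p)))\<^sup>2)" t] a
    by (intro nn_integral_cmult) simp
  also have "(\<integral>\<^sup>+\<omega>. (\<integral>\<^sup>+s\<in>{0..t}. ennreal ((norm (a s \<omega>))\<^sup>2) \<partial>lborel) \<partial>M) =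
      (\<integral>\<^sup>+p. ennreal ((norm (a (fst p) (snd p)))\<^sup>2) \<partial>time_space t)"
    using a by (subst nn_integral_time_space) auto
  finally show ?thesis .
qed

lemma drift_L2:
  fixes a :: "real \<Rightarrow> 'a \<Rightarrow> 'b::euclidean_space"
  assumes prog: "progressive M W a" and a: "L2 (time_space T) (\<lambda>p. a (fst p) (snd p))" and T: "0 \<le> T"
  shows "0 \<le> t \<Longrightarrow> t \<le> T \<Longrightarrow> L2 M (drift a t)"
    and "L2 (time_space T) (\<lambda>p. drift a (fst p) (snd p))"
proof -
  let ?A = "\<integral>\<^sup>+p. ennreal ((norm (a (fst p) (snd p)))\<^sup>2) \<partial>time_space T"
  have A: "?A < \<infinity>" using L2_nn_integral[OF a] by simp
  have d_m: "(\<lambda>p. drift a (fst p) (snd p)) \<in> borel_measurable (time_space T)"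
    by (rule drift_measurable[OF L2_measurable[OF a]])
  have le: "(\<integral>\<^sup>+\<omega>. ennreal ((norm (drift a t \<omega>))\<^sup>2) \<partial>M) \<le> ennreal T * ?A" if t: "0 \<le> t" "t \<le> T" for t
  proof -
    note m = progressive_measurable[OF prog]
    have "(\<integral>\<^sup>+\<omega>. ennreal ((norm (drift a t \<omega>))\<^sup>2) \<partial>M) \<le>
        ennreal t * (\<integral>\<^sup>+p. ennreal ((norm (a (fst p) (snd p)))\<^sup>2) \<partial>time_space t)"
      by (rule nn_integral_drift_le[OF m[OF t(1)] t(1)])
    also have "\<dots> \<le> ennreal T * ?A"
      using t m[OF t(1)] m[OF T] by (intro mult_mono ennreal_leI nn_integral_time_space_mono) auto
    finally show ?thesis .
  qed
  show "L2 M (drift a t)" if t: "0 \<le> t" "t \<le> T"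
  proof (rule L2I_nn_integral)
    show "drift a t \<in> borel_measurable M"
      using time_space_section(2)[OF d_m t] by simp
    show "(\<integral>\<^sup>+\<omega>. ennreal ((norm (drift a t \<omega>))\<^sup>2) \<partial>M) < \<infinity>"
      using A by (intro le_less_trans[OF le[OF t]]) (simp add: ennreal_mult_less_top)
  qed
  show "L2 (time_space T) (\<lambda>p. drift a (fst p) (snd p))"
  proof (rule L2I_nn_integral[OF d_m])
    have "(\<integral>\<^sup>+p. ennreal ((norm (drift a (fst p) (snd p)))\<^sup>2) \<partial>time_space T) =
        (\<integral>\<^sup>+t\<in>{0..T}. (\<integral>\<^sup>+\<omega>. ennreal ((norm (drift a t \<omega>))\<^sup>2) \<partial>M) \<partial>lborel)"
      using d_m by (subst nn_integral_time_space_fst(1)) auto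
    also have "\<dots> \<le> (\<integral>\<^sup>+t. (ennreal T * ?A) * indicator {0..T} t \<partial>lborel)"
      using le by (intro nn_integral_mono) (auto simp: indicator_def)
    also have "\<dots> < \<infinity>"
      using A T by (simp add: nn_integral_cmult_indicator ennreal_mult_less_top)
    finally show "(\<integral>\<^sup>+p. ennreal ((norm (drift a (fst p) (snd p)))\<^sup>2) \<partial>time_space T) < \<infinity>" .
  qed
qed

text \<open>The martingale property down to time 0, tested against the constant \<open>x\<close>; by
  the isometry the integral over \<open>[0, 0]\<close> vanishes almost surely.\<close>

lemma ito_integral_mean_zero:
  fixes h :: "'b::euclidean_space \<Rightarrow> 'c::euclidean_space \<Rightarrow> real"
  assumes h: "bounded_bilinear h" and T: "0 \<le> T"
    and J: "has_ito_integral M W c T J" and K: "has_ito_integral M W c 0 K"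
  shows "expectation (\<lambda>\<omega>. h (J \<omega>) x) = 0"
proof -
  interpret bounded_bilinear h by fact
  have K_m: "K \<in> borel_measurable M" using K by (simp add: has_ito_integral_def)
  have "AE t in lborel. t \<noteq> (0::real)" by (rule AE_lborel_singleton)
  then have null: "(\<integral>\<^sup>+t\<in>{0..0}. g t \<partial>lborel) = 0" for g :: "real \<Rightarrow> ennreal"
    by (subst nn_integral_cong_AE[where v="\<lambda>_. 0"]) (auto elim: eventually_mono)
  have "(\<integral>\<^sup>+\<omega>. ennreal ((norm (K \<omega>))\<^sup>2) \<partial>M) = 0"
    unfolding ito_isometry_norm[OF K order_refl]
    using L2_measurable[OF has_ito_integral_L2(1)[OF K order_refl]]
    by (subst nn_integral_time_space) (auto simp: null)
  then have "AE \<omega> in M. K \<omega> = 0"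
    using K_m by (subst (asm) nn_integral_0_iff_AE) auto
  then have "expectation (\<lambda>\<omega>. h (K \<omega>) x) = 0"
    by (intro integral_eq_zero_AE) (auto simp: zero_left)
  moreover have "expectation (\<lambda>\<omega>. h (J \<omega>) x) = expectation (\<lambda>\<omega>. h (K \<omega>) x)"
    by (rule ito_integral_martingale[OF h order_refl T J K])
      (auto intro: L2_bounded[OF finite_measure_axioms, of _ "norm x"])
  ultimately show ?thesis by simp
qed

text \<open>Fubini moves the time integral outside. As \<open>a s\<close> is known at time
  \<open>s\<close>, the martingale property replaces \<open>J\<close> by the integral up to
  \<open>s\<close>. That integral is written as \<open>X s - (x + drift a s)\<close>: the integrals
  are chosen for each time separately, whereas this expression is jointly measurable.\<close>

lemma expectation_drift_ito:
  fixes X a c :: "real \<Rightarrow> 'a \<Rightarrow> 'b::euclidean_space" and h :: "'b \<Rightarrow> 'b \<Rightarrow> real"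
  assumes h: "bounded_bilinear h" and T: "0 \<le> T"
    and a: "progressive M W a" "L2 (time_space T) (\<lambda>p. a (fst p) (snd p))"
    and X: "L2 (time_space T) (\<lambda>p. X (fst p) (snd p))"
    and ito: "\<And>t. 0 \<le> t \<Longrightarrow>
      \<exists>J. has_ito_integral M W c t J \<and> (AE \<omega> in M. X t \<omega> = x + drift a t \<omega> + J \<omega>)"
    and J: "has_ito_integral M W c T J"
  shows "expectation (\<lambda>\<omega>. h (drift a T \<omega>) (J \<omega>)) =
    (\<integral>p. h (a (fst p) (snd p)) (X (fst p) (snd p) - (x + drift a (fst p) (snd p))) \<partial>time_space T)"
proof -
  interpret bounded_bilinear h by fact
  let ?N = "restrict_space lborel {0..T}"
  interpret NM: pair_sigma_finite ?N M by (rule pair_sigma_finite_time_space)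
  let ?a = "\<lambda>p. a (fst p) (snd p)"
  let ?R = "\<lambda>p. X (fst p) (snd p) - (x + drift a (fst p) (snd p))"
  have N: "finite_measure ?N" by (rule finite_measure_restrict_Icc)
  have JL2: "L2 M J" by (rule has_ito_integral_L2(2)[OF J T])
  have "L2 (time_space T) (\<lambda>p. J (snd p))"
    unfolding time_space_def by (rule L2_snd[OF N sigma_finite_measure_axioms JL2])
  then have int: "integrable (?N \<Otimes>\<^sub>M M) (\<lambda>p. h (?a p) (J (snd p)))"
    using L2_bilinear_integrable[OF h a(2)] unfolding time_space_def by blast
  have "L2 (time_space T) (\<lambda>_. x)"
    by (rule L2_bounded[OF finite_measure_time_space, of _ _ "norm x"]) auto
  from L2_diff[OF X L2_add[OF this drift_L2(2)[OF a T]]]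
  have int': "integrable (?N \<Otimes>\<^sub>M M) (\<lambda>p. h (?a p) (?R p))"
    using L2_bilinear_integrable[OF h a(2)] unfolding time_space_def by blast
  have "expectation (\<lambda>\<omega>. h (drift a T \<omega>) (J \<omega>)) = expectation (\<lambda>\<omega>. \<integral>s. h (a s \<omega>) (J \<omega>) \<partial>?N)"
  proof (rule integral_cong_AE)
    show "AE \<omega> in M. h (drift a T \<omega>) (J \<omega>) = (\<integral>s. h (a s \<omega>) (J \<omega>) \<partial>?N)"
      using L2_time_section[OF a(2)]
    proof (rule eventually_mono)
      fix \<omega> assume "L2 ?N (\<lambda>s. a s \<omega>)"
      then have "integrable ?N (\<lambda>s. a s \<omega>)" by (rule L2_integrable[OF N])
      from bilinear_integral_left[OF h this, of "J \<omega>"]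
      show "h (drift a T \<omega>) (J \<omega>) = (\<integral>s. h (a s \<omega>) (J \<omega>) \<partial>?N)"
        by (simp add: drift_restrict)
    qed
    show "(\<lambda>\<omega>. h (drift a T \<omega>) (J \<omega>)) \<in> borel_measurable M"
      using L2_measurable[OF drift_L2(1)[OF a T T order_refl]] L2_measurable[OF JL2]
      by (rule bilinear_borel_measurable[OF h])
    show "(\<lambda>\<omega>. \<integral>s. h (a s \<omega>) (J \<omega>) \<partial>?N) \<in> borel_measurable M"
      using NM.integrable_snd[of "\<lambda>s \<omega>. h (a s \<omega>) (J \<omega>)"] int by (simp add: split_beta')
  qed
  also have "\<dots> = (\<integral>p. h (?a p) (J (snd p)) \<partial>(?N \<Otimes>\<^sub>M M))"
    using NM.integral_snd[of "\<lambda>s \<omega>. h (a s \<omega>) (J \<omega>)"] int by (simp add: split_beta')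
  also have "\<dots> = (\<integral>s. expectation (\<lambda>\<omega>. h (a s \<omega>) (J \<omega>)) \<partial>?N)"
    using NM.integral_fst'[OF int] by simp
  also have "\<dots> = (\<integral>s. expectation (\<lambda>\<omega>. h (a s \<omega>) (X s \<omega> - (x + drift a s \<omega>))) \<partial>?N)"
  proof (rule integral_cong_AE)
    show "(\<lambda>s. expectation (\<lambda>\<omega>. h (a s \<omega>) (J \<omega>))) \<in> borel_measurable ?N"
      using NM.integrable_fst'[OF int] by simp
    show "(\<lambda>s. expectation (\<lambda>\<omega>. h (a s \<omega>) (X s \<omega> - (x + drift a s \<omega>)))) \<in> borel_measurable ?N"
      using NM.integrable_fst'[OF int'] by simp
    \<comment> \<open>The martingale property needs a square integrable test variable, and Fubini
      provides this for almost every time.\<close>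
    have "AE s in ?N. integrable M (\<lambda>\<omega>. (norm (a s \<omega>))\<^sup>2)"
      using a(2) NM.AE_integrable_fst[of "\<lambda>s \<omega>. (norm (a s \<omega>))\<^sup>2"]
      by (simp add: L2_def time_space_def split_beta')
    then show "AE s in ?N. expectation (\<lambda>\<omega>. h (a s \<omega>) (J \<omega>)) =
        expectation (\<lambda>\<omega>. h (a s \<omega>) (X s \<omega> - (x + drift a s \<omega>)))"
    proof (rule AE_mp, intro AE_I2 impI)
      fix s assume "s \<in> space ?N" and sq: "integrable M (\<lambda>\<omega>. (norm (a s \<omega>))\<^sup>2)"
      then have s: "0 \<le> s" "s \<le> T" by (auto simp: space_restrict_space)
      obtain J' where J': "has_ito_integral M W c s J'"
        and eq: "AE \<omega> in M. X s \<omega> = x + drift a s \<omega> + J' \<omega>"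
        using ito[OF s(1)] by blast
      have as: "a s \<in> borel_measurable (\<F> s)"
        by (rule progressive_measurable_filtration[OF a(1) s(1)])
      then have "L2 M (a s)" using sq by (simp add: L2_def measurable_filtration)
      with as have "expectation (\<lambda>\<omega>. h (a s \<omega>) (J \<omega>)) = expectation (\<lambda>\<omega>. h (a s \<omega>) (J' \<omega>))"
        by (rule ito_integral_martingale[OF bounded_bilinear.flip[OF h] s J J'])
      also have "\<dots> = expectation (\<lambda>\<omega>. h (a s \<omega>) (X s \<omega> - (x + drift a s \<omega>)))"
      proof (rule integral_cong_AE)
        have a_s: "a s \<in> borel_measurable M" using as by (rule measurable_filtration)
        show "(\<lambda>\<omega>. h (a s \<omega>) (J' \<omega>)) \<in> borel_measurable M"
          using J' by (intro bilinear_borel_measurable[OF h a_s]) (simp add: has_ito_integral_def)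
        have "X s \<in> borel_measurable M"
          using time_space_section(2)[OF L2_measurable[OF X] s] by simp
        then show "(\<lambda>\<omega>. h (a s \<omega>) (X s \<omega> - (x + drift a s \<omega>))) \<in> borel_measurable M"
          using L2_measurable[OF drift_L2(1)[OF a T s]]
          by (intro bilinear_borel_measurable[OF h a_s]) simp
        show "AE \<omega> in M. h (a s \<omega>) (J' \<omega>) = h (a s \<omega>) (X s \<omega> - (x + drift a s \<omega>))"
          using eq by (rule eventually_mono) simp
      qed
      finally show "expectation (\<lambda>\<omega>. h (a s \<omega>) (J \<omega>)) =
        expectation (\<lambda>\<omega>. h (a s \<omega>) (X s \<omega> - (x + drift a s \<omega>)))" .
    qed
  qed
  also have "\<dots> = (\<integral>p. h (?a p) (?R p) \<partial>time_space T)"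
    using NM.integral_fst'[OF int'] by (simp add: time_space_def)
  finally show ?thesis .
qed

text \<open>Calculus path by path: the drift has an integrable derivative along almost every path,
  so the product rule for \<open>h\<close> applies there, and the result is averaged.\<close>

lemma expectation_drift_square:
  fixes a :: "real \<Rightarrow> 'a \<Rightarrow> 'b::euclidean_space" and h :: "'b \<Rightarrow> 'b \<Rightarrow> real"
  assumes h: "bounded_bilinear h" and sym: "\<And>y z. h y z = h z y" and T: "0 \<le> T"
    and a: "progressive M W a" "L2 (time_space T) (\<lambda>p. a (fst p) (snd p))"
  shows "expectation (\<lambda>\<omega>. h (x + drift a T \<omega>) (x + drift a T \<omega>)) =
    h x x + (\<integral>p. 2 * h (a (fst p) (snd p)) (x + drift a (fst p) (snd p)) \<partial>time_space T)"
proof -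
  interpret bounded_bilinear h by fact
  let ?N = "restrict_space lborel {0..T}"
  interpret NM: pair_sigma_finite ?N M by (rule pair_sigma_finite_time_space)
  let ?a = "\<lambda>p. a (fst p) (snd p)" and ?Z = "\<lambda>p. x + drift a (fst p) (snd p)"
  have N: "finite_measure ?N" by (rule finite_measure_restrict_Icc)
  have "L2 (time_space T) (\<lambda>_. x)"
    by (rule L2_bounded[OF finite_measure_time_space, of _ _ "norm x"]) auto
  from L2_add[OF this drift_L2(2)[OF a T]]
  have Z: "L2 (time_space T) ?Z" .
  have int: "integrable (?N \<Otimes>\<^sub>M M) (\<lambda>p. 2 * h (?a p) (?Z p))"
    using L2_bilinear_integrable[OF h a(2) Z] unfolding time_space_def by simp
  have path: "h (x + drift a T \<omega>) (x + drift a T \<omega>) =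
      h x x + (\<integral>t. 2 * h (a t \<omega>) (x + drift a t \<omega>) \<partial>?N)"
    if L2: "L2 ?N (\<lambda>t. a t \<omega>)" and int: "integrable ?N (\<lambda>t. h (a t \<omega>) (x + drift a t \<omega>))" for \<omega>
  proof -
    have a_int: "integrable ?N (\<lambda>t. a t \<omega>)" by (rule L2_integrable[OF N L2])
    have d: "drift a T \<omega> = (\<integral>t. a t \<omega> \<partial>?N)"
      by (rule drift_restrict)
    have x: "integrable ?N (\<lambda>t. h (a t \<omega>) x)" "(\<integral>t. h (a t \<omega>) x \<partial>?N) = h (drift a T \<omega>) x"
      using bilinear_integral_left[OF h a_int] unfolding d
      by (auto intro: integrable_bounded_linear[OF bounded_linear_left a_int])
    have "h (drift a T \<omega>) (drift a T \<omega>) =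
        2 * (\<integral>t. h (a t \<omega>) (\<integral>s. indicator {..t} s *\<^sub>R a s \<omega> \<partial>?N) \<partial>?N)"
      unfolding d by (rule bilinear_square_integral[OF h sym L2])
    also have "(\<integral>t. h (a t \<omega>) (\<integral>s. indicator {..t} s *\<^sub>R a s \<omega> \<partial>?N) \<partial>?N) =
        (\<integral>t. h (a t \<omega>) (drift a t \<omega>) \<partial>?N)"
      by (intro Bochner_Integration.integral_cong refl)
        (auto simp: space_restrict_space drift_eq[where T=T])
    also have "\<dots> = (\<integral>t. h (a t \<omega>) (x + drift a t \<omega>) - h (a t \<omega>) x \<partial>?N)"
      by (simp add: add_right)
    also have "\<dots> = (\<integral>t. h (a t \<omega>) (x + drift a t \<omega>) \<partial>?N) - h (drift a T \<omega>) x"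
      using int x by simp
    finally have "h (drift a T \<omega>) (drift a T \<omega>) =
        2 * ((\<integral>t. h (a t \<omega>) (x + drift a t \<omega>) \<partial>?N) - h (drift a T \<omega>) x)" .
    moreover have "h (x + drift a T \<omega>) (x + drift a T \<omega>) =
        h x x + 2 * h (drift a T \<omega>) x + h (drift a T \<omega>) (drift a T \<omega>)"
      using sym[of x "drift a T \<omega>"] by (simp add: add_left add_right)
    ultimately show ?thesis by (simp add: right_diff_distrib)
  qed
  have "AE \<omega> in M. integrable ?N (\<lambda>t. 2 * h (a t \<omega>) (x + drift a t \<omega>))"
    using NM.AE_integrable_snd[of "\<lambda>t \<omega>. 2 * h (a t \<omega>) (x + drift a t \<omega>)"] int
    by (simp add: split_beta')
  with L2_time_section[OF a(2)]
  have "AE \<omega> in M. h (x + drift a T \<omega>) (x + drift a T \<omega>) =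
      h x x + (\<integral>t. 2 * h (a t \<omega>) (x + drift a t \<omega>) \<partial>?N)"
    by eventually_elim (rule path, simp_all)
  moreover have snd: "integrable M (\<lambda>\<omega>. \<integral>t. 2 * h (a t \<omega>) (x + drift a t \<omega>) \<partial>?N)"
    using NM.integrable_snd[of "\<lambda>t \<omega>. 2 * h (a t \<omega>) (x + drift a t \<omega>)"] int
    by (simp add: split_beta')
  moreover have "(\<lambda>\<omega>. h (x + drift a T \<omega>) (x + drift a T \<omega>)) \<in> borel_measurable M"
    using L2_measurable[OF drift_L2(1)[OF a T T order_refl]]
    by (intro bilinear_borel_measurable[OF h]) simp_all
  ultimately have "expectation (\<lambda>\<omega>. h (x + drift a T \<omega>) (x + drift a T \<omega>)) =
      expectation (\<lambda>\<omega>. h x x + (\<integral>t. 2 * h (a t \<omega>) (x + drift a t \<omega>) \<partial>?N))"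
    by (intro integral_cong_AE) auto
  also have "\<dots> = h x x + expectation (\<lambda>\<omega>. \<integral>t. 2 * h (a t \<omega>) (x + drift a t \<omega>) \<partial>?N)"
    using snd by (simp add: prob_space)
  also have "expectation (\<lambda>\<omega>. \<integral>t. 2 * h (a t \<omega>) (x + drift a t \<omega>) \<partial>?N) =
      (\<integral>p. 2 * h (?a p) (?Z p) \<partial>time_space T)"
    using NM.integral_snd[of "\<lambda>t \<omega>. 2 * h (a t \<omega>) (x + drift a t \<omega>)"] int
    by (simp add: split_beta' time_space_def)
  finally show ?thesis .
qed

text \<open>The expectation of Ito's formula for a quadratic form. Writing \<open>X = Z + J\<close> with \<open>Z\<close> of bounded
  variation and \<open>J\<close> the stochastic integral, the three parts of the square are evaluated by calculus,
  by the martingale property and by the Ito isometry.\<close>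

lemma ito_energy:
  fixes X a c :: "real \<Rightarrow> 'a \<Rightarrow> 'b::euclidean_space" and h :: "'b \<Rightarrow> 'b \<Rightarrow> real"
  assumes h: "bounded_bilinear h" and sym: "\<And>y z. h y z = h z y" and T: "0 \<le> T"
    and a: "progressive M W a" "L2 (time_space T) (\<lambda>p. a (fst p) (snd p))"
    and X: "L2 (time_space T) (\<lambda>p. X (fst p) (snd p))"
    and ito: "\<And>t. 0 \<le> t \<Longrightarrow>
      \<exists>J. has_ito_integral M W c t J \<and> (AE \<omega> in M. X t \<omega> = x + drift a t \<omega> + J \<omega>)"
  shows "L2 M (X T)"
    and "integrable (time_space T) (\<lambda>p. 2 * h (a (fst p) (snd p)) (X (fst p) (snd p)) +
        h (c (fst p) (snd p)) (c (fst p) (snd p)))"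
    and "expectation (\<lambda>\<omega>. h (X T \<omega>) (X T \<omega>)) =
      h x x + (\<integral>p. 2 * h (a (fst p) (snd p)) (X (fst p) (snd p)) +
        h (c (fst p) (snd p)) (c (fst p) (snd p)) \<partial>time_space T)"
proof -
  interpret bounded_bilinear h by fact
  let ?a = "\<lambda>p. a (fst p) (snd p)" and ?X = "\<lambda>p. X (fst p) (snd p)"
  let ?c = "\<lambda>p. c (fst p) (snd p)" and ?Z = "\<lambda>p. x + drift a (fst p) (snd p)"
  obtain J where J: "has_ito_integral M W c T J" and eq: "AE \<omega> in M. X T \<omega> = x + drift a T \<omega> + J \<omega>"
    using ito[OF T] by blast
  obtain K where K: "has_ito_integral M W c 0 K" using ito[OF order_refl] by blast
  have xM: "L2 M (\<lambda>_. x)" by (rule L2_bounded[OF finite_measure_axioms, of _ "norm x"]) auto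
  have dM: "L2 M (drift a T)" by (rule drift_L2(1)[OF a T T order_refl])
  have ZM: "L2 M (\<lambda>\<omega>. x + drift a T \<omega>)" by (rule L2_add[OF xM dM])
  have JM: "L2 M J" by (rule has_ito_integral_L2(2)[OF J T])
  have cQ: "L2 (time_space T) ?c" by (rule has_ito_integral_L2(1)[OF J T])
  have X_m: "X T \<in> borel_measurable M"
    using time_space_section(2)[OF L2_measurable[OF X] T order_refl] by simp
  show XM: "L2 M (X T)"
    by (rule L2_cong_AE[OF L2_add[OF ZM JM] X_m eq])
  have "L2 (time_space T) (\<lambda>_. x)"
    by (rule L2_bounded[OF finite_measure_time_space, of _ _ "norm x"]) auto
  from L2_add[OF this drift_L2(2)[OF a T]] have ZQ: "L2 (time_space T) ?Z" .
  note int = L2_bilinear_integrable[OF h]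
  show "integrable (time_space T) (\<lambda>p. 2 * h (?a p) (?X p) + h (?c p) (?c p))"
    using int[OF a(2) X] int[OF cQ cQ] by simp
  have "expectation (\<lambda>\<omega>. h (X T \<omega>) (X T \<omega>)) =
      expectation (\<lambda>\<omega>. h (x + drift a T \<omega>) (x + drift a T \<omega>) +
        (2 * h (J \<omega>) x + 2 * h (drift a T \<omega>) (J \<omega>) + h (J \<omega>) (J \<omega>)))"
  proof (rule integral_cong_AE)
    show "AE \<omega> in M. h (X T \<omega>) (X T \<omega>) = h (x + drift a T \<omega>) (x + drift a T \<omega>) +
        (2 * h (J \<omega>) x + 2 * h (drift a T \<omega>) (J \<omega>) + h (J \<omega>) (J \<omega>))"
      using eq
    proof (rule eventually_mono)
      fix \<omega> assume X: "X T \<omega> = x + drift a T \<omega> + J \<omega>"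
      show "h (X T \<omega>) (X T \<omega>) = h (x + drift a T \<omega>) (x + drift a T \<omega>) +
        (2 * h (J \<omega>) x + 2 * h (drift a T \<omega>) (J \<omega>) + h (J \<omega>) (J \<omega>))"
        unfolding X using sym[of x "J \<omega>"] sym[of "J \<omega>" "drift a T \<omega>"]
        by (simp add: add_left add_right)
    qed
  qed (use int[OF XM XM] int[OF ZM ZM] int[OF JM xM] int[OF dM JM] int[OF JM JM] in auto)
  also have "\<dots> = expectation (\<lambda>\<omega>. h (x + drift a T \<omega>) (x + drift a T \<omega>)) +
      (2 * expectation (\<lambda>\<omega>. h (J \<omega>) x) + 2 * expectation (\<lambda>\<omega>. h (drift a T \<omega>) (J \<omega>)) +
       expectation (\<lambda>\<omega>. h (J \<omega>) (J \<omega>)))"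
    using int[OF ZM ZM] int[OF JM xM] int[OF dM JM] int[OF JM JM] by simp
  also have "\<dots> = h x x + ((\<integral>p. 2 * h (?a p) (?Z p) \<partial>time_space T) +
      2 * (\<integral>p. h (?a p) (?X p - ?Z p) \<partial>time_space T) + (\<integral>p. h (?c p) (?c p) \<partial>time_space T))"
    using expectation_drift_square[OF h sym T a] ito_integral_mean_zero[OF h T J K]
      expectation_drift_ito[OF h T a X ito J] ito_isometry[OF h T J J]
    by simp
  \<comment> \<open>The cross term was left in terms of \<open>X - Z\<close>; added to the part from
    calculus it makes \<open>Z\<close> disappear.\<close>
  also have "(\<integral>p. 2 * h (?a p) (?Z p) \<partial>time_space T) +
      2 * (\<integral>p. h (?a p) (?X p - ?Z p) \<partial>time_space T) + (\<integral>p. h (?c p) (?c p) \<partial>time_space T) =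
      (\<integral>p. 2 * h (?a p) (?X p) + h (?c p) (?c p) \<partial>time_space T)"
    unfolding diff_right using int[OF a(2) X] int[OF a(2) ZQ] int[OF cQ cQ] by simp
  finally show "expectation (\<lambda>\<omega>. h (X T \<omega>) (X T \<omega>)) =
      h x x + (\<integral>p. 2 * h (?a p) (?X p) + h (?c p) (?c p) \<partial>time_space T)" .
qed

text \<open>Gronwall for the mean square of \<open>X - Y\<close>, finite by the a priori estimate.
  The inputs \<open>\<beta>\<close> and \<open>\<gamma>\<close> cancel. The conclusion is uniqueness
  in mean square on each \<open>[0, T]\<close>, the form in which square integrability passes from
  one solution to another.\<close>

lemma sde_solution_unique:
  fixes X Y :: "real \<Rightarrow> 'a \<Rightarrow> real^'n"
  assumes X: "sde_solution M W A C \<beta> \<gamma> x X" and Y: "sde_solution M W A C \<beta> \<gamma> x Y"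
    and \<beta>: "progressive M W \<beta>" "\<And>T. 0 \<le> T \<Longrightarrow> L2 (time_space T) (\<lambda>p. \<beta> (fst p) (snd p))"
    and T: "0 \<le> T"
  shows "(\<integral>\<^sup>+p. ennreal ((norm (X (fst p) (snd p) - Y (fst p) (snd p)))\<^sup>2) \<partial>time_space T) = 0"
proof -
  obtain k where k: "k > 0" "\<And>y. (norm (A *v y))\<^sup>2 \<le> k * (norm y)\<^sup>2"
    by (rule matrix_vector_mult_bound[of A]) (rule that)
  obtain l where l: "l > 0" "\<And>y. (norm (C *v y))\<^sup>2 \<le> l * (norm y)\<^sup>2"
    by (rule matrix_vector_mult_bound[of C]) (rule that)
  define a where "a s \<omega> = A *v X s \<omega> + \<beta> s \<omega>" for s \<omega>
  define a' where "a' s \<omega> = A *v Y s \<omega> + \<beta> s \<omega>" for s \<omega>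
  let ?d = "\<lambda>s \<omega>. A *v (X s \<omega> - Y s \<omega>)"
  let ?q = "\<lambda>p. ennreal ((norm (X (fst p) (snd p) - Y (fst p) (snd p)))\<^sup>2)"
  have X2: "L2 (time_space t) (\<lambda>p. X (fst p) (snd p))"
    and Y2: "L2 (time_space t) (\<lambda>p. Y (fst p) (snd p))" if "0 \<le> t" for t
    using sde_solution_L2[OF X that \<beta>(2)[OF that]] sde_solution_L2[OF Y that \<beta>(2)[OF that]] by auto
  have q_m: "?q \<in> borel_measurable (time_space t)" if "0 \<le> t" for t
    using L2_measurable[OF L2_diff[OF X2[OF that] Y2[OF that]]] by simp
  define f where "f t = (\<integral>\<^sup>+\<omega>. ennreal ((norm (X t \<omega> - Y t \<omega>))\<^sup>2) \<partial>M) * indicator {0..T} t" for t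
  have f_m: "f \<in> borel_measurable borel"
    using nn_integral_time_space_fst(2)[OF q_m[OF T]] by (simp add: f_def[abs_def])
  have q_f: "(\<integral>\<^sup>+p. ?q p \<partial>time_space t) = (\<integral>\<^sup>+s\<in>{0..t}. f s \<partial>lborel)" if "0 \<le> t" "t \<le> T" for t
    using that unfolding nn_integral_time_space_fst(1)[OF q_m[OF that(1)]] f_def
    by (intro nn_integral_cong) (auto simp: indicator_def)
  have fin: "(\<integral>\<^sup>+s\<in>{0..T}. f s \<partial>lborel) < \<infinity>"
    unfolding q_f[OF T order_refl, symmetric] L2_nn_integral[OF L2_diff[OF X2[OF T] Y2[OF T]]] by simp
  \<comment> \<open>The first summand comes from the drift, through Cauchy-Schwarz in time and the
    bound \<open>k\<close> for \<open>A\<close>; the second from the isometry and the bound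
    \<open>l\<close> for \<open>C\<close>. The factors 2 come from squaring a sum.\<close>
  define K where "K = 2 * (T * k) + 2 * l"
  have K: "K > 0" using T k(1) l(1) by (simp add: K_def add_nonneg_pos)
  have step: "f t \<le> 0 + ennreal K * (\<integral>\<^sup>+s\<in>{0..t}. f s \<partial>lborel)" if t: "0 \<le> t" "t \<le> T" for t
  proof -
    note X2 = X2[OF t(1)] and Y2 = Y2[OF t(1)] and \<beta>2 = \<beta>(2)[OF t(1)]
    obtain J where J: "has_ito_integral M W (\<lambda>s \<omega>. C *v X s \<omega> + \<gamma> s \<omega>) t J"
      and eqX: "AE \<omega> in M. X t \<omega> = x + drift a t \<omega> + J \<omega>"
      using sde_solutionD(3)[OF X t(1)] unfolding a_def by blast
    obtain J' where J': "has_ito_integral M W (\<lambda>s \<omega>. C *v Y s \<omega> + \<gamma> s \<omega>) t J'"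
      and eqY: "AE \<omega> in M. Y t \<omega> = x + drift a' t \<omega> + J' \<omega>"
      using sde_solutionD(3)[OF Y t(1)] unfolding a'_def by blast
    have A: "bounded_linear ((*v) A)" by (rule matrix_vector_mul_bounded_linear)
    have "AE \<omega> in M. L2 (restrict_space lborel {0..t}) (\<lambda>s. a s \<omega>)"
      unfolding a_def by (rule L2_time_section[OF L2_add[OF L2_linear[OF X2 A] \<beta>2]])
    moreover have "AE \<omega> in M. L2 (restrict_space lborel {0..t}) (\<lambda>s. a' s \<omega>)"
      unfolding a'_def by (rule L2_time_section[OF L2_add[OF L2_linear[OF Y2 A] \<beta>2]])
    \<comment> \<open>Subtracting the two drifts needs each to be a genuine integral rather than the
      default value 0, which holds on almost every path.\<close>
    ultimately have "AE \<omega> in M. X t \<omega> - Y t \<omega> = drift ?d t \<omega> + (J \<omega> - J' \<omega>)"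
      using eqX eqY
    proof eventually_elim
      case (elim \<omega>)
      note int = elim(1,2)[THEN L2_integrable[OF finite_measure_restrict_Icc]]
      have "drift a t \<omega> - drift a' t \<omega> = drift ?d t \<omega>"
        unfolding drift_restrict using int
        by (subst Bochner_Integration.integral_diff[symmetric])
          (simp_all add: a_def a'_def matrix_vector_mult_diff_distrib)
      then show ?case using elim(3,4) by (simp add: algebra_simps)
    qed
    then have "(\<integral>\<^sup>+\<omega>. ennreal ((norm (X t \<omega> - Y t \<omega>))\<^sup>2) \<partial>M) =
        (\<integral>\<^sup>+\<omega>. ennreal ((norm (drift ?d t \<omega> + (J \<omega> - J' \<omega>)))\<^sup>2) \<partial>M)"
      by (intro nn_integral_cong_AE) (auto elim: eventually_mono)
    also have "\<dots> \<le> 2 * (\<integral>\<^sup>+\<omega>. ennreal ((norm (drift ?d t \<omega>))\<^sup>2) \<partial>M) +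
        2 * (\<integral>\<^sup>+\<omega>. ennreal ((norm (J \<omega> - J' \<omega>))\<^sup>2) \<partial>M)"
    proof (rule nn_integral_norm_add_le)
      have "(\<lambda>p. drift ?d (fst p) (snd p)) \<in> borel_measurable (time_space t)"
        by (intro drift_measurable L2_measurable[OF L2_linear[OF L2_diff[OF X2 Y2] A]])
      from time_space_section(2)[OF this t(1) order_refl]
      show "drift ?d t \<in> borel_measurable M" by simp
    qed (use J J' in \<open>auto simp: has_ito_integral_def\<close>)
    also have "\<dots> \<le> 2 * (ennreal T * (ennreal k * (\<integral>\<^sup>+p. ?q p \<partial>time_space t))) +
        2 * (ennreal l * (\<integral>\<^sup>+p. ?q p \<partial>time_space t))"
    proof (intro add_mono mult_left_mono)
      have "(\<integral>\<^sup>+\<omega>. ennreal ((norm (drift ?d t \<omega>))\<^sup>2) \<partial>M) \<le>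
          ennreal t * (\<integral>\<^sup>+p. ennreal ((norm (?d (fst p) (snd p)))\<^sup>2) \<partial>time_space t)"
        by (intro nn_integral_drift_le L2_measurable[OF L2_linear[OF L2_diff[OF X2 Y2] A]] t(1))
      also have "\<dots> \<le> ennreal T * (\<integral>\<^sup>+p. ennreal k * ?q p \<partial>time_space t)"
        using t k by (intro mult_mono nn_integral_mono ennreal_leI)
          (auto simp flip: ennreal_mult intro!: ennreal_leI)
      also have "(\<integral>\<^sup>+p. ennreal k * ?q p \<partial>time_space t) = ennreal k * (\<integral>\<^sup>+p. ?q p \<partial>time_space t)"
        by (rule nn_integral_cmult[OF q_m[OF t(1)]])
      finally show "(\<integral>\<^sup>+\<omega>. ennreal ((norm (drift ?d t \<omega>))\<^sup>2) \<partial>M) \<le>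
        ennreal T * (ennreal k * (\<integral>\<^sup>+p. ?q p \<partial>time_space t))" .
      have "(\<integral>\<^sup>+\<omega>. ennreal ((norm (J \<omega> - J' \<omega>))\<^sup>2) \<partial>M) =
          (\<integral>\<^sup>+p. ennreal ((norm (C *v (X (fst p) (snd p) - Y (fst p) (snd p))))\<^sup>2) \<partial>time_space t)"
        unfolding ito_isometry_diff[OF J J' t(1)] by (simp add: matrix_vector_mult_diff_distrib)
      also have "\<dots> \<le> (\<integral>\<^sup>+p. ennreal l * ?q p \<partial>time_space t)"
        using l by (intro nn_integral_mono) (auto simp flip: ennreal_mult intro!: ennreal_leI)
      also have "\<dots> = ennreal l * (\<integral>\<^sup>+p. ?q p \<partial>time_space t)"
        by (rule nn_integral_cmult[OF q_m[OF t(1)]])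
      finally show "(\<integral>\<^sup>+\<omega>. ennreal ((norm (J \<omega> - J' \<omega>))\<^sup>2) \<partial>M) \<le>
        ennreal l * (\<integral>\<^sup>+p. ?q p \<partial>time_space t)" .
    qed simp_all
    also have "\<dots> = ennreal K * (\<integral>\<^sup>+p. ?q p \<partial>time_space t)"
      using T k(1) l(1) by (simp add: K_def ennreal_mult distrib_right mult.assoc)
    finally show ?thesis
      using t by (simp add: f_def q_f)
  qed
  have "(\<integral>\<^sup>+s\<in>{0..T}. f s \<partial>lborel) \<le> ennreal (2 * exp (2 * K * T)) * (\<integral>\<^sup>+s\<in>{0..T}. 0 \<partial>lborel)"
    by (rule gronwall_nn_integral[OF f_m _ K step fin]) simp_all
  then show ?thesis using q_f[OF T order_refl] by simp
qed

lemma sde_energy: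
  fixes X :: "real \<Rightarrow> 'a \<Rightarrow> real^'n" and P :: "real^'n^'n"
  assumes sde: "sde_solution M W A C \<beta> \<gamma> x X" and T: "0 \<le> T"
    and \<beta>: "progressive M W \<beta>" "L2 (time_space T) (\<lambda>p. \<beta> (fst p) (snd p))"
    and sym: "transpose P = P"
  defines "a \<equiv> \<lambda>p. A *v X (fst p) (snd p) + \<beta> (fst p) (snd p)"
    and "c \<equiv> \<lambda>p. C *v X (fst p) (snd p) + \<gamma> (fst p) (snd p)"
  shows "L2 M (X T)"
    and "integrable (time_space T) (\<lambda>p. 2 * (a p \<bullet> (P *v X (fst p) (snd p))) + c p \<bullet> (P *v c p))"
    and "expectation (\<lambda>\<omega>. X T \<omega> \<bullet> (P *v X T \<omega>)) =
      x \<bullet> (P *v x) + (\<integral>p. 2 * (a p \<bullet> (P *v X (fst p) (snd p))) + c p \<bullet> (P *v c p) \<partial>time_space T)"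
proof -
  have h: "bounded_bilinear (\<lambda>y z. y \<bullet> (P *v z))"
    by (rule bounded_bilinear.comp[OF bounded_bilinear_inner bounded_linear_ident
          matrix_vector_mul_bounded_linear])
  have h_sym: "y \<bullet> (P *v z) = z \<bullet> (P *v y)" for y z
    by (metis dot_lmul_matrix inner_commute sym transpose_matrix_vector)
  have X2: "L2 (time_space T) (\<lambda>p. X (fst p) (snd p))"
    by (rule sde_solution_L2[OF sde T \<beta>(2)])
  have a_prog: "progressive M W (\<lambda>s \<omega>. A *v X s \<omega> + \<beta> s \<omega>)"
    using sde_solutionD(1)[OF sde] \<beta>(1) unfolding progressive_def split_beta
    by (auto intro!: borel_measurable_add matrix_vector_mult_measurable)
  have a2: "L2 (time_space T) (\<lambda>p. A *v X (fst p) (snd p) + \<beta> (fst p) (snd p))"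
    by (intro L2_add L2_linear[OF X2] \<beta>(2) matrix_vector_mul_bounded_linear)
  note energy = ito_energy[OF h h_sym T a_prog a2 X2 sde_solutionD(3)[OF sde]]
  show "L2 M (X T)" by (rule energy(1))
  show "integrable (time_space T) (\<lambda>p. 2 * (a p \<bullet> (P *v X (fst p) (snd p))) + c p \<bullet> (P *v c p))"
    unfolding a_def c_def by (rule energy(2))
  show "expectation (\<lambda>\<omega>. X T \<omega> \<bullet> (P *v X T \<omega>)) =
      x \<bullet> (P *v x) + (\<integral>p. 2 * (a p \<bullet> (P *v X (fst p) (snd p))) + c p \<bullet> (P *v c p) \<partial>time_space T)"
    unfolding a_def c_def by (rule energy(3))
qed

end

subsection \<open>The Lyapunov equation\<close>

lemma transpose_add: "transpose (A + B) = transpose A + transpose (B :: 'a::plus^'n^'m)"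
  by (simp add: transpose_def vec_eq_iff)

lemma transpose_diff: "transpose (A - B) = transpose A - transpose (B :: 'a::minus^'n^'m)"
  by (simp add: transpose_def vec_eq_iff)

lemma inner_matrix_symmetric:
  fixes P :: "real^'n^'n"
  assumes "transpose P = P"
  shows "y \<bullet> (P *v z) = z \<bullet> (P *v y)"
  by (metis assms dot_lmul_matrix inner_commute transpose_matrix_vector)

text \<open>The generator of the homogeneous equation acting on the quadratic form of
  \<open>P\<close>, written as a matrix.\<close>

definition lyapunov_op :: "real^'n^'n \<Rightarrow> real^'n^'n \<Rightarrow> real^'n^'n \<Rightarrow> real^'n^'n" where
  "lyapunov_op A C P = transpose A ** P + P ** A + transpose C ** P ** C"

lemma matrix_mult_scaleR:
  fixes A :: "real^'n^'m" and B :: "real^'k^'n"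
  shows "A ** (r *\<^sub>R B) = r *\<^sub>R (A ** B)" "(r *\<^sub>R A) ** B = r *\<^sub>R (A ** B)"
  by (simp_all add: matrix_matrix_mult_def vec_eq_iff sum_distrib_left mult_ac)

lemma matrix_mult_add_left: "(A + B) ** C = A ** C + B ** (C :: 'a::semiring_1^'k^'n)"
  by (simp add: matrix_matrix_mult_def vec_eq_iff distrib_right sum.distrib)

lemma uminus_matrix_vector_mult: "(- A) *v y = - (A *v (y :: 'a::ring_1^'n))"
  by (simp add: matrix_vector_mult_def vec_eq_iff sum_negf)

lemma linear_lyapunov_op: "linear (lyapunov_op A C)"
proof (rule linearI)
  show "lyapunov_op A C (P + Q) = lyapunov_op A C P + lyapunov_op A C Q" for P Q
    by (simp add: lyapunov_op_def matrix_add_ldistrib matrix_mult_add_left)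
  show "lyapunov_op A C (r *\<^sub>R P) = r *\<^sub>R lyapunov_op A C P" for r P
    by (simp add: lyapunov_op_def matrix_mult_scaleR scaleR_add_right)
qed

lemma transpose_lyapunov_op:
  "transpose (lyapunov_op A C P) = lyapunov_op A C (transpose P)"
  by (simp add: lyapunov_op_def transpose_add matrix_transpose_mul matrix_mul_assoc add_ac)

text \<open>The right-hand side is the integrand of \<open>sde_energy\<close> at \<open>y\<close>
  for the equation without inputs.\<close>

lemma lyapunov_op_quadratic:
  fixes P :: "real^'n^'n"
  assumes "transpose P = P"
  shows "y \<bullet> (lyapunov_op A C P *v y) = 2 * ((A *v y) \<bullet> (P *v y)) + (C *v y) \<bullet> (P *v (C *v y))"
proof -
  have T: "y \<bullet> (transpose F *v z) = (F *v y) \<bullet> z" for F :: "real^'n^'n" and z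
    by (metis dot_lmul_matrix inner_commute transpose_matrix_vector)
  have "y \<bullet> (lyapunov_op A C P *v y) = y \<bullet> (transpose A *v (P *v y)) + y \<bullet> (P *v (A *v y)) +
      y \<bullet> (transpose C *v (P *v (C *v y)))"
    by (simp only: lyapunov_op_def matrix_vector_mult_add_rdistrib inner_add_right
        matrix_vector_mul_assoc[symmetric])
  then show ?thesis
    unfolding T using inner_matrix_symmetric[OF assms, of y "A *v y"] by (simp add: inner_commute)
qed

text \<open>The left-hand side collects the terms that the inputs add to the energy integrand. The
  coefficient 1/2 is chosen so that, against \<open>- (norm y)\<^sup>2\<close> from
  \<open>L(P) = - I\<close>, half of the decay survives.\<close>

lemma quadratic_perturbation_bound:
  fixes P C :: "real^'n^'n"
  obtains K where "K > 0"
    "\<And>y \<beta> \<gamma>. 2 * (\<beta> \<bullet> (P *v y)) + 2 * ((C *v y) \<bullet> (P *v \<gamma>)) + \<gamma> \<bullet> (P *v \<gamma>) \<le>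
      (norm y)\<^sup>2 / 2 + K * ((norm \<beta>)\<^sup>2 + (norm \<gamma>)\<^sup>2)"
proof -
  obtain k where k: "k > 0" "\<And>y. norm (P *v y) \<le> norm y * k"
    using bounded_linear.pos_bounded[OF matrix_vector_mul_bounded_linear[of P]] by blast
  obtain l where l: "l > 0" "\<And>y. norm (C *v y) \<le> norm y * l"
    using bounded_linear.pos_bounded[OF matrix_vector_mul_bounded_linear[of C]] by blast
  \<comment> \<open>Young's inequality with weight \<open>1 / (8 * r)\<close>: each of the two cross
    terms may use up one quarter of the square of \<open>norm y\<close>.\<close>
  have weighted: "2 * r * (a * b) \<le> b\<^sup>2 / 4 + 16 * r\<^sup>2 * a\<^sup>2" if "r > 0" "0 \<le> a" "0 \<le> b" for r a b :: real
  proof -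
    have "a * b \<le> a\<^sup>2 / (1 / (8 * r)) + 1 / (8 * r) * b\<^sup>2"
      using that by (intro mult_le_weighted_squares) auto
    then have "2 * r * (a * b) \<le> 2 * r * (a\<^sup>2 / (1 / (8 * r)) + 1 / (8 * r) * b\<^sup>2)"
      using that by (intro mult_left_mono) auto
    also have "\<dots> = b\<^sup>2 / 4 + 16 * r\<^sup>2 * a\<^sup>2"
      using that by (simp add: field_simps power2_eq_square)
    finally show ?thesis .
  qed
  \<comment> \<open>The first two summands are the costs of the cross terms, with
    \<open>r = k\<close> and \<open>r = l * k\<close>; the last one bounds the form of
    \<open>P\<close> at \<open>\<gamma>\<close>.\<close>
  define K where "K = 16 * k\<^sup>2 + 16 * (l * k)\<^sup>2 + k"
  show thesis
  proof (rule that[of K])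
    show "K > 0" using k l by (simp add: K_def add_nonneg_pos)
    fix y \<beta> \<gamma> :: "real^'n"
    have "2 * (\<beta> \<bullet> (P *v y)) \<le> 2 * (norm \<beta> * (norm y * k))"
      using norm_cauchy_schwarz[of \<beta> "P *v y"] mult_left_mono[OF k(2)[of y], of "norm \<beta>"] by simp
    also have "\<dots> = 2 * k * (norm \<beta> * norm y)" by simp
    also have "\<dots> \<le> (norm y)\<^sup>2 / 4 + 16 * k\<^sup>2 * (norm \<beta>)\<^sup>2"
      using k(1) by (intro weighted) auto
    finally have 1: "2 * (\<beta> \<bullet> (P *v y)) \<le> (norm y)\<^sup>2 / 4 + 16 * k\<^sup>2 * (norm \<beta>)\<^sup>2" .
    have "2 * ((C *v y) \<bullet> (P *v \<gamma>)) \<le> 2 * ((norm y * l) * (norm \<gamma> * k))"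
      using norm_cauchy_schwarz[of "C *v y" "P *v \<gamma>"]
        mult_mono[OF l(2)[of y] k(2)[of \<gamma>]] l(1) by simp
    also have "\<dots> = 2 * (l * k) * (norm \<gamma> * norm y)" by simp
    also have "\<dots> \<le> (norm y)\<^sup>2 / 4 + 16 * (l * k)\<^sup>2 * (norm \<gamma>)\<^sup>2"
      using k(1) l(1) by (intro weighted) auto
    finally have 2: "2 * ((C *v y) \<bullet> (P *v \<gamma>)) \<le> (norm y)\<^sup>2 / 4 + 16 * (l * k)\<^sup>2 * (norm \<gamma>)\<^sup>2" .
    have 3: "\<gamma> \<bullet> (P *v \<gamma>) \<le> k * (norm \<gamma>)\<^sup>2"
      using norm_cauchy_schwarz[of \<gamma> "P *v \<gamma>"] mult_left_mono[OF k(2)[of \<gamma>], of "norm \<gamma>"]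
      by (simp add: power2_eq_square mult_ac)
    have "0 \<le> (16 * (l * k)\<^sup>2 + k) * (norm \<beta>)\<^sup>2" "0 \<le> 16 * k\<^sup>2 * (norm \<gamma>)\<^sup>2"
      using k(1) by simp_all
    then show "2 * (\<beta> \<bullet> (P *v y)) + 2 * ((C *v y) \<bullet> (P *v \<gamma>)) + \<gamma> \<bullet> (P *v \<gamma>) \<le>
      (norm y)\<^sup>2 / 2 + K * ((norm \<beta>)\<^sup>2 + (norm \<gamma>)\<^sup>2)"
      using 1 2 3 unfolding K_def distrib_left distrib_right by linarith
  qed
qed

context brownian
begin

text \<open>If the form were \<open>- \<delta> < 0\<close> at \<open>x\<close>, the energy identity
  would keep its expectation along the solution at or below \<open>- \<delta>\<close>. With
  \<open>k\<close> a bound for \<open>P\<close>, the second moment would then be at least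
  \<open>\<delta> / k\<close> at every time, and its integral over the half-line infinite.\<close>

lemma L2_stable_quadratic_nonneg:
  fixes A C P :: "real^'n^'n"
  assumes stable: "L2_stable M W A C" and sym: "transpose P = P"
    and neg: "\<And>y. y \<bullet> (lyapunov_op A C P *v y) \<le> 0"
  shows "0 \<le> x \<bullet> (P *v x)"
proof (rule ccontr)
  assume "\<not> 0 \<le> x \<bullet> (P *v x)"
  define \<delta> where "\<delta> = - (x \<bullet> (P *v x))"
  have \<delta>: "\<delta> > 0" using \<open>\<not> 0 \<le> _\<close> by (simp add: \<delta>_def)
  obtain X where X: "sde_solution M W A C (\<lambda>_ _. 0) (\<lambda>_ _. 0) x X" and "X \<in> X_space M W"
    using stable unfolding L2_stable_def by blast
  then have sq: "sq_integrable M X" by (simp add: X_space_def)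
  have prog: "progressive M W X" by (rule sde_solutionD(1)[OF X])
  have prog0: "progressive M W (\<lambda>_ _. 0 :: real^'n)" by (simp add: progressive_def split_beta)
  have L20: "L2 N (\<lambda>_. 0 :: real^'n)" for N :: "(real \<times> 'a) measure" by (simp add: L2_def)
  obtain k where k: "k > 0" "\<And>y. norm (P *v y) \<le> norm y * k"
    using bounded_linear.pos_bounded[OF matrix_vector_mul_bounded_linear[of P]] by blast
  have lower: "ennreal \<delta> \<le> ennreal k * (\<integral>\<^sup>+\<omega>. ennreal ((norm (X t \<omega>))\<^sup>2) \<partial>M)" if t: "0 \<le> t" for t
  proof -
    note energy = sde_energy[OF X t prog0 L20 sym]
    have "expectation (\<lambda>\<omega>. X t \<omega> \<bullet> (P *v X t \<omega>)) = x \<bullet> (P *v x) +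
        (\<integral>p. X (fst p) (snd p) \<bullet> (lyapunov_op A C P *v X (fst p) (snd p)) \<partial>time_space t)"
      using energy(3) by (simp add: lyapunov_op_quadratic[OF sym])
    also have "\<dots> \<le> - \<delta>"
    proof -
      have "0 \<le> (\<integral>p. - (X (fst p) (snd p) \<bullet> (lyapunov_op A C P *v X (fst p) (snd p))) \<partial>time_space t)"
        using neg by (intro Bochner_Integration.integral_nonneg) simp
      then show ?thesis by (simp add: \<delta>_def)
    qed
    finally have "\<delta> \<le> - expectation (\<lambda>\<omega>. X t \<omega> \<bullet> (P *v X t \<omega>))" by simp
    also have "\<dots> = expectation (\<lambda>\<omega>. - (X t \<omega> \<bullet> (P *v X t \<omega>)))" by simp
    also have "\<dots> \<le> expectation (\<lambda>\<omega>. k * (norm (X t \<omega>))\<^sup>2)"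
    proof (rule integral_mono)
      have h: "bounded_bilinear (\<lambda>y z. y \<bullet> (P *v z))"
        by (rule bounded_bilinear.comp[OF bounded_bilinear_inner bounded_linear_ident
              matrix_vector_mul_bounded_linear])
      show "integrable M (\<lambda>\<omega>. - (X t \<omega> \<bullet> (P *v X t \<omega>)))"
        using L2_bilinear_integrable[OF h energy(1) energy(1)] by simp
      show "integrable M (\<lambda>\<omega>. k * (norm (X t \<omega>))\<^sup>2)"
        using energy(1) by (simp add: L2_def)
      fix \<omega>
      have "- (X t \<omega> \<bullet> (P *v X t \<omega>)) \<le> norm (X t \<omega>) * norm (P *v X t \<omega>)"
        using Cauchy_Schwarz_ineq2[of "X t \<omega>" "P *v X t \<omega>"] by linarith
      also have "\<dots> \<le> norm (X t \<omega>) * (norm (X t \<omega>) * k)"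
        by (intro mult_left_mono k(2)) simp
      finally show "- (X t \<omega> \<bullet> (P *v X t \<omega>)) \<le> k * (norm (X t \<omega>))\<^sup>2"
        by (simp add: power2_eq_square mult_ac)
    qed
    also have "\<dots> = k * expectation (\<lambda>\<omega>. (norm (X t \<omega>))\<^sup>2)" by simp
    finally show ?thesis
      unfolding L2_nn_integral[OF energy(1)] using k(1)
      by (simp add: ennreal_leI flip: ennreal_mult)
  qed
  obtain S where S: "(\<integral>\<^sup>+\<omega>. (\<integral>\<^sup>+t\<in>{0..}. ennreal ((norm (X t \<omega>))\<^sup>2) \<partial>lborel) \<partial>M) = ennreal S" "0 \<le> S"
    using sq unfolding sq_integrable_def
    by (cases "\<integral>\<^sup>+\<omega>. (\<integral>\<^sup>+t\<in>{0..}. ennreal ((norm (X t \<omega>))\<^sup>2) \<partial>lborel) \<partial>M") auto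
  have bound: "\<delta> * T \<le> k * S" if T: "0 \<le> T" for T
  proof -
    have m: "(\<lambda>p. ennreal ((norm (X (fst p) (snd p)))\<^sup>2)) \<in> borel_measurable (time_space T)"
      using progressive_measurable[OF prog T] by simp
    have "ennreal (\<delta> * T) = (\<integral>\<^sup>+t. ennreal \<delta> * indicator {0..T} t \<partial>lborel)"
      using T \<delta> by (simp add: nn_integral_cmult_indicator ennreal_mult)
    also have "\<dots> \<le> (\<integral>\<^sup>+t. ennreal k * ((\<integral>\<^sup>+\<omega>. ennreal ((norm (X t \<omega>))\<^sup>2) \<partial>M) * indicator {0..T} t) \<partial>lborel)"
      using lower by (intro nn_integral_mono) (auto simp: indicator_def)
    also have "\<dots> = ennreal k * (\<integral>\<^sup>+p. ennreal ((norm (X (fst p) (snd p)))\<^sup>2) \<partial>time_space T)"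
      unfolding nn_integral_time_space_fst(1)[OF m]
      using nn_integral_time_space_fst(2)[OF m] by (subst nn_integral_cmult) auto
    also have "\<dots> \<le> ennreal k * ennreal S"
      using L2F_L2_time_space(2)[OF prog sq T] unfolding S(1) by (rule mult_left_mono) simp
    finally have "ennreal (\<delta> * T) \<le> ennreal (k * S)" using k(1) S(2) by (simp add: ennreal_mult)
    then show ?thesis using k(1) S(2) by (subst (asm) ennreal_le_iff) auto
  qed
  \<comment> \<open>A horizon just beyond \<open>k * S / \<delta>\<close>: the left-hand side is
    \<open>k * S + \<delta>\<close>.\<close>
  have "\<delta> * (k * S / \<delta> + 1) \<le> k * S"
    using k(1) S(2) \<delta> by (intro bound) simp
  then show False using \<delta> by (simp add: distrib_left)
qed

text \<open>The Lyapunov operator is injective on symmetric matrices, hence surjective; the summand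
  \<open>P - transpose P\<close> extends it to an injective endomorphism of the space of all matrices.\<close>

lemma L2_stable_lyapunov:
  fixes A C :: "real^'n^'n"
  assumes stable: "L2_stable M W A C"
  obtains P where "transpose P = P" "lyapunov_op A C P = - mat 1"
    "\<And>y. 0 \<le> y \<bullet> (P *v y)"
proof -
  interpret L: linear "lyapunov_op A C" by (rule linear_lyapunov_op)
  define F where "F P = lyapunov_op A C (P + transpose P) + (P - transpose P)" for P
  have lin: "linear F"
    unfolding F_def
    by (rule linearI)
      (simp_all add: L.add L.scale transpose_add transpose_scalar algebra_simps)
  \<comment> \<open>Adding the transpose removes the antisymmetric summand of
    \<open>F\<close>.\<close>
  have F_sym: "F P + transpose (F P) = 2 *\<^sub>R lyapunov_op A C (P + transpose P)" for P
    by (simp add: F_def transpose_add transpose_diff transpose_lyapunov_op L.add scaleR_2 add_ac)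
  have "P = 0" if "F P = 0" for P
  proof -
    define S where "S = P + transpose P"
    have S: "transpose S = S" by (simp add: S_def transpose_add add.commute)
    have LS: "lyapunov_op A C S = 0"
      using F_sym[of P] that by (simp add: S_def transpose_def vec_eq_iff)
    \<comment> \<open>As \<open>S\<close> is annihilated, the sign condition holds for
      \<open>S\<close> and for \<open>- S\<close>, so the quadratic form vanishes.\<close>
    then have "0 \<le> y \<bullet> (S *v y)" for y
      by (intro L2_stable_quadratic_nonneg[OF stable S]) simp
    moreover have "0 \<le> y \<bullet> ((- S) *v y)" for y
    proof (rule L2_stable_quadratic_nonneg[OF stable])
      show "transpose (- S) = - S" using S by (simp add: transpose_def vec_eq_iff)
      show "z \<bullet> (lyapunov_op A C (- S) *v z) \<le> 0" for z by (simp add: L.neg LS)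
    qed
    ultimately have S0: "y \<bullet> (S *v y) = 0" for y
      using antisym[of "y \<bullet> (S *v y)" 0] by (simp add: uminus_matrix_vector_mult)
    have "y \<bullet> (S *v z) = 0" for y z
      using S0[of "y + z"] S0[of y] S0[of z] inner_matrix_symmetric[OF S, of y z]
      by (simp add: matrix_vector_right_distrib inner_add_left inner_add_right)
    then have "S *v z = 0" for z by (metis inner_eq_zero_iff)
    then have "S = 0" by (simp add: matrix_eq)
    moreover have "P - transpose P = 0" using that LS by (simp add: F_def S_def)
    ultimately have "2 *\<^sub>R P = 0" unfolding S_def scaleR_2 by (metis add.right_neutral eq_iff_diff_eq_0)
    then show "P = 0" by simp
  qed
  then have "inj F" using linear_injective_0[OF lin] by blast
  then have "surj F" by (rule linear_injective_imp_surjective[OF lin]) simp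
  then obtain Q where Q: "F Q = - mat 1" by (metis surjD)
  \<comment> \<open>The right-hand side \<open>- mat 1\<close> is symmetric, so symmetrising
    \<open>F Q = - mat 1\<close> yields the equation for \<open>P\<close> with a factor 2 on both
    sides.\<close>
  define P where "P = Q + transpose Q"
  have P: "transpose P = P" by (simp add: P_def transpose_add add.commute)
  have "transpose (- mat 1 :: real^'n^'n) = - mat 1"
    by (simp add: transpose_def mat_def vec_eq_iff)
  then have "2 *\<^sub>R lyapunov_op A C P = 2 *\<^sub>R (- mat 1)"
    using F_sym[of Q] unfolding Q P_def by (simp only: scaleR_2)
  then have LP: "lyapunov_op A C P = - mat 1" by (simp only: scaleR_cancel_left) simp
  show thesis
  proof (rule that[OF P LP])
    show "0 \<le> y \<bullet> (P *v y)" for y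
      by (rule L2_stable_quadratic_nonneg[OF stable P]) (simp add: LP uminus_matrix_vector_mult)
  qed
qed

subsection \<open>Feedback controls\<close>

lemma L2F_add:
  fixes \<phi> \<psi> :: "real \<Rightarrow> 'a \<Rightarrow> 'b::euclidean_space"
  assumes \<phi>: "\<phi> \<in> L2F M W" and \<psi>: "\<psi> \<in> L2F M W"
  shows "(\<lambda>t \<omega>. \<phi> t \<omega> + \<psi> t \<omega>) \<in> L2F M W"
proof -
  let ?S = "\<lambda>\<phi>. \<integral>\<^sup>+\<omega>. (\<integral>\<^sup>+t\<in>{0..}. ennreal ((norm (\<phi> t \<omega> :: 'b))\<^sup>2) \<partial>lborel) \<partial>M"
  have \<phi>': "progressive M W \<phi>" "sq_integrable M \<phi>" and \<psi>': "progressive M W \<psi>" "sq_integrable M \<psi>"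
    using assms by (simp_all add: L2F_def)
  have prog: "progressive M W (\<lambda>t \<omega>. \<phi> t \<omega> + \<psi> t \<omega>)"
    using \<phi>'(1) \<psi>'(1) unfolding progressive_def split_beta by (auto intro!: borel_measurable_add)
  have "sq_integrable M (\<lambda>t \<omega>. \<phi> t \<omega> + \<psi> t \<omega>)"
  proof (rule sq_integrableI[OF prog, of "2 * ?S \<phi> + 2 * ?S \<psi>"])
    show "2 * ?S \<phi> + 2 * ?S \<psi> < \<infinity>"
      using \<phi>'(2) \<psi>'(2) by (simp add: sq_integrable_def ennreal_mult_less_top)
    fix T :: real assume T: "0 \<le> T"
    have "(\<integral>\<^sup>+p. ennreal ((norm (\<phi> (fst p) (snd p) + \<psi> (fst p) (snd p)))\<^sup>2) \<partial>time_space T) \<le>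
        2 * (\<integral>\<^sup>+p. ennreal ((norm (\<phi> (fst p) (snd p)))\<^sup>2) \<partial>time_space T) +
        2 * (\<integral>\<^sup>+p. ennreal ((norm (\<psi> (fst p) (snd p)))\<^sup>2) \<partial>time_space T)"
      using T \<phi>'(1) \<psi>'(1) by (intro nn_integral_norm_add_le progressive_measurable)
    also have "\<dots> \<le> 2 * ?S \<phi> + 2 * ?S \<psi>"
      using L2F_L2_time_space(2)[OF \<phi>' T] L2F_L2_time_space(2)[OF \<psi>' T]
      by (intro add_mono mult_left_mono) auto
    finally show "(\<integral>\<^sup>+p. ennreal ((norm (\<phi> (fst p) (snd p) + \<psi> (fst p) (snd p)))\<^sup>2) \<partial>time_space T) \<le>
        2 * ?S \<phi> + 2 * ?S \<psi>" .
  qed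
  with prog show ?thesis by (simp add: L2F_def)
qed

lemma L2F_matrix_mult:
  fixes \<phi> :: "real \<Rightarrow> 'a \<Rightarrow> real^'n" and B :: "real^'n^'m"
  assumes "\<phi> \<in> L2F M W"
  shows "(\<lambda>t \<omega>. B *v \<phi> t \<omega>) \<in> L2F M W"
proof -
  let ?S = "\<integral>\<^sup>+\<omega>. (\<integral>\<^sup>+t\<in>{0..}. ennreal ((norm (\<phi> t \<omega>))\<^sup>2) \<partial>lborel) \<partial>M"
  have \<phi>: "progressive M W \<phi>" "sq_integrable M \<phi>" using assms by (simp_all add: L2F_def)
  obtain k where k: "k > 0" "\<And>y. (norm (B *v y))\<^sup>2 \<le> k * (norm y)\<^sup>2"
    by (rule matrix_vector_mult_bound[of B]) (rule that)
  have prog: "progressive M W (\<lambda>t \<omega>. B *v \<phi> t \<omega>)"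
    using \<phi>(1) unfolding progressive_def split_beta by (auto intro!: matrix_vector_mult_measurable)
  have "sq_integrable M (\<lambda>t \<omega>. B *v \<phi> t \<omega>)"
  proof (rule sq_integrableI[OF prog, of "ennreal k * ?S"])
    show "ennreal k * ?S < \<infinity>"
      using \<phi>(2) by (simp add: sq_integrable_def ennreal_mult_less_top)
    fix T :: real assume T: "0 \<le> T"
    have "(\<integral>\<^sup>+p. ennreal ((norm (B *v \<phi> (fst p) (snd p)))\<^sup>2) \<partial>time_space T) \<le>
        (\<integral>\<^sup>+p. ennreal k * ennreal ((norm (\<phi> (fst p) (snd p)))\<^sup>2) \<partial>time_space T)"
      using k by (intro nn_integral_mono) (auto simp flip: ennreal_mult intro!: ennreal_leI)
    also have "\<dots> = ennreal k * (\<integral>\<^sup>+p. ennreal ((norm (\<phi> (fst p) (snd p)))\<^sup>2) \<partial>time_space T)"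
      using progressive_measurable[OF \<phi>(1) T] by (intro nn_integral_cmult) simp
    also have "\<dots> \<le> ennreal k * ?S"
      by (rule mult_left_mono[OF L2F_L2_time_space(2)[OF \<phi> T]]) simp
    finally show "(\<integral>\<^sup>+p. ennreal ((norm (B *v \<phi> (fst p) (snd p)))\<^sup>2) \<partial>time_space T) \<le> ennreal k * ?S" .
  qed
  with prog show ?thesis by (simp add: L2F_def)
qed

lemma L2F_norm_integral_bounded:
  fixes \<phi> :: "real \<Rightarrow> 'a \<Rightarrow> 'b::euclidean_space"
  assumes "\<phi> \<in> L2F M W"
  obtains S where "0 \<le> S"
    "\<And>T. 0 \<le> T \<Longrightarrow> (\<integral>p. (norm (\<phi> (fst p) (snd p)))\<^sup>2 \<partial>time_space T) \<le> S"
proof -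
  have \<phi>: "progressive M W \<phi>" "sq_integrable M \<phi>" using assms by (simp_all add: L2F_def)
  obtain S where S: "(\<integral>\<^sup>+\<omega>. (\<integral>\<^sup>+t\<in>{0..}. ennreal ((norm (\<phi> t \<omega>))\<^sup>2) \<partial>lborel) \<partial>M) = ennreal S" "0 \<le> S"
    using \<phi>(2) unfolding sq_integrable_def
    by (cases "\<integral>\<^sup>+\<omega>. (\<integral>\<^sup>+t\<in>{0..}. ennreal ((norm (\<phi> t \<omega>))\<^sup>2) \<partial>lborel) \<partial>M") auto
  show thesis
  proof (rule that[OF S(2)])
    fix T :: real assume T: "0 \<le> T"
    show "(\<integral>p. (norm (\<phi> (fst p) (snd p)))\<^sup>2 \<partial>time_space T) \<le> S"
      using L2F_L2_time_space(2)[OF \<phi> T] S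
      by (simp add: L2_nn_integral[OF L2F_L2_time_space(1)[OF \<phi> T]] S(1))
  qed
qed

lemma L2_stable_sq_integrable:
  fixes X :: "real \<Rightarrow> 'a \<Rightarrow> real^'n"
  assumes stable: "L2_stable M W A C" and \<beta>: "\<beta> \<in> L2F M W" and \<gamma>: "\<gamma> \<in> L2F M W"
    and X: "sde_solution M W A C \<beta> \<gamma> x X"
  shows "sq_integrable M X"
proof -
  from stable obtain P where P: "transpose P = P" "lyapunov_op A C P = - mat 1"
    and nonneg: "\<And>y. 0 \<le> y \<bullet> (P *v y)"
    by (rule L2_stable_lyapunov) (rule that)
  obtain K where K: "K > 0"
    "\<And>y \<beta> \<gamma>. 2 * (\<beta> \<bullet> (P *v y)) + 2 * ((C *v y) \<bullet> (P *v \<gamma>)) + \<gamma> \<bullet> (P *v \<gamma>) \<le>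
      (norm y)\<^sup>2 / 2 + K * ((norm \<beta>)\<^sup>2 + (norm \<gamma>)\<^sup>2)"
    by (rule quadratic_perturbation_bound[of P C]) (rule that)
  obtain S where S: "0 \<le> S"
    "\<And>T. 0 \<le> T \<Longrightarrow> (\<integral>p. (norm (\<beta> (fst p) (snd p)))\<^sup>2 \<partial>time_space T) \<le> S"
    using \<beta> by (rule L2F_norm_integral_bounded) (rule that)
  obtain R where R: "0 \<le> R"
    "\<And>T. 0 \<le> T \<Longrightarrow> (\<integral>p. (norm (\<gamma> (fst p) (snd p)))\<^sup>2 \<partial>time_space T) \<le> R"
    using \<gamma> by (rule L2F_norm_integral_bounded) (rule that)
  have \<beta>': "progressive M W \<beta>" "sq_integrable M \<beta>" and \<gamma>': "progressive M W \<gamma>" "sq_integrable M \<gamma>"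
    using \<beta> \<gamma> by (simp_all add: L2F_def)
  \<comment> \<open>Twice the initial energy plus the cost of the inputs; the factor 2 undoes the
    half of the decay that was given up. It does not depend on \<open>T\<close>.\<close>
  define B where "B = 2 * (x \<bullet> (P *v x) + K * (S + R))"
  show ?thesis
  proof (rule sq_integrableI[OF sde_solutionD(1)[OF X], of "ennreal B"])
    fix T :: real assume T: "0 \<le> T"
    let ?X = "\<lambda>p. X (fst p) (snd p)" and ?\<beta> = "\<lambda>p. \<beta> (fst p) (snd p)" and ?\<gamma> = "\<lambda>p. \<gamma> (fst p) (snd p)"
    let ?E = "\<lambda>p. 2 * ((A *v ?X p + ?\<beta> p) \<bullet> (P *v ?X p)) +
        (C *v ?X p + ?\<gamma> p) \<bullet> (P *v (C *v ?X p + ?\<gamma> p))"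
    have \<beta>2: "L2 (time_space T) ?\<beta>" by (rule L2F_L2_time_space(1)[OF \<beta>' T])
    have \<gamma>2: "L2 (time_space T) ?\<gamma>" by (rule L2F_L2_time_space(1)[OF \<gamma>' T])
    have X2: "L2 (time_space T) ?X" by (rule sde_solution_L2[OF X T \<beta>2])
    note energy = sde_energy[OF X T \<beta>'(1) \<beta>2 P(1)]
    \<comment> \<open>The part quadratic in \<open>X\<close> is
      \<open>- (norm (?X p))\<^sup>2\<close> by the Lyapunov equation; all other terms contain an
      input.\<close>
    have pw: "?E p \<le> - (norm (?X p))\<^sup>2 / 2 + K * ((norm (?\<beta> p))\<^sup>2 + (norm (?\<gamma> p))\<^sup>2)" for p
    proof -
      have "?X p \<bullet> (lyapunov_op A C P *v ?X p) = - (norm (?X p))\<^sup>2"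
        by (simp add: P(2) uminus_matrix_vector_mult power2_norm_eq_inner)
      then have "?E p = - (norm (?X p))\<^sup>2 + (2 * (?\<beta> p \<bullet> (P *v ?X p)) +
          2 * ((C *v ?X p) \<bullet> (P *v ?\<gamma> p)) + ?\<gamma> p \<bullet> (P *v ?\<gamma> p))"
        using inner_matrix_symmetric[OF P(1), of "?\<gamma> p" "C *v ?X p"]
        by (simp add: lyapunov_op_quadratic[OF P(1)] inner_add_left inner_add_right
            matrix_vector_right_distrib)
      then show ?thesis using K(2)[of "?\<beta> p" "?X p" "?\<gamma> p"] by linarith
    qed
    have "0 \<le> expectation (\<lambda>\<omega>. X T \<omega> \<bullet> (P *v X T \<omega>))"
      using nonneg by (intro Bochner_Integration.integral_nonneg)
    also have "\<dots> = x \<bullet> (P *v x) + (\<integral>p. ?E p \<partial>time_space T)" by (rule energy(3))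
    also have "(\<integral>p. ?E p \<partial>time_space T) \<le>
        (\<integral>p. - (norm (?X p))\<^sup>2 / 2 + K * ((norm (?\<beta> p))\<^sup>2 + (norm (?\<gamma> p))\<^sup>2) \<partial>time_space T)"
      using X2 \<beta>2 \<gamma>2 pw by (intro integral_mono energy(2)) (simp_all add: L2_def)
    also have "\<dots> = - (\<integral>p. (norm (?X p))\<^sup>2 \<partial>time_space T) / 2 +
        K * ((\<integral>p. (norm (?\<beta> p))\<^sup>2 \<partial>time_space T) + (\<integral>p. (norm (?\<gamma> p))\<^sup>2 \<partial>time_space T))"
      using X2 \<beta>2 \<gamma>2 by (simp add: L2_def)
    also have "\<dots> \<le> - (\<integral>p. (norm (?X p))\<^sup>2 \<partial>time_space T) / 2 + K * (S + R)"
      using K(1) S(2)[OF T] R(2)[OF T] by (intro add_left_mono mult_left_mono add_mono) auto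
    finally have "(\<integral>p. (norm (?X p))\<^sup>2 \<partial>time_space T) \<le> B"
      by (simp add: B_def)
    then show "(\<integral>\<^sup>+p. ennreal ((norm (?X p))\<^sup>2) \<partial>time_space T) \<le> ennreal B"
      unfolding L2_nn_integral[OF X2] by (rule ennreal_leI)
  qed simp
qed

text \<open>Admissibility speaks of all solutions for a control, whereas the arguments produce one
  square integrable solution; uniqueness transfers the property to the others.\<close>

lemma sq_integrable_of_sde_solution:
  fixes X Y :: "real \<Rightarrow> 'a \<Rightarrow> real^'n"
  assumes X: "sde_solution M W A C \<beta> \<gamma> x X" and Y: "sde_solution M W A C \<beta> \<gamma> x Y"
    and \<beta>: "\<beta> \<in> L2F M W" and sq: "sq_integrable M X"
  shows "sq_integrable M Y"
proof -
  let ?S = "\<integral>\<^sup>+\<omega>. (\<integral>\<^sup>+t\<in>{0..}. ennreal ((norm (X t \<omega>))\<^sup>2) \<partial>lborel) \<partial>M"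
  have \<beta>': "progressive M W \<beta>" "sq_integrable M \<beta>" using \<beta> by (simp_all add: L2F_def)
  note progX = sde_solutionD(1)[OF X] and progY = sde_solutionD(1)[OF Y]
  show ?thesis
  proof (rule sq_integrableI[OF progY, of "2 * ?S"])
    show "2 * ?S < \<infinity>" using sq by (simp add: sq_integrable_def ennreal_mult_less_top)
    fix T :: real assume T: "0 \<le> T"
    let ?X = "\<lambda>p. X (fst p) (snd p)" and ?Y = "\<lambda>p. Y (fst p) (snd p)"
    note mX = progressive_measurable[OF progX T] and mY = progressive_measurable[OF progY T]
    have "(\<integral>\<^sup>+p. ennreal ((norm (?Y p))\<^sup>2) \<partial>time_space T) =
        (\<integral>\<^sup>+p. ennreal ((norm (?X p + (?Y p - ?X p)))\<^sup>2) \<partial>time_space T)" by simp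
    also have "\<dots> \<le> 2 * (\<integral>\<^sup>+p. ennreal ((norm (?X p))\<^sup>2) \<partial>time_space T) +
        2 * (\<integral>\<^sup>+p. ennreal ((norm (?Y p - ?X p))\<^sup>2) \<partial>time_space T)"
      using mX mY by (intro nn_integral_norm_add_le) auto
    also have "(\<integral>\<^sup>+p. ennreal ((norm (?Y p - ?X p))\<^sup>2) \<partial>time_space T) = 0"
      by (rule sde_solution_unique[OF Y X \<beta>'(1) L2F_L2_time_space(1)[OF \<beta>'] T])
    also have "2 * (\<integral>\<^sup>+p. ennreal ((norm (?X p))\<^sup>2) \<partial>time_space T) + 2 * 0 \<le> 2 * ?S"
      using L2F_L2_time_space(2)[OF progX sq T] by (simp add: mult_left_mono)
    finally show "(\<integral>\<^sup>+p. ennreal ((norm (?Y p))\<^sup>2) \<partial>time_space T) \<le> 2 * ?S" .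
  qed
qed

end

section \<open>Equivalence of the open-loop and closed-loop equations\<close>

lemma controlled_solution_feedback:
  fixes A C :: "real^'n^'n" and B D :: "real^'m^'n" and \<Theta> :: "real^'n^'m"
  shows
  "controlled_solution M W (A + B ** \<Theta>) (C + D ** \<Theta>) B D b \<sigma> x v X \<longleftrightarrow>
    controlled_solution M W A C B D b \<sigma> x (\<lambda>t \<omega>. \<Theta> *v X t \<omega> + v t \<omega>) X"
proof -
  have eq: "(F + G ** \<Theta>) *v y + (G *v w + z) = F *v y + (G *v (\<Theta> *v y + w) + z)"
    for F :: "real^'n^'n" and G :: "real^'m^'n" and y z w
    by (simp add: matrix_vector_mult_add_rdistrib matrix_vector_right_distrib
        matrix_vector_mul_assoc add.assoc)
  show ?thesis unfolding controlled_solution_def sde_solution_def eq ..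
qed

text \<open>Both sides are sets of processes, not of equivalence classes: the right-hand side runs
  through all versions of the closed-loop solution, and an admissible \<open>u\<close> is recovered
  from its \<open>X\<close> and \<open>v\<close> exactly, at every time and outcome.\<close>

theorem proposition3p3:
  fixes M :: "'a measure" and W :: "real \<Rightarrow> 'a \<Rightarrow> real"
    and A C :: "real^'n^'n" and B D :: "real^'m^'n"
    and b \<sigma> :: "real \<Rightarrow> 'a \<Rightarrow> real^'n"
    and \<Theta> :: "real^'n^'m"
  assumes "brownian_basis M W"
    and "b \<in> L2F M W" and "\<sigma> \<in> L2F M W"
    and "\<Theta> \<in> stabilizers M W A C B D"
  shows "\<forall>x. admissible_controls M W A C B D b \<sigma> x =
    {(\<lambda>t \<omega>. \<Theta> *v X\<^sub>\<Theta> t \<omega> + v t \<omega>) | X\<^sub>\<Theta> v.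
       v \<in> L2F M W \<and>
       controlled_solution M W (A + B ** \<Theta>) (C + D ** \<Theta>) B D b \<sigma> x v X\<^sub>\<Theta>}"
proof (intro allI equalityI subsetI)
  interpret brownian M W by unfold_locales (rule assms(1))
  fix x :: "real^'n" and u :: "real \<Rightarrow> 'a \<Rightarrow> real^'m"
  {
    assume "u \<in> admissible_controls M W A C B D b \<sigma> x"
    then obtain X where u: "u \<in> L2F M W" and X: "controlled_solution M W A C B D b \<sigma> x u X"
      and sq: "sq_integrable M X"
      unfolding admissible_controls_def by blast
    \<comment> \<open>Solving \<open>u = \<Theta> X + v\<close> for \<open>v\<close>; square
      integrability of \<open>X\<close>, which admissibility contains, makes it an allowed
      input.\<close>
    define v where "v t \<omega> = (- \<Theta>) *v X t \<omega> + u t \<omega>" for t \<omega>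
    have u_eq: "u = (\<lambda>t \<omega>. \<Theta> *v X t \<omega> + v t \<omega>)"
      by (simp add: v_def uminus_matrix_vector_mult)
    have "X \<in> L2F M W"
      using sq sde_solutionD(1) X unfolding controlled_solution_def L2F_def by blast
    then have "v \<in> L2F M W"
      unfolding v_def using u by (intro L2F_add L2F_matrix_mult)
    moreover have "controlled_solution M W (A + B ** \<Theta>) (C + D ** \<Theta>) B D b \<sigma> x v X"
      using X unfolding controlled_solution_feedback u_eq[symmetric] .
    ultimately show "u \<in> {(\<lambda>t \<omega>. \<Theta> *v X\<^sub>\<Theta> t \<omega> + v t \<omega>) | X\<^sub>\<Theta> v. v \<in> L2F M W \<and>
       controlled_solution M W (A + B ** \<Theta>) (C + D ** \<Theta>) B D b \<sigma> x v X\<^sub>\<Theta>}"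
      using u_eq by blast
  next
    assume "u \<in> {(\<lambda>t \<omega>. \<Theta> *v X\<^sub>\<Theta> t \<omega> + v t \<omega>) | X\<^sub>\<Theta> v. v \<in> L2F M W \<and>
       controlled_solution M W (A + B ** \<Theta>) (C + D ** \<Theta>) B D b \<sigma> x v X\<^sub>\<Theta>}"
    then obtain X v where u_eq: "u = (\<lambda>t \<omega>. \<Theta> *v X t \<omega> + v t \<omega>)" and v: "v \<in> L2F M W"
      and X: "controlled_solution M W (A + B ** \<Theta>) (C + D ** \<Theta>) B D b \<sigma> x v X"
      by blast
    have input: "(\<lambda>t \<omega>. G *v w t \<omega> + z t \<omega>) \<in> L2F M W"
      if "w \<in> L2F M W" "z \<in> L2F M W" for G :: "real^'m^'n" and w z
      using that by (intro L2F_add L2F_matrix_mult)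
    have "L2_stable M W (A + B ** \<Theta>) (C + D ** \<Theta>)"
      using assms(4) by (simp add: stabilizers_def)
    then have sq: "sq_integrable M X"
      by (rule L2_stable_sq_integrable[OF _ input[OF v assms(2)] input[OF v assms(3)]
            X[unfolded controlled_solution_def]])
    then have "X \<in> L2F M W"
      using sde_solutionD(1) X unfolding controlled_solution_def L2F_def by blast
    then have u: "u \<in> L2F M W"
      unfolding u_eq using v by (intro L2F_add L2F_matrix_mult)
    have X': "controlled_solution M W A C B D b \<sigma> x u X"
      using X unfolding controlled_solution_feedback u_eq .
    \<comment> \<open>With \<open>u\<close> now fixed, \<open>Y\<close> may be any other solution of
      the open-loop equation, and need not be the \<open>X\<close> from which \<open>u\<close> was
      built.\<close>
    have "sq_integrable M Y" if "controlled_solution M W A C B D b \<sigma> x u Y" for Y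
      by (rule sq_integrable_of_sde_solution[OF X'[unfolded controlled_solution_def]
            that[unfolded controlled_solution_def] input[OF u assms(2)] sq])
    with u X' show "u \<in> admissible_controls M W A C B D b \<sigma> x"
      unfolding admissible_controls_def by blast
  }
qed

end
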